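(* Let $\theta_H$ and $q_\mu$ be as defined in the context. (i) When $\omega$ is decreasing, a free public option is optimal if and only if either (a) $\mathbf E[\omega]>\alpha$, or (b) $\mathbf E[\omega]\le\alpha$ and \[\int_{\underline\theta}^{\theta_H(0)}v(q_0(s))\,ds+\underline\theta v(q_0(\underline\theta))<U^{\mathrm{LF}}(\theta_H(0)).\] (ii) When $\omega$ is increasing, a free public option is optimal if and only if $\mathbf E[\omega]>\alpha$.
   Context: Primitives: constants $A>0$, $c>0$, $0<\underline\theta<\overline\theta$; a function $v:[0,A]\to[0,\infty)$, twice continuously differentiable with $v'>0$ and $v''<0$; an absolutely continuous cumulative distribution function $F$ with positive density $f$ on $[\underline\theta,\overline\theta]$; a continuous function $\omega:[\underline\theta,\overline\theta]\to[0,\infty)$ (welfare weights); a constant $\alpha>0$ (welfare weight of profit). "Increasing" and "decreasing" are meant strictly. $\mathbf E[\omega]=\int\omega\,dF$. Laissez-faire: $U^{\mathrm{LF}}(\theta)=\max_{q\in[0,A]}[\theta v(q)-cq]$. A mechanism is a pair $(q,t)$ with $q:[\underline\theta,\overline\theta]\to[0,A]$ and $t:[\underline\theta,\overline\theta]\to\mathbb R$. It is feasible if it satisfies, for all $\theta$: (IC) $\theta\in\arg\max_{\theta'}[\theta v(q(\theta'))-t(\theta')]$; (IR) $\theta v(q(\theta))-t(\theta)\ge U^{\mathrm{LF}}(\theta)$; (LS) $t(\theta)\ge 0$. The social planner maximizes, over feasible mechanisms, $\int_{\underline\theta}^{\overline\theta}\big[\omega(\theta)[\theta v(q(\theta))-t(\theta)]+\alpha[t(\theta)-cq(\theta)]\big]\,dF(\theta)$.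 The optimal mechanism $(q^*,t^* )$ is a solution; the optimal allocation function is (essentially) unique and the optimal payment function is unique when $\mathbf E[\omega]\ne\alpha$; when $\mathbf E[\omega]=\alpha$, $(q^*,t^* )$ denotes the optimal mechanism with pointwise smallest payment function. Free public option: "a free public option is optimal" means that the lowest quality level is given for free to an interval of the lowest types and that the no-lump-sum-transfer constraint is binding with positive shadow cost, i.e. there is $\varepsilon>0$ such that $q^*$ is constant and $t^*=0$ on $(\underline\theta,\underline\theta+\varepsilon)$, and dropping the constraint (LS) from the planner's problem strictly increases its supremum (possibly to $+\infty$). Demand: for $x\in\mathbb R$, $D(c,x)$ is the unique maximizer of $q\mapsto x v(q)-cq$ over $[0,A]$. Ironing: for a function $h$ on $[\underline\theta,\overline\theta]$, its ironed version is the nondecreasing function $\overline h(\theta)=-\frac{d}{dz}\Big(\mathrm{co}\,\Phi_h\Big)(z)\Big|_{z=F(\theta)}$, where $\Phi_h(z)=\int_{F^{-1}(z)}^{\overline\theta}h(s)\,dF(s)$ for $z\in[0,1]$ and $\mathrm{co}\,\Phi$ is the pointwise smallest concave function that is no smaller than $\Phi$ (one-sided derivatives at endpoints). Definitions of $q_0$ and $\theta_H(0)$ (the objects $q_\mu$, $\theta_H(\mu)$ at $\mu=0$, the only value used in the claim): $q_0(\theta)=D(c,\overline{H_0}(\theta))$ with $H_0(\theta)=\theta+\frac{\int_{\underline\theta}^{\theta}[\alpha-\omega(s)]\,dF(s)}{\alpha f(\theta)}$; and, when $\mathbf E[\omega]\le\alpha$, $\theta_H(0)=\max\{\theta\in[\underline\theta,\overline\theta]:\int_{\underline\theta}^{\theta}[\alpha-\omega(s)]\,dF(s)\le0\}$.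 *)

theory Defs
  imports "HOL-Probability.Probability"
begin

text \<open>Types are distributed on \<open>{lo..hi}\<close> with density \<open>f\<close>. Functions on \<open>{lo..hi}\<close> (or on
  \<open>{0..A}\<close>) are total functions on the reals whose values elsewhere are irrelevant.\<close>

definition type_dist :: "real \<Rightarrow> real \<Rightarrow> (real \<Rightarrow> real) \<Rightarrow> real measure" where
  "type_dist lo hi f = density lborel (\<lambda>s. ennreal (indicator {lo..hi} s * f s))"

definition concave_envelope :: "(real \<Rightarrow> real) \<Rightarrow> real \<Rightarrow> real" where
  "concave_envelope \<Phi> z =
     Inf {g z | g. concave_on {0..1} g \<and> (\<forall>x\<in>{0..1}. \<Phi> x \<le> g x)}"

locale screening =
  fixes A c lo hi :: real
    and v v' v'' :: "real \<Rightarrow> real"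
    and f \<omega> :: "real \<Rightarrow> real"
    and \<alpha> :: real
  assumes A_pos: "0 < A"
    and c_pos: "0 < c"
    and lo_pos: "0 < lo"
    and lo_less_hi: "lo < hi"
    and v_nonneg: "\<And>q. q \<in> {0..A} \<Longrightarrow> 0 \<le> v q"
    and v_deriv: "\<And>q. q \<in> {0..A} \<Longrightarrow> (v has_real_derivative v' q) (at q within {0..A})"
    and v'_deriv: "\<And>q. q \<in> {0..A} \<Longrightarrow> (v' has_real_derivative v'' q) (at q within {0..A})"
    and v''_cont: "continuous_on {0..A} v''"
    and v'_pos: "\<And>q. q \<in> {0..A} \<Longrightarrow> 0 < v' q"
    and v''_neg: "\<And>q. q \<in> {0..A} \<Longrightarrow> v'' q < 0"
    and f_meas: "set_borel_measurable borel {lo..hi} f"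
    and f_pos: "\<And>\<theta>. \<theta> \<in> {lo..hi} \<Longrightarrow> 0 < f \<theta>"
    and type_dist_prob: "prob_space (type_dist lo hi f)"
    and \<omega>_cont: "continuous_on {lo..hi} \<omega>"
    and \<omega>_nonneg: "\<And>\<theta>. \<theta> \<in> {lo..hi} \<Longrightarrow> 0 \<le> \<omega> \<theta>"
    and \<alpha>_pos: "0 < \<alpha>"
begin

definition F :: "real \<Rightarrow> real" where
  "F = cdf (type_dist lo hi f)"

definition mean_weight :: real where
  "mean_weight = (LINT s:{lo..hi}|type_dist lo hi f. \<omega> s)"

definition U_LF :: "real \<Rightarrow> real" where
  "U_LF \<theta> = (SUP q\<in>{0..A}. \<theta> * v q - c * q)"

definition demand :: "real \<Rightarrow> real" where
  "demand x = (THE q. q \<in> {0..A} \<and> (\<forall>q'\<in>{0..A}. x * v q' - c * q' \<le> x * v q - c * q))"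

text \<open>Feasibility without the no-lump-sum-transfer constraint.\<close>

definition feasible_noLS :: "(real \<Rightarrow> real) \<Rightarrow> (real \<Rightarrow> real) \<Rightarrow> bool" where
  "feasible_noLS q t \<longleftrightarrow>
     (\<forall>\<theta>\<in>{lo..hi}. q \<theta> \<in> {0..A}) \<and>
     (\<forall>\<theta>\<in>{lo..hi}. \<forall>\<theta>'\<in>{lo..hi}. \<theta> * v (q \<theta>') - t \<theta>' \<le> \<theta> * v (q \<theta>) - t \<theta>) \<and>
     (\<forall>\<theta>\<in>{lo..hi}. U_LF \<theta> \<le> \<theta> * v (q \<theta>) - t \<theta>)"

definition feasible :: "(real \<Rightarrow> real) \<Rightarrow> (real \<Rightarrow> real) \<Rightarrow> bool" where
  "feasible q t \<longleftrightarrow> feasible_noLS q t \<and> (\<forall>\<theta>\<in>{lo..hi}. 0 \<le> t \<theta>)"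

text \<open>Incentive compatibility makes \<open>q\<close> and \<open>t\<close> bounded and monotone, so the integral below
  exists for every mechanism satisfying \<open>feasible_noLS\<close>.\<close>

definition welfare :: "(real \<Rightarrow> real) \<Rightarrow> (real \<Rightarrow> real) \<Rightarrow> real" where
  "welfare q t =
     (LINT \<theta>:{lo..hi}|type_dist lo hi f.
        \<omega> \<theta> * (\<theta> * v (q \<theta>) - t \<theta>) + \<alpha> * (t \<theta> - c * q \<theta>))"

definition planner_solution :: "(real \<Rightarrow> real) \<Rightarrow> (real \<Rightarrow> real) \<Rightarrow> bool" where
  "planner_solution q t \<longleftrightarrow>
     feasible q t \<and> (\<forall>q' t'. feasible q' t' \<longrightarrow> welfare q' t' \<le> welfare q t)"

text \<open>If the mean welfare weight equals \<open>\<alpha>\<close>, the level of payments is indeterminate and the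
  solution with the pointwise smallest payment function is selected.\<close>

definition optimal_mechanism :: "(real \<Rightarrow> real) \<Rightarrow> (real \<Rightarrow> real) \<Rightarrow> bool" where
  "optimal_mechanism q t \<longleftrightarrow>
     planner_solution q t \<and>
     (mean_weight = \<alpha> \<longrightarrow>
        (\<forall>q' t'. planner_solution q' t' \<longrightarrow> (\<forall>\<theta>\<in>{lo..hi}. t \<theta> \<le> t' \<theta>)))"

text \<open>The optimal mechanism is unique only up to the countably many jump points of \<open>q\<close> and the
  endpoints of \<open>{lo..hi}\<close>; being constant on an open interval does not depend on the version.
  The suprema are taken in \<^typ>\<open>ereal\<close>, as the one without the no-lump-sum-transfer constraint can
  be infinite.\<close>

definition free_public_option_optimal :: bool where
  "free_public_option_optimal \<longleftrightarrow>
     (\<exists>q t. optimal_mechanism q t \<and>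
        (\<exists>\<epsilon>>0. lo + \<epsilon> \<le> hi \<and>
           (\<exists>q\<^sub>0. \<forall>\<theta>\<in>{lo<..<lo + \<epsilon>}. q \<theta> = q\<^sub>0 \<and> t \<theta> = 0))) \<and>
     (SUP (q, t)\<in>{(q, t). feasible q t}. ereal (welfare q t))
       < (SUP (q, t)\<in>{(q, t). feasible_noLS q t}. ereal (welfare q t))"

definition tail_integral :: "(real \<Rightarrow> real) \<Rightarrow> real \<Rightarrow> real" where
  "tail_integral h z =
     (LINT s:{the_inv_into {lo..hi} F z..hi}|type_dist lo hi f. h s)"

text \<open>At the (at most countably many) kinks of the concave envelope the right derivative is used,
  which makes the ironed function nondecreasing on \<open>{lo..<hi}\<close>. At \<open>hi\<close> the left derivative is
  used; it may be infinite, in which case the value there is unspecified, but this single type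
  carries no mass.\<close>

definition ironed :: "(real \<Rightarrow> real) \<Rightarrow> real \<Rightarrow> real" where
  "ironed h \<theta> =
     - vector_derivative (concave_envelope (tail_integral h))
         (if F \<theta> < 1 then at_right (F \<theta>) else at_left (F \<theta>))"

definition cum_gap :: "real \<Rightarrow> real" where
  "cum_gap \<theta> = (LINT s:{lo..\<theta>}|type_dist lo hi f. \<alpha> - \<omega> s)"

definition H0 :: "real \<Rightarrow> real" where
  "H0 \<theta> = \<theta> + cum_gap \<theta> / (\<alpha> * f \<theta>)"

definition q0 :: "real \<Rightarrow> real" where
  "q0 \<theta> = demand (ironed H0 \<theta>)"

definition \<theta>H0 :: real where
  "\<theta>H0 = (GREATEST \<theta>. \<theta> \<in> {lo..hi} \<and> cum_gap \<theta> \<le> 0)"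

end

end

theory Submission
  imports Defs
begin

text \<open>An incentive compatible mechanism is a nondecreasing allocation \<open>x = v \<circ> q\<close> together with the
  rent of the lowest type, and the no-lump-sum constraint involves only that rent and \<open>x lo\<close>. The
  problem is concave. Hence, if dropping the constraint pays, a small step towards a better
  unconstrained mechanism must be infeasible at the optimum: payments vanish at the bottom, and if
  the lowest types were not pooled, raising their allocation to the level that restores feasibility
  would cost only to second order. So a free public option is optimal iff the constraint is costly.

  If the mean weight exceeds \<open>\<alpha>\<close>, unlimited lump sums are profitable. If \<open>\<omega>\<close> increases and its mean is
  at most \<open>\<alpha>\<close>, every mechanism is improved by one giving the lowest type its laissez-faire rent, which
  needs no lump sum. If \<open>\<omega>\<close> decreases and its mean is at most \<open>\<alpha>\<close>, the unconstrained optimum is the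
  ironed allocation \<open>q0\<close> below \<open>\<theta>H0\<close> and laissez-faire above, and condition (b) says that it violates the
  constraint; as the optimum is unique, the constraint is then costly.\<close>

section \<open>Bounded Borel functions and Fubini\<close>

text \<open>Two obstacles shape the details. The constraint \<open>no_subsidy\<close> looks at the
  single value \<open>x lo\<close>, while rents and welfare see an allocation only up to null sets;
  so versions of \<open>x\<close> built from one-sided limits appear wherever existence, pooling or
  the value \<open>q0 lo\<close> matters. And \<open>f\<close> is only measurable and positive, so
  \<open>H0\<close> may be unbounded; ironing therefore never integrates against
  \<open>ironed H0\<close> but works with supergradients of the concave envelope. Optimality of the
  ironed allocation is shown level by level: a monotone allocation serves a quality level
  \<open>r\<close> to the types above one threshold \<open>\<tau>\<close>, and this contributes, up
  to a factor and a constant, \<open>P \<tau> + c / v' r * F \<tau>\<close>, where \<open>P\<close>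
  is the tail integral in type coordinates. The best threshold is where the ironed function crosses
  \<open>c / v' r\<close>; integration over \<open>r\<close> gives the claim. Existence of an
  optimum rests on Helly's selection theorem.\<close>

definition bdd_borel :: "(real \<Rightarrow> real) \<Rightarrow> bool" where
  "bdd_borel h \<longleftrightarrow> h \<in> borel_measurable borel \<and> (\<exists>B. \<forall>x. \<bar>h x\<bar> \<le> B)"

lemma bdd_borelI: "h \<in> borel_measurable borel \<Longrightarrow> (\<And>x. \<bar>h x\<bar> \<le> B) \<Longrightarrow> bdd_borel h"
  by (auto simp: bdd_borel_def)

lemma bdd_borel_measurable: "bdd_borel h \<Longrightarrow> h \<in> borel_measurable borel"
  by (auto simp: bdd_borel_def)

lemma bdd_borel_bound:
  assumes "bdd_borel h" obtains B where "0 \<le> B" "\<And>x. \<bar>h x\<bar> \<le> B"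
  using assms unfolding bdd_borel_def by (meson abs_ge_zero order_trans)

lemma bdd_borel_const: "bdd_borel (\<lambda>_. k)"
  by (rule bdd_borelI[of _ "\<bar>k\<bar>"]) auto

lemma bdd_borel_indicator: "S \<in> sets borel \<Longrightarrow> bdd_borel (indicator S)"
  by (rule bdd_borelI[of _ 1]) (auto simp: indicator_def)

lemma bdd_borel_add: assumes "bdd_borel g" "bdd_borel h" shows "bdd_borel (\<lambda>x. g x + h x)"
proof -
  obtain B C where "\<And>x. \<bar>g x\<bar> \<le> B" "\<And>x. \<bar>h x\<bar> \<le> C"
    using assms by (metis bdd_borel_bound)
  then have "\<bar>g x + h x\<bar> \<le> B + C" for x
    by (meson abs_triangle_ineq add_mono order_trans)
  then show ?thesis
    using assms by (intro bdd_borelI[of _ "B + C"]) (auto simp: bdd_borel_def)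
qed

lemma bdd_borel_mult: assumes "bdd_borel g" "bdd_borel h" shows "bdd_borel (\<lambda>x. g x * h x)"
proof -
  obtain B C where "0 \<le> B" "\<And>x. \<bar>g x\<bar> \<le> B" "\<And>x. \<bar>h x\<bar> \<le> C"
    using assms by (metis bdd_borel_bound)
  then have "\<bar>g x * h x\<bar> \<le> B * C" for x
    by (simp add: abs_mult mult_mono')
  then show ?thesis
    using assms by (intro bdd_borelI[of _ "B * C"]) (auto simp: bdd_borel_def)
qed

lemma bdd_borel_diff: assumes "bdd_borel g" "bdd_borel h" shows "bdd_borel (\<lambda>x. g x - h x)"
  using bdd_borel_add[OF assms(1) bdd_borel_mult[OF bdd_borel_const[of "-1"] assms(2)]] by simp

lemma bdd_borel_divide: assumes "bdd_borel g" shows "bdd_borel (\<lambda>x. g x / k)"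
  using bdd_borel_mult[OF assms bdd_borel_const[of "1 / k"]] by simp

lemma bdd_borel_mono: "mono h \<Longrightarrow> (\<And>x. \<bar>h x\<bar> \<le> B) \<Longrightarrow> bdd_borel h"
  by (intro bdd_borelI borel_measurable_mono)

lemma bdd_borel_integrable:
  assumes "finite_measure N" "sets N = sets borel" "bdd_borel h"
  shows "integrable N h"
proof -
  interpret finite_measure N by fact
  obtain B where "\<And>x. \<bar>h x\<bar> \<le> B" using assms(3) by (metis bdd_borel_bound)
  moreover have "h \<in> borel_measurable N"
    using assms bdd_borel_measurable[OF assms(3)] measurable_cong_sets[OF assms(2) refl] by blast
  ultimately show ?thesis
    by (intro integrable_const_bound[of _ B]) auto
qed

lemmas bdd_borel_intros =
  bdd_borel_const bdd_borel_indicator bdd_borel_add bdd_borel_mult bdd_borel_diff bdd_borel_divide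

text \<open>Serves two purposes. With \<open>q\<close> the identity and Lebesgue measure on types it
  is integration by parts for rents; with \<open>q\<close> an allocation and Lebesgue measure on
  qualities it splits utilities and costs into quality levels.\<close>

lemma Fubini_below_graph:
  assumes N: "finite_measure N" "sets N = sets borel" and R: "finite_measure R" "sets R = sets borel"
    and a: "bdd_borel a" and b: "bdd_borel b" and q: "q \<in> borel_measurable borel"
  shows "(\<integral>\<theta>. a \<theta> * (\<integral>s. indicator {..<q \<theta>} s * b s \<partial>R) \<partial>N)
       = (\<integral>s. b s * (\<integral>\<theta>. a \<theta> * indicator {..<q \<theta>} s \<partial>N) \<partial>R)"
proof -
  interpret N: finite_measure N by fact
  interpret R: finite_measure R by fact
  interpret NR: pair_sigma_finite N R ..
  interpret P: finite_measure "N \<Otimes>\<^sub>M R"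
    by (rule finite_measure_pair_measure) fact+
  obtain Ba Bb where B: "0 \<le> Ba" "\<And>x. \<bar>a x\<bar> \<le> Ba" "0 \<le> Bb" "\<And>x. \<bar>b x\<bar> \<le> Bb"
    using a b by (metis bdd_borel_bound)
  have sets: "sets (N \<Otimes>\<^sub>M R) = sets (borel \<Otimes>\<^sub>M borel)"
    using N R by (intro sets_pair_measure_cong) auto
  have [measurable]: "a \<in> borel_measurable borel" "b \<in> borel_measurable borel" "q \<in> borel_measurable borel"
    using a b q by (auto simp: bdd_borel_def)
  let ?k = "\<lambda>\<theta> s. a \<theta> * (indicator {..<q \<theta>} s * b s)"
  \<comment> \<open>Membership in a set that depends on \<open>\<theta>\<close> becomes a
    comparison, which is jointly measurable.\<close>
  have k_eq: "?k \<theta> s = a \<theta> * ((if s < q \<theta> then 1 else 0) * b s)" for \<theta> s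
    by (auto simp: indicator_def)
  have "case_prod ?k \<in> borel_measurable (borel \<Otimes>\<^sub>M borel)"
    unfolding k_eq by measurable
  then have m: "case_prod ?k \<in> borel_measurable (N \<Otimes>\<^sub>M R)"
    using measurable_cong_sets[OF sets refl] by blast
  have bd: "\<bar>?k \<theta> s\<bar> \<le> Ba * Bb" for \<theta> s
    using B by (auto simp: abs_mult indicator_def intro!: mult_mono mult_nonneg_nonneg)
  have "integrable (N \<Otimes>\<^sub>M R) (case_prod ?k)"
    using m bd by (intro P.integrable_const_bound[of _ "Ba * Bb"]) auto
  from NR.Fubini_integral[OF this]
  have "(\<integral>s. (\<integral>\<theta>. ?k \<theta> s \<partial>N) \<partial>R) = (\<integral>\<theta>. (\<integral>s. ?k \<theta> s \<partial>R) \<partial>N)" .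
  moreover have "(\<integral>\<theta>. ?k \<theta> s \<partial>N) = b s * (\<integral>\<theta>. a \<theta> * indicator {..<q \<theta>} s \<partial>N)" for s
    by (subst integral_mult_right_zero[symmetric], rule Bochner_Integration.integral_cong)
       (auto simp: algebra_simps)
  ultimately show ?thesis by simp
qed

text \<open>The increments of \<open>N\<close> and \<open>I\<close> lie between the same two bounds,
  so they differ by at most \<open>(g t - g s) * (t - s)\<close>. Over a uniform partition into
  \<open>n\<close> pieces these errors telescope to \<open>(g b - g a) * (b - a) / n\<close>. This
  replaces differentiation in the envelope theorem.\<close>

lemma integral_squeeze_eq:
  fixes N I g :: "real \<Rightarrow> real"
  assumes "a \<le> b"
    and lower: "\<And>s t. a \<le> s \<Longrightarrow> s \<le> t \<Longrightarrow> t \<le> b \<Longrightarrow> g s * (t - s) \<le> N t - N s \<and> g s * (t - s) \<le> I t - I s"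
    and upper: "\<And>s t. a \<le> s \<Longrightarrow> s \<le> t \<Longrightarrow> t \<le> b \<Longrightarrow> N t - N s \<le> g t * (t - s) \<and> I t - I s \<le> g t * (t - s)"
  shows "N b - N a = I b - I a"
proof -
  define D where "D t = N t - I t" for t
  have D: "\<bar>D t - D s\<bar> \<le> (g t - g s) * (t - s)" if "a \<le> s" "s \<le> t" "t \<le> b" for s t
    using lower[OF that] upper[OF that] unfolding D_def left_diff_distrib by linarith
  have bound: "\<bar>D b - D a\<bar> \<le> (g b - g a) * (b - a) / real (Suc n)" for n
  proof -
    define p where "p i = a + real i * ((b - a) / real (Suc n))" for i
    have p0: "p 0 = a" and pn: "p (Suc n) = b"
      by (auto simp: p_def)
    have step: "p (Suc i) - p i = (b - a) / real (Suc n)" for i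
      unfolding p_def of_nat_Suc[of i] distrib_right by simp
    have mono: "p i \<le> p j" if "i \<le> j" for i j
      using that assms(1) by (auto simp: p_def intro!: divide_right_mono mult_right_mono)
    have "\<bar>D b - D a\<bar> = \<bar>\<Sum>i<Suc n. D (p (Suc i)) - D (p i)\<bar>"
      using sum_lessThan_telescope[of "\<lambda>i. D (p i)" "Suc n"] p0 pn by simp
    also have "\<dots> \<le> (\<Sum>i<Suc n. \<bar>D (p (Suc i)) - D (p i)\<bar>)" by (rule sum_abs)
    also have "\<dots> \<le> (\<Sum>i<Suc n. (g (p (Suc i)) - g (p i)) * ((b - a) / real (Suc n)))"
    proof (rule sum_mono)
      fix i assume "i \<in> {..<Suc n}"
      then have "a \<le> p i" "p i \<le> p (Suc i)" "p (Suc i) \<le> b"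
        using mono[of 0 i] mono[of i "Suc i"] mono[of "Suc i" "Suc n"] p0 pn by auto
      from D[OF this] show "\<bar>D (p (Suc i)) - D (p i)\<bar> \<le> (g (p (Suc i)) - g (p i)) * ((b - a) / real (Suc n))"
        by (simp add: step)
    qed
    also have "\<dots> = (g b - g a) * ((b - a) / real (Suc n))"
      unfolding sum_distrib_right[symmetric] sum_lessThan_telescope[of "\<lambda>i. g (p i)" "Suc n"] p0 pn ..
    finally show ?thesis by simp
  qed
  have "(\<lambda>n. (g b - g a) * (b - a) / real (Suc n)) \<longlonglongrightarrow> 0"
    by (rule LIMSEQ_Suc[of "\<lambda>n. (g b - g a) * (b - a) / real n"], rule lim_const_over_n)
  then have "\<bar>D b - D a\<bar> \<le> 0"
    by (rule LIMSEQ_le_const) (use bound in auto)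
  then show ?thesis by (simp add: D_def)
qed

lemma bdd_borel_below_graph:
  assumes N: "finite_measure N" "sets N = sets borel" and a: "bdd_borel a" and q: "q \<in> borel_measurable borel"
  shows "bdd_borel (\<lambda>s. \<integral>\<theta>. a \<theta> * indicator {..<q \<theta>} s \<partial>N)"
proof -
  interpret N: finite_measure N by fact
  obtain B where B: "0 \<le> B" "\<And>x. \<bar>a x\<bar> \<le> B" using a by (metis bdd_borel_bound)
  have [measurable]: "a \<in> borel_measurable borel" "q \<in> borel_measurable borel"
    using a q by (auto simp: bdd_borel_def)
  have eq: "a \<theta> * indicator {..<q \<theta>} s = a \<theta> * (if s < q \<theta> then 1 else 0)" for \<theta> s
    by (auto simp: indicator_def)
  have sets: "sets (borel \<Otimes>\<^sub>M N) = sets (borel \<Otimes>\<^sub>M borel)"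
    using N by (intro sets_pair_measure_cong) auto
  have "(\<lambda>(s, \<theta>). a \<theta> * indicator {..<q \<theta>} s) \<in> borel_measurable (borel \<Otimes>\<^sub>M borel)"
    unfolding eq by measurable
  then have m: "(\<lambda>(s, \<theta>). a \<theta> * indicator {..<q \<theta>} s) \<in> borel_measurable (borel \<Otimes>\<^sub>M N)"
    using measurable_cong_sets[OF sets refl] by blast
  show ?thesis
  proof (rule bdd_borelI)
    show "(\<lambda>s. \<integral>\<theta>. a \<theta> * indicator {..<q \<theta>} s \<partial>N) \<in> borel_measurable borel"
      by (rule N.borel_measurable_lebesgue_integral[OF m])
    show "\<bar>\<integral>\<theta>. a \<theta> * indicator {..<q \<theta>} s \<partial>N\<bar> \<le> B * measure N (space N)" for s
    proof -
      have b: "bdd_borel (\<lambda>\<theta>. a \<theta> * indicator {..<q \<theta>} s)"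
        using B by (intro bdd_borelI[of _ B]) (auto simp: eq)
      have "\<bar>\<integral>\<theta>. a \<theta> * indicator {..<q \<theta>} s \<partial>N\<bar> \<le> (\<integral>\<theta>. \<bar>a \<theta> * indicator {..<q \<theta>} s\<bar> \<partial>N)"
        by (rule integral_abs_bound)
      also have "\<dots> \<le> (\<integral>\<theta>. B \<partial>N)"
        by (rule integral_mono)
           (use B bdd_borel_integrable[OF N b] in \<open>auto intro!: integrable_abs split: split_indicator\<close>)
      finally show ?thesis by (simp add: mult.commute)
    qed
  qed
qed

lemma monotone_threshold:
  fixes Q :: "real \<Rightarrow> bool"
  assumes "a \<le> b" "\<And>x y. a < x \<Longrightarrow> x \<le> y \<Longrightarrow> y < b \<Longrightarrow> Q x \<Longrightarrow> Q y"
  obtains \<tau> where "a \<le> \<tau>" "\<tau> \<le> b" "\<And>x. a < x \<Longrightarrow> x < \<tau> \<Longrightarrow> \<not> Q x" "\<And>x. \<tau> < x \<Longrightarrow> x < b \<Longrightarrow> Q x"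
proof -
  \<comment> \<open>The point \<open>b\<close> is inserted so that the infimum exists even if
    \<open>Q\<close> holds nowhere; the threshold is then \<open>b\<close>.\<close>
  define S where "S = insert b {x. a < x \<and> x < b \<and> Q x}"
  have bdd: "bdd_below S" and ne: "S \<noteq> {}" using assms(1) by (auto simp: S_def intro!: bdd_belowI[of _ a])
  show thesis
  proof (rule that[of "Inf S"])
    show "a \<le> Inf S" using ne assms(1) by (intro cInf_greatest) (auto simp: S_def)
    show "Inf S \<le> b" by (rule cInf_lower[OF _ bdd]) (simp add: S_def)
    then show "\<not> Q x" if "a < x" "x < Inf S" for x
      using cInf_lower[OF _ bdd, of x] that by (auto simp: S_def)
    show "Q x" if x: "Inf S < x" "x < b" for x
    proof -
      obtain y where "y \<in> S" "y < x" using x(1) cInf_less_iff[OF ne bdd] by blast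
      then show ?thesis using x assms(2)[of y x] by (auto simp: S_def)
    qed
  qed
qed

section \<open>Concave envelopes\<close>

text \<open>Chord slopes from \<open>z\<close> decrease in the other endpoint, so the right
  derivative is their supremum. The bound \<open>K\<close> makes it finite, which can fail at the
  endpoint 0, where a concave function may have a vertical tangent.\<close>

lemma concave_right_derivative:
  fixes g :: "real \<Rightarrow> real"
  assumes g: "concave_on {0..1} g" and z: "0 \<le> z" "z < 1"
    and K: "\<And>y. z < y \<Longrightarrow> y \<le> 1 \<Longrightarrow> g y \<le> g z + K * (y - z)"
  obtains e where "vector_derivative g (at_right z) = e" "e \<le> K"
    "\<And>y. y \<in> {0..1} \<Longrightarrow> g y \<le> g z + e * (y - z)"
proof -
  define s where "s y = (g y - g z) / (y - z)" for y
  have chord: "(y - x) * g b + (b - y) * g x \<le> (b - x) * g y" if "0 \<le> x" "x < y" "y < b" "b \<le> 1" for x y b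
  proof -
    define l where "l = (y - x) / (b - x)"
    have l: "0 \<le> l" "0 \<le> 1 - l" "l * (b - x) = y - x" using that by (auto simp: l_def)
    have "y = (1 - l) * x + l * b" using l(3) by (simp add: algebra_simps)
    then have "(1 - l) * g x + l * g b \<le> g y"
      using g that l unfolding concave_on_iff by force
    then have "(b - x) * ((1 - l) * g x + l * g b) \<le> (b - x) * g y"
      using that by (intro mult_left_mono) auto
    moreover have "(b - x) * ((1 - l) * g x + l * g b) = (b - x - l * (b - x)) * g x + l * (b - x) * g b"
      by (simp add: algebra_simps)
    ultimately show ?thesis unfolding l(3) by (simp add: algebra_simps)
  qed
  have anti: "s b \<le> s y" if "z < y" "y < b" "b \<le> 1" for y b
    using chord[of z y b] that z by (simp add: s_def field_simps)
  have s_le: "s y \<le> K" if "z < y" "y \<le> 1" for y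
    using K[OF that] that by (simp add: s_def field_simps)
  have bdd: "bdd_above (s ` {z<..1})" using s_le by (intro bdd_aboveI2[of _ _ K]) auto
  define e where "e = (SUP y\<in>{z<..1}. s y)"
  have s_le_e: "s y \<le> e" if "z < y" "y \<le> 1" for y
    unfolding e_def using that by (intro cSUP_upper bdd) auto
  have e_le: "e \<le> k" if "\<And>y. z < y \<Longrightarrow> y \<le> 1 \<Longrightarrow> s y \<le> k" for k
    unfolding e_def using that z by (intro cSUP_least) auto
  have lim: "(s \<longlongrightarrow> e) (at_right z)"
  proof (rule order_tendstoI)
    fix a assume "a < e"
    then obtain y0 where y0: "z < y0" "y0 \<le> 1" "a < s y0"
      using e_le[of a] by (meson not_less)
    show "\<forall>\<^sub>F y in at_right z. a < s y"
    proof (rule eventually_at_rightI[of z y0])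
      show "a < s y" if "y \<in> {z<..<y0}" for y using anti[of y y0] y0 that by simp
    qed (rule y0)
  next
    fix a assume "e < a"
    then show "\<forall>\<^sub>F y in at_right z. s y < a"
    proof (intro eventually_at_rightI[of z 1])
      show "s y < a" if "e < a" "y \<in> {z<..<1}" for y using s_le_e[of y] that by simp
    qed (rule z)
  qed
  then have "(g has_field_derivative e) (at_right z)"
    by (simp add: has_field_derivative_iff s_def[abs_def])
  then have "(g has_vector_derivative e) (at_right z)"
    by (simp add: has_real_derivative_iff_has_vector_derivative)
  then have "vector_derivative g (at_right z) = e"
    by (intro vector_derivative_within) simp_all
  moreover have "e \<le> K" using s_le by (intro e_le)
  moreover have "g y \<le> g z + e * (y - z)" if y: "y \<in> {0..1}" for y
  proof (cases y z rule: linorder_cases)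
    case less
    have "e \<le> (g z - g y) / (z - y)"
    proof (rule e_le)
      fix b assume "z < b" "b \<le> 1"
      then show "s b \<le> (g z - g y) / (z - y)"
        using chord[of y z b] less y by (simp add: s_def field_simps)
    qed
    then show ?thesis using less by (simp add: field_simps)
  next
    case greater
    then show ?thesis using s_le_e[of y] y by (simp add: s_def field_simps)
  qed simp
  ultimately show thesis using that by blast
qed

context
  fixes \<Phi> :: "real \<Rightarrow> real" and B :: real
  assumes bound: "\<And>z. z \<in> {0..1} \<Longrightarrow> \<Phi> z \<le> B"
begin

lemma envelope_ge: assumes "z \<in> {0..1}" shows "\<Phi> z \<le> concave_envelope \<Phi> z"
  unfolding concave_envelope_def
proof (rule cInf_greatest)
  have "concave_on {0..1::real} (\<lambda>_. B)" by (simp add: concave_on_const)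
  then show "{g z |g. concave_on {0..1} g \<and> (\<forall>x\<in>{0..1}. \<Phi> x \<le> g x)} \<noteq> {}"
    using bound by blast
qed (use assms in auto)

lemma envelope_le:
  assumes "z \<in> {0..1}" "concave_on {0..1} g" "\<And>x. x \<in> {0..1} \<Longrightarrow> \<Phi> x \<le> g x"
  shows "concave_envelope \<Phi> z \<le> g z"
  unfolding concave_envelope_def
  by (rule cInf_lower) (use assms in \<open>auto intro!: bdd_belowI[of _ "\<Phi> z"]\<close>)

lemma envelope_le_line:
  assumes "z \<in> {0..1}" "\<And>x. x \<in> {0..1} \<Longrightarrow> \<Phi> x \<le> a + b * (x - d)"
  shows "concave_envelope \<Phi> z \<le> a + b * (z - d)"
proof (rule envelope_le)
  show "concave_on {0..1} (\<lambda>x. a + b * (x - d))"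
    unfolding concave_on_iff
  proof (intro conjI ballI allI impI)
    fix x y u v :: real assume "u + v = 1"
    then have u: "u = 1 - v" by simp
    show "u * (a + b * (x - d)) + v * (a + b * (y - d)) \<le> a + b * (u *\<^sub>R x + v *\<^sub>R y - d)"
      by (simp add: u algebra_simps)
  qed simp
qed (use assms in auto)

lemma envelope_concave: "concave_on {0..1} (concave_envelope \<Phi>)"
  unfolding concave_on_iff
proof (intro conjI ballI allI impI)
  fix x y u v :: real
  assume xy: "x \<in> {0..1}" "y \<in> {0..1}" and uv: "0 \<le> u" "0 \<le> v" "u + v = 1"
  show "u * concave_envelope \<Phi> x + v * concave_envelope \<Phi> y \<le> concave_envelope \<Phi> (u *\<^sub>R x + v *\<^sub>R y)"
    unfolding concave_envelope_def[of \<Phi> "u *\<^sub>R x + v *\<^sub>R y"]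
  proof (rule cInf_greatest)
    have "concave_on {0..1::real} (\<lambda>_. B)" by (simp add: concave_on_const)
    then show "{g (u *\<^sub>R x + v *\<^sub>R y) |g. concave_on {0..1} g \<and> (\<forall>x\<in>{0..1}. \<Phi> x \<le> g x)} \<noteq> {}"
      using bound by blast
    fix r assume "r \<in> {g (u *\<^sub>R x + v *\<^sub>R y) |g. concave_on {0..1} g \<and> (\<forall>x\<in>{0..1}. \<Phi> x \<le> g x)}"
    then obtain g where g: "r = g (u *\<^sub>R x + v *\<^sub>R y)" "concave_on {0..1} g" "\<And>x. x \<in> {0..1} \<Longrightarrow> \<Phi> x \<le> g x"
      by blast
    have "u * concave_envelope \<Phi> x + v * concave_envelope \<Phi> y \<le> u * g x + v * g y"
      using envelope_le[OF _ g(2,3)] xy uv by (intro add_mono mult_left_mono) auto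
    also have "\<dots> \<le> r" using g(2) xy uv unfolding g(1) concave_on_iff by blast
    finally show "u * concave_envelope \<Phi> x + v * concave_envelope \<Phi> y \<le> r" .
  qed
qed simp

text \<open>Replacing the envelope near \<open>z\<close> by a chord would give a smaller concave majorant.\<close>

lemma envelope_affine:
  assumes cont: "continuous_on {0..1} \<Phi>" and z: "0 < z" "z < 1" and less: "\<Phi> z < concave_envelope \<Phi> z"
  obtains d s where "0 < d" "0 \<le> z - d" "z + d \<le> 1"
    "\<And>y. \<bar>y - z\<bar> \<le> d \<Longrightarrow> concave_envelope \<Phi> y = concave_envelope \<Phi> z + s * (y - z)"
proof -
  let ?E = "concave_envelope \<Phi>"
  \<comment> \<open>Half the distance, so that \<open>?E z - \<eta> = \<Phi> z + \<eta>\<close>: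
    near \<open>z\<close> this level separates \<open>\<Phi>\<close> from the envelope, and hence
    from the chord.\<close>
  define \<eta> where "\<eta> = (?E z - \<Phi> z) / 2"
  have \<eta>: "0 < \<eta>" using less by (simp add: \<eta>_def)
  have contE: "continuous_on {0<..<1} ?E"
  proof -
    have "concave_on {0<..<1} ?E"
      using envelope_concave unfolding concave_on_iff by (auto simp: greaterThanLessThan_subseteq_atLeastAtMost_iff)
    then have "convex_on {0<..<1} (\<lambda>x. - ?E x)" by (simp add: concave_on_def)
    then have "continuous_on {0<..<1} (\<lambda>x. - ?E x)" by (intro convex_on_continuous) auto
    from continuous_on_minus[OF this] show ?thesis unfolding minus_minus .
  qed
  have "isCont ?E z" using contE z by (simp add: continuous_on_eq_continuous_at)
  moreover have "continuous_on {0<..<1} \<Phi>" by (rule continuous_on_subset[OF cont]) auto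
  then have "isCont \<Phi> z" using z by (simp add: continuous_on_eq_continuous_at)
  ultimately have "\<forall>\<^sub>F y in at z. ?E z - \<eta> < ?E y \<and> \<Phi> y < \<Phi> z + \<eta>"
    using \<eta> by (intro eventually_conj order_tendstoD(1)[of ?E "?E z"] order_tendstoD(2)[of \<Phi> "\<Phi> z"]) (auto simp: isCont_def)
  then obtain d0 where d0: "0 < d0" "\<And>y. y \<noteq> z \<Longrightarrow> dist y z < d0 \<Longrightarrow> ?E z - \<eta> < ?E y \<and> \<Phi> y < \<Phi> z + \<eta>"
    by (auto simp: eventually_at)
  have near: "?E z - \<eta> < ?E y" "\<Phi> y < \<Phi> z + \<eta>" if "\<bar>y - z\<bar> < d0" for y
    using d0(2)[of y] that \<eta> by (cases "y = z"; auto simp: dist_real_def)+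
  define d where "d = min (d0 / 2) (min z (1 - z))"
  have d: "0 < d" "d < d0" "0 \<le> z - d" "z + d \<le> 1" using d0(1) z by (auto simp: d_def)
  define a b where "a = z - d" and "b = z + d"
  have ab: "a \<in> {0..1}" "b \<in> {0..1}" "a < b" using d z by (auto simp: a_def b_def)
  define s where "s = (?E b - ?E a) / (b - a)"
  define l where "l y = ?E a + s * (y - a)" for y
  have la: "l a = ?E a" and lb: "l b = ?E b" using ab by (auto simp: l_def s_def)
  have conc: "u * ?E x + v * ?E y \<le> ?E (u * x + v * y)"
    if "x \<in> {0..1}" "y \<in> {0..1}" "0 \<le> u" "0 \<le> v" "u + v = 1" for x y u v
    using envelope_concave that unfolding concave_on_iff by auto
  have l_affine: "l (u * x + v * y) = u * l x + v * l y" if "u + v = 1" for x y u v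
  proof -
    have u: "u = 1 - v" using that by simp
    show ?thesis by (simp add: l_def u algebra_simps)
  qed
  have inside: "l y \<le> ?E y" "min (?E a) (?E b) \<le> l y" if y: "a \<le> y" "y \<le> b" for y
  proof -
    define v where "v = (y - a) / (b - a)"
    have "v * (b - a) = y - a" using ab by (simp add: v_def)
    then have "y = (1 - v) * a + v * b" by (simp add: algebra_simps)
    moreover have "0 \<le> v" "0 \<le> 1 - v" using y ab by (auto simp: v_def)
    ultimately have v: "0 \<le> v" "0 \<le> 1 - v" "y = (1 - v) * a + v * b" by auto
    have ly: "l y = (1 - v) * ?E a + v * ?E b"
      unfolding v(3) by (subst l_affine) (simp_all add: lb, simp add: l_def)
    show "l y \<le> ?E y" unfolding ly using conc[OF ab(1,2) v(2,1)] v(3) by simp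
    have "(1 - v) * min (?E a) (?E b) + v * min (?E a) (?E b) \<le> l y"
      unfolding ly using v by (intro add_mono mult_left_mono) auto
    then show "min (?E a) (?E b) \<le> l y" by (simp add: algebra_simps)
  qed
  \<comment> \<open>Outside \<open>{a..b}\<close> a concave function lies below the line through its
    chord, so taking the minimum with that line changes nothing there.\<close>
  have outside: "?E y \<le> l y" if y: "y \<in> {0..1}" "y \<le> a \<or> b \<le> y" for y
  proof -
    consider "y = a" | "y = b" | "y < a" | "b < y" using y(2) by linarith
    then show ?thesis
    proof cases
      case 3
      define v where "v = (b - a) / (b - y)"
      have "v * (b - y) = b - a" using 3 ab by (simp add: v_def)
      then have "a = v * y + (1 - v) * b" by (simp add: algebra_simps)
      moreover have "0 < v" "0 \<le> 1 - v" using 3 ab by (auto simp: v_def)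
      ultimately have v: "0 < v" "0 \<le> 1 - v" "a = v * y + (1 - v) * b" by auto
      have "v * ?E y + (1 - v) * ?E b \<le> v * l y + (1 - v) * l b"
        using conc[OF y(1) ab(2), of v "1 - v"] v(1,2) l_affine[of v "1 - v" y b] la
        unfolding v(3)[symmetric] by simp
      then show ?thesis using v(1) by (simp add: lb)
    next
      case 4
      define v where "v = (b - a) / (y - a)"
      have "v * (y - a) = b - a" using 4 ab by (simp add: v_def)
      then have "b = v * y + (1 - v) * a" by (simp add: algebra_simps)
      moreover have "0 < v" "0 \<le> 1 - v" using 4 ab by (auto simp: v_def)
      ultimately have v: "0 < v" "0 \<le> 1 - v" "b = v * y + (1 - v) * a" by auto
      have "v * ?E y + (1 - v) * ?E a \<le> v * l y + (1 - v) * l a"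
        using conc[OF y(1) ab(1), of v "1 - v"] v(1,2) l_affine[of v "1 - v" y a] lb
        unfolding v(3)[symmetric] by simp
      then show ?thesis using v(1) by (simp add: la)
    qed (auto simp: la lb)
  qed
  have l_conc: "concave_on {0..1} (\<lambda>y. min (?E y) (l y))"
    unfolding concave_on_iff
  proof (intro conjI ballI allI impI)
    fix x y u v :: real
    assume xy: "x \<in> {0..1}" "y \<in> {0..1}" and uv: "0 \<le> u" "0 \<le> v" "u + v = 1"
    have "u * min (?E x) (l x) + v * min (?E y) (l y) \<le> u * ?E x + v * ?E y"
      "u * min (?E x) (l x) + v * min (?E y) (l y) \<le> u * l x + v * l y"
      using uv by (auto intro!: add_mono mult_left_mono)
    then show "u * min (?E x) (l x) + v * min (?E y) (l y) \<le> min (?E (u *\<^sub>R x + v *\<^sub>R y)) (l (u *\<^sub>R x + v *\<^sub>R y))"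
      using conc[OF xy uv] l_affine[OF uv(3), of x y] by simp
  qed simp
  have major: "\<Phi> y \<le> min (?E y) (l y)" if y: "y \<in> {0..1}" for y
  proof (cases "a \<le> y \<and> y \<le> b")
    case True
    have "?E z - \<eta> < min (?E a) (?E b)" using near(1)[of a] near(1)[of b] d by (simp add: a_def b_def)
    moreover have "\<Phi> y < \<Phi> z + \<eta>" using near(2)[of y] True d by (auto simp: a_def b_def)
    moreover have "\<Phi> z + \<eta> = ?E z - \<eta>" by (simp add: \<eta>_def field_simps)
    moreover have "min (?E a) (?E b) \<le> l y" using inside(2) True by blast
    ultimately have "\<Phi> y \<le> l y" by linarith
    then show ?thesis using envelope_ge[OF y] by simp
  next
    case False
    then show ?thesis using outside[OF y] envelope_ge[OF y] by auto
  qed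
  have eq: "?E y = l y" if "a \<le> y" "y \<le> b" for y
    using envelope_le[OF _ l_conc major, of y] inside(1)[OF that] that ab by auto
  show thesis
  proof (rule that[of d s])
    show "?E y = ?E z + s * (y - z)" if "\<bar>y - z\<bar> \<le> d" for y
    proof -
      have "a \<le> y" "y \<le> b" "a \<le> z" "z \<le> b" using that d by (auto simp: a_def b_def)
      then have "?E y = l y" "?E z = l z" using eq by blast+
      then show ?thesis by (simp add: l_def algebra_simps)
    qed
  qed (use d in auto)
qed

end

context screening begin

section \<open>Primitives\<close>

text \<open>The inverse of \<open>v\<close>: the quality that yields gross utility \<open>y\<close>.
  It is continued by constants outside \<open>{v 0..v A}\<close>, which makes it monotone on the
  whole line and hence Borel.\<close>

definition w :: "real \<Rightarrow> real" where
  "w y = the_inv_into {0..A} v (max (v 0) (min (v A) y))"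

lemma v_cont: "continuous_on {0..A} v"
  by (rule DERIV_continuous_on, rule v_deriv)

lemma v'_cont: "continuous_on {0..A} v'"
  by (rule DERIV_continuous_on, rule v'_deriv)

text \<open>Mean value theorem with a strictly decreasing derivative. Later arguments use the strict
  concavity of \<open>v\<close> through these inequalities and their consequences.\<close>

lemma v_diff_bounds:
  assumes "0 \<le> a" "a < b" "b \<le> A"
  shows "v' b * (b - a) < v b - v a" "v b - v a < v' a * (b - a)"
proof -
  have der: "(v has_real_derivative v' q) (at q)" "(v' has_real_derivative v'' q) (at q)"
    if "a < q" "q < b" for q
    using v_deriv[of q] v'_deriv[of q] at_within_Icc_at[of 0 q A] assms that by auto
  have contv: "continuous_on {a..b} v"
    by (rule continuous_on_subset[of "{0..A}"])
       (use assms v_cont in auto)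
  have contv': "continuous_on {a..b} v'"
    by (rule continuous_on_subset[of "{0..A}"])
       (use assms v'_cont in auto)
  obtain l z where "a < z" "z < b" "(v has_real_derivative l) (at z)" "v b - v a = (b - a) * l"
    using MVT[OF \<open>a < b\<close> contv] der(1) by (meson real_differentiable_def)
  then have z: "a < z" "z < b" "v b - v a = (b - a) * v' z"
    using DERIV_unique[OF der(1)] by blast+
  have "v' z < v' a"
  proof (rule DERIV_neg_imp_decreasing_open[of a z])
    show "\<exists>y. (v' has_real_derivative y) (at x) \<and> y < 0" if "a < x" "x < z" for x
      using der(2)[of x] v''_neg[of x] that z assms by auto
    show "continuous_on {a..z} v'" using contv' z by (auto intro: continuous_on_subset)
  qed (use z in auto)
  moreover have "v' b < v' z"
  proof (rule DERIV_neg_imp_decreasing_open[of z b])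
    show "\<exists>y. (v' has_real_derivative y) (at x) \<and> y < 0" if "z < x" "x < b" for x
      using der(2)[of x] v''_neg[of x] that z assms by auto
    show "continuous_on {z..b} v'" using contv' z by (auto intro: continuous_on_subset)
  qed (use z in auto)
  ultimately show "v' b * (b - a) < v b - v a" "v b - v a < v' a * (b - a)"
    using z assms by (auto simp: mult.commute)
qed

lemma v_strict_mono: "0 \<le> a \<Longrightarrow> a < b \<Longrightarrow> b \<le> A \<Longrightarrow> v a < v b"
  using v_diff_bounds(1)[of a b] v'_pos[of b]
  by (smt (verit) atLeastAtMost_iff mult_pos_pos)

lemma v_mono: "0 \<le> a \<Longrightarrow> a \<le> b \<Longrightarrow> b \<le> A \<Longrightarrow> v a \<le> v b"
  using v_strict_mono[of a b] by (cases "a = b") auto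

lemma v_less_iff: "a \<in> {0..A} \<Longrightarrow> b \<in> {0..A} \<Longrightarrow> v a < v b \<longleftrightarrow> a < b"
  using v_strict_mono v_mono by (metis atLeastAtMost_iff not_less)

lemma v_range: "q \<in> {0..A} \<Longrightarrow> v q \<in> {v 0..v A}"
  using v_mono[of 0 q] v_mono[of q A] by auto

lemma v_inj: "inj_on v {0..A}"
  by (rule inj_onI) (metis v_less_iff less_irrefl linorder_cases)

lemma v'_strict_antimono: "0 \<le> a \<Longrightarrow> a < b \<Longrightarrow> b \<le> A \<Longrightarrow> v' b < v' a"
  using v_diff_bounds[of a b] by (smt (verit) mult_less_cancel_right)

lemma v_image: "v ` {0..A} = {v 0..v A}"
proof
  show "v ` {0..A} \<subseteq> {v 0..v A}" using v_range by auto
  show "{v 0..v A} \<subseteq> v ` {0..A}"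
    using IVT'[of v 0 _ A] v_cont A_pos by fastforce
qed

lemma w_in: "w y \<in> {0..A}"
  unfolding w_def by (rule the_inv_into_into[OF v_inj]) (use v_mono[of 0 A] A_pos in \<open>auto simp: v_image\<close>)

lemma v_w: "y \<in> {v 0..v A} \<Longrightarrow> v (w y) = y"
  unfolding w_def by (subst f_the_inv_into_f[OF v_inj]) (auto simp: v_image)

lemma w_v: "q \<in> {0..A} \<Longrightarrow> w (v q) = q"
  using v_range[of q] by (auto simp: w_def the_inv_into_f_f[OF v_inj])

lemma w_clamp: "w (max (v 0) (min (v A) y)) = w y"
proof -
  have "max (v 0) (min (v A) (max (v 0) (min (v A) y))) = max (v 0) (min (v A) y)"
    using v_mono[of 0 A] A_pos by (simp add: min_def max_def)
  then show ?thesis by (simp add: w_def)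
qed

lemma w_mono: "mono w"
proof
  fix x y :: real assume "x \<le> y"
  let ?c = "\<lambda>y. max (v 0) (min (v A) y)"
  have c: "?c z \<in> {v 0..v A}" for z using v_mono[of 0 A] A_pos by auto
  have "v (w (?c x)) \<le> v (w (?c y))"
    using \<open>x \<le> y\<close> by (simp add: v_w[OF c])
  then have "w (?c x) \<le> w (?c y)"
    using v_less_iff[OF w_in w_in] by (meson not_less)
  then show "w x \<le> w y" by (simp add: w_clamp)
qed

text \<open>As \<open>v'\<close> decreases, the inverse of \<open>v\<close> is steepest at the top
  of the range; its slope there is a Lipschitz constant for \<open>w\<close>.\<close>

definition wlip :: real where "wlip = 1 / v' A"

lemma wlip_pos: "0 < wlip"
  using v'_pos[of A] A_pos by (simp add: wlip_def)

lemma w_diff_le: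
  assumes "x \<in> {v 0..v A}" "y \<in> {v 0..v A}" "x \<le> y"
  shows "w y - w x \<le> wlip * (y - x)"
proof (cases "w x < w y")
  case True
  have "v' A * (w y - w x) \<le> v' (w y) * (w y - w x)"
    using v'_strict_antimono[of "w y" A] w_in[of y] True by (cases "w y = A") auto
  also have "\<dots> < v (w y) - v (w x)"
    using v_diff_bounds(1)[of "w x" "w y"] True w_in by auto
  finally show ?thesis
    using v'_pos[of A] A_pos assms by (simp add: v_w wlip_def field_simps)
next
  case False
  then show ?thesis using assms(3) wlip_pos by (smt (verit) mult_nonneg_nonneg)
qed

lemma w_abs_diff_le:
  assumes "x \<in> {v 0..v A}" "y \<in> {v 0..v A}"
  shows "\<bar>w y - w x\<bar> \<le> wlip * \<bar>y - x\<bar>"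
  using w_diff_le[OF assms] w_diff_le[OF assms(2,1)] monoD[OF w_mono, of x y] monoD[OF w_mono, of y x]
  by (cases "x \<le> y") auto

lemma v_strict_concave:
  assumes "a \<in> {0..A}" "b \<in> {0..A}" "a \<noteq> b" "0 < l" "l < 1"
  shows "(1 - l) * v a + l * v b < v ((1 - l) * a + l * b)"
proof -
  have *: "(1 - l) * v a + l * v b < v ((1 - l) * a + l * b)"
    if ab: "0 \<le> a" "a < b" "b \<le> A" and l: "0 < l" "l < 1" for a b l
  proof -
    let ?m = "(1 - l) * a + l * b"
    have eq: "?m - a = l * (b - a)" "b - ?m = (1 - l) * (b - a)" by (auto simp: algebra_simps)
    have m: "a < ?m" "?m < b"
      using ab l eq by (smt (verit) mult_pos_pos)+
    have "v' ?m * (l * (b - a)) < v ?m - v a" "v b - v ?m < v' ?m * ((1 - l) * (b - a))"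
      using v_diff_bounds(1)[of a ?m] v_diff_bounds(2)[of ?m b] m ab by (auto simp: eq)
    then have "(1 - l) * (v' ?m * (l * (b - a))) < (1 - l) * (v ?m - v a)"
      and "l * (v b - v ?m) < l * (v' ?m * ((1 - l) * (b - a)))"
      using l by auto
    then show ?thesis by (simp add: algebra_simps)
  qed
  show ?thesis
  proof (cases "a < b")
    case True then show ?thesis using *[of a b l] assms by auto
  next
    case False
    then show ?thesis using *[of b a "1 - l"] assms by (auto simp: algebra_simps)
  qed
qed

text \<open>Applying \<open>v\<close> to both sides reduces this to strict concavity of
  \<open>v\<close>. It is the source of strict concavity of the planner's objective in the
  allocation.\<close>

lemma w_strict_convex:
  assumes "x \<in> {v 0..v A}" "y \<in> {v 0..v A}" "x \<noteq> y" "0 < l" "l < 1"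
  shows "w ((1 - l) * x + l * y) < (1 - l) * w x + l * w y"
proof -
  have ne: "w x \<noteq> w y" using assms v_w by metis
  have m: "(1 - l) * x + l * y \<in> {v 0..v A}"
    using convexD_alt[of "{v 0..v A}" x y l] assms by auto
  have m2: "(1 - l) * w x + l * w y \<in> {0..A}"
    using convexD_alt[of "{0..A}" "w x" "w y" l] assms w_in[of x] w_in[of y] by auto
  have "v (w ((1 - l) * x + l * y)) < v ((1 - l) * w x + l * w y)"
    using v_strict_concave[OF w_in w_in ne assms(4,5)]
    by (simp only: v_w[OF m] v_w[OF assms(1)] v_w[OF assms(2)])
  then show ?thesis using v_less_iff[OF w_in m2] by blast
qed

lemma w_convex:
  assumes "x \<in> {v 0..v A}" "y \<in> {v 0..v A}" "0 \<le> l" "l \<le> 1"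
  shows "w ((1 - l) * x + l * y) \<le> (1 - l) * w x + l * w y"
proof (cases "x = y \<or> l = 0 \<or> l = 1")
  case True
  moreover have "(1 - l) * y + l * y = y" "(1 - l) * w y + l * w y = w y"
    by (auto simp: algebra_simps)
  ultimately show ?thesis by auto
next
  case False
  then show ?thesis using w_strict_convex[of x y l] assms by auto
qed

lemma w_bdd_borel: assumes "h \<in> borel_measurable borel" shows "bdd_borel (\<lambda>\<theta>. w (h \<theta>))"
proof (rule bdd_borelI)
  show "(\<lambda>\<theta>. w (h \<theta>)) \<in> borel_measurable borel"
    using measurable_compose[OF assms borel_measurable_mono[OF w_mono]] .
  show "\<bar>w (h \<theta>)\<bar> \<le> A" for \<theta> using w_in[of "h \<theta>"] by auto
qed

section \<open>Type distribution, Lebesgue measure on types and accumulated weight gaps\<close>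

abbreviation M :: "real measure" where "M \<equiv> type_dist lo hi f"

definition L :: "real measure" where "L = density lborel (indicator {lo..hi})"

text \<open>Composition with this map extends a function on the type interval by constants, so that
  monotonicity, continuity and bounds hold on the whole line without side conditions.\<close>

definition clamp :: "real \<Rightarrow> real" where "clamp \<theta> = max lo (min hi \<theta>)"

lemma clamp_in: "clamp \<theta> \<in> {lo..hi}"
  using lo_less_hi by (auto simp: clamp_def)

lemma clamp_id: "\<theta> \<in> {lo..hi} \<Longrightarrow> clamp \<theta> = \<theta>"
  by (auto simp: clamp_def)

lemma clamp_mono: "mono clamp"
  by (auto simp: clamp_def mono_def)

lemma clamp_bdd_borel: "bdd_borel clamp"
proof (rule bdd_borel_mono[OF clamp_mono])
  show "\<bar>clamp x\<bar> \<le> hi" for x using clamp_in[of x] lo_pos by auto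
qed

lemma f_ind_meas: "(\<lambda>s. indicator {lo..hi} s * f s) \<in> borel_measurable borel"
  using f_meas by (simp add: set_borel_measurable_def)

lemma dens_meas: "(\<lambda>s. ennreal (indicator {lo..hi} s * f s)) \<in> borel_measurable lborel"
  using f_ind_meas by simp

lemma sets_M: "sets M = sets borel"
  by (simp add: type_dist_def)

lemma sets_L: "sets L = sets borel"
  by (simp add: L_def)

lemma space_M: "space M = UNIV" and space_L: "space L = UNIV"
  by (simp_all add: type_dist_def L_def)

lemma finite_M: "finite_measure M"
  using type_dist_prob by (simp add: prob_space_def)

lemma emeasure_L: "S \<in> sets borel \<Longrightarrow> emeasure L S = emeasure lborel ({lo..hi} \<inter> S)"
  by (simp add: L_def emeasure_restricted)

lemma finite_L: "finite_measure L"
  by (rule finite_measureI) (use lo_less_hi in \<open>simp add: space_L emeasure_L\<close>)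

lemma AE_M_iff: "(AE x in M. P x) \<longleftrightarrow> (AE x in lborel. x \<in> {lo..hi} \<longrightarrow> P x)"
proof -
  have "0 < ennreal (indicator {lo..hi} x * f x) \<longleftrightarrow> x \<in> {lo..hi}" for x
    using f_pos[of x] by (auto simp: indicator_def)
  then show ?thesis unfolding type_dist_def by (subst AE_density[OF dens_meas]) simp
qed

lemma AE_L_iff: "(AE x in L. P x) \<longleftrightarrow> (AE x in lborel. x \<in> {lo..hi} \<longrightarrow> P x)"
proof -
  have "0 < (indicator {lo..hi} x :: ennreal) \<longleftrightarrow> x \<in> {lo..hi}" for x
    by (auto simp: indicator_def)
  then show ?thesis unfolding L_def by (subst AE_density) auto
qed

text \<open>The density is positive on \<open>{lo..hi}\<close>, so both measures have the same null
  sets. Equality of allocations almost everywhere therefore needs no choice of measure.\<close>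

lemma AE_L_iff_M: "(AE x in L. P x) \<longleftrightarrow> (AE x in M. P x)"
  by (simp add: AE_L_iff AE_M_iff)

lemma AE_L_countable: assumes "countable C" shows "AE x in L. x \<in> {lo..hi} \<and> x \<notin> C"
proof -
  have "AE x in lborel. x \<notin> C"
    using countable_imp_null_set_lborel[OF assms] by (rule AE_not_in)
  then show ?thesis by (auto simp: AE_L_iff)
qed

lemma AE_L_interior: "AE x in L. lo < x \<and> x < hi"
  by (rule eventually_mono[OF AE_L_countable[of "{lo, hi}"]]) auto

lemmas AE_M_countable = AE_L_countable[unfolded AE_L_iff_M]
lemmas AE_M_interior = AE_L_interior[unfolded AE_L_iff_M]

lemma int_M: "bdd_borel h \<Longrightarrow> integrable M h"
  by (rule bdd_borel_integrable[OF finite_M sets_M])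

lemma int_L: "bdd_borel h \<Longrightarrow> integrable L h"
  by (rule bdd_borel_integrable[OF finite_L sets_L])

lemma meas_M: "bdd_borel h \<Longrightarrow> h \<in> borel_measurable M"
  using borel_measurable_integrable[OF int_M] .

lemma meas_L: "bdd_borel h \<Longrightarrow> h \<in> borel_measurable L"
  using borel_measurable_integrable[OF int_L] .

lemma cong_M: "bdd_borel h \<Longrightarrow> bdd_borel k \<Longrightarrow> (AE x in M. h x = k x) \<Longrightarrow> (\<integral>x. h x \<partial>M) = (\<integral>x. k x \<partial>M)"
  by (rule integral_cong_AE) (auto simp: meas_M)

lemma cong_L: "bdd_borel h \<Longrightarrow> bdd_borel k \<Longrightarrow> (AE x in L. h x = k x) \<Longrightarrow> (\<integral>x. h x \<partial>L) = (\<integral>x. k x \<partial>L)"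
  by (rule integral_cong_AE) (auto simp: meas_L)

lemma cong_M_interior:
  "bdd_borel h \<Longrightarrow> bdd_borel k \<Longrightarrow> (\<And>x. lo < x \<Longrightarrow> x < hi \<Longrightarrow> h x = k x) \<Longrightarrow> (\<integral>x. h x \<partial>M) = (\<integral>x. k x \<partial>M)"
  by (rule cong_M) (auto intro: eventually_mono[OF AE_M_interior])

lemma cong_L_interior:
  "bdd_borel h \<Longrightarrow> bdd_borel k \<Longrightarrow> (\<And>x. lo < x \<Longrightarrow> x < hi \<Longrightarrow> h x = k x) \<Longrightarrow> (\<integral>x. h x \<partial>L) = (\<integral>x. k x \<partial>L)"
  by (rule cong_L) (auto intro: eventually_mono[OF AE_L_interior])

lemma mono_M: "bdd_borel h \<Longrightarrow> bdd_borel k \<Longrightarrow> (AE x in M. h x \<le> k x) \<Longrightarrow> (\<integral>x. h x \<partial>M) \<le> (\<integral>x. k x \<partial>M)"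
  by (rule integral_mono_AE) (auto simp: int_M)

lemma mono_L: "bdd_borel h \<Longrightarrow> bdd_borel k \<Longrightarrow> (AE x in L. h x \<le> k x) \<Longrightarrow> (\<integral>x. h x \<partial>L) \<le> (\<integral>x. k x \<partial>L)"
  by (rule integral_mono_AE) (auto simp: int_L)

lemma measure_L: assumes "lo \<le> a" "a \<le> b" "b \<le> hi" shows "measure L {a..<b} = b - a"
proof -
  have "{lo..hi} \<inter> {a..<b} = {a..<b}" using assms by auto
  then show ?thesis using assms by (simp add: measure_def emeasure_L)
qed

lemma integral_indicator_L:
  assumes "lo \<le> a" "a \<le> b" "b \<le> hi" shows "(\<integral>s. indicator {a..<b} s \<partial>L) = b - a"
  using measure_L[OF assms] by (simp add: space_L)

lemma set_integral_M:
  assumes "bdd_borel k" "\<And>x. x \<in> {lo..hi} \<Longrightarrow> h x = k x"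
  shows "(LINT x:{lo..hi}|M. h x) = (\<integral>x. k x \<partial>M)"
proof -
  have "(LINT x:{lo..hi}|M. h x) = (\<integral>x. indicator {lo..hi} x * k x \<partial>M)"
    unfolding set_lebesgue_integral_def by (rule Bochner_Integration.integral_cong) (auto simp: assms(2) indicator_def)
  also have "\<dots> = (\<integral>x. k x \<partial>M)"
    by (rule cong_M_interior) (use assms(1) in \<open>auto intro!: bdd_borel_intros\<close>)
  finally show ?thesis .
qed

lemma integral_L_eq:
  assumes "bdd_borel h" shows "(\<integral>x. h x \<partial>L) = (LINT x:{lo..hi}|lborel. h x)"
proof -
  have "L = density lborel (\<lambda>x. ennreal (indicator {lo..hi} x))"
    by (simp add: L_def ennreal_indicator)
  then show ?thesis
    using bdd_borel_measurable[OF assms]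
    by (simp add: integral_density set_lebesgue_integral_def)
qed

text \<open>The net social cost of a unit of rent: it takes \<open>\<alpha>\<close> from weighted
  profit and returns the weight of the type. Its accumulation \<open>G\<close> is
  \<open>cum_gap\<close> written as an integral over the whole line.\<close>

definition gap :: "real \<Rightarrow> real" where "gap \<theta> = \<alpha> - \<omega> (clamp \<theta>)"

definition G :: "real \<Rightarrow> real" where "G \<theta> = (\<integral>s. indicator {..\<theta>} s * gap s \<partial>M)"

lemma gap_cont: "continuous_on UNIV gap"
proof -
  have "continuous_on UNIV (\<lambda>\<theta>. \<omega> (clamp \<theta>))"
    by (rule continuous_on_compose2[OF \<omega>_cont])
       (use clamp_in in \<open>auto simp: clamp_def intro!: continuous_intros\<close>)
  then show ?thesis unfolding gap_def by (intro continuous_intros)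
qed

lemma gap_bdd_borel: "bdd_borel gap"
proof -
  have "bounded (gap ` {lo..hi})"
    by (intro compact_imp_bounded compact_continuous_image continuous_on_subset[OF gap_cont]) auto
  then obtain B where "\<forall>y\<in>gap ` {lo..hi}. norm y \<le> B"
    unfolding bounded_iff by blast
  then have "\<And>x. x \<in> {lo..hi} \<Longrightarrow> \<bar>gap x\<bar> \<le> B" by auto
  moreover have "gap (clamp x) = gap x" for x by (simp add: gap_def clamp_id[OF clamp_in])
  ultimately have "\<bar>gap x\<bar> \<le> B" for x using clamp_in[of x] by metis
  then show ?thesis
    by (intro bdd_borelI borel_measurable_continuous_onI gap_cont)
qed

lemma cum_gap_eq: assumes "\<theta> \<le> hi" shows "cum_gap \<theta> = G \<theta>"
proof -
  have "cum_gap \<theta> = (\<integral>s. indicator {lo..\<theta>} s * gap s \<partial>M)"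
    unfolding cum_gap_def set_lebesgue_integral_def
    by (rule Bochner_Integration.integral_cong) (use assms in \<open>auto simp: gap_def clamp_id indicator_def\<close>)
  also have "\<dots> = G \<theta>"
    unfolding G_def
    by (rule cong_M_interior) (auto intro!: bdd_borel_intros gap_bdd_borel split: split_indicator)
  finally show ?thesis .
qed

lemma mean_weight_eq: "\<alpha> - mean_weight = (\<integral>s. gap s \<partial>M)"
proof -
  have "mean_weight = (\<integral>s. \<alpha> - gap s \<partial>M)"
    unfolding mean_weight_def
    by (rule set_integral_M) (intro bdd_borel_intros gap_bdd_borel, simp add: gap_def clamp_id)
  also have "\<dots> = \<alpha> - (\<integral>s. gap s \<partial>M)"
    using prob_space.prob_space[OF type_dist_prob]
    by (subst Bochner_Integration.integral_diff) (auto intro!: int_M bdd_borel_intros gap_bdd_borel)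
  finally show ?thesis by simp
qed

lemma G_hi: "G hi = \<alpha> - mean_weight"
  unfolding G_def mean_weight_eq
  by (rule cong_M_interior) (auto intro!: bdd_borel_intros gap_bdd_borel split: split_indicator)

lemma G_diff:
  assumes "a \<le> b" shows "G b - G a = (\<integral>s. indicator {a<..b} s * gap s \<partial>M)"
  unfolding G_def
  by (subst Bochner_Integration.integral_diff[symmetric])
     (use assms in \<open>auto intro!: int_M bdd_borel_intros gap_bdd_borel Bochner_Integration.integral_cong split: split_indicator\<close>)

lemma finite_borel_M: "finite_borel_measure M"
  using finite_M sets_M by (auto simp: finite_borel_measure_def finite_borel_measure_axioms_def)

lemma AE_M_notin_iff: "S \<in> sets borel \<Longrightarrow> (AE x in M. x \<notin> S) \<longleftrightarrow> emeasure M S = 0"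
  by (subst AE_iff_null_sets[symmetric]) (auto simp: sets_M null_sets_def)

lemma F_diff: assumes "a \<le> b" shows "F b - F a = measure M {a<..b}"
  using finite_borel_measure.cdf_diff_eq[OF finite_borel_M, of a b] assms
  unfolding F_def by (cases "a = b") auto

lemma F_less: assumes "lo \<le> a" "a < b" "b \<le> hi" shows "F a < F b"
proof -
  have "\<not> (AE x in M. x \<notin> {a<..b})"
  proof
    assume "AE x in M. x \<notin> {a<..b}"
    then have "AE x in lborel. x \<notin> {a<..b}"
      unfolding AE_M_iff by eventually_elim (use assms in auto)
    then show False using assms AE_iff_null_sets[of "{a<..b}" lborel] by (simp add: null_sets_def)
  qed
  then have "measure M {a<..b} \<noteq> 0"
    by (subst (asm) AE_M_notin_iff) (simp_all add: finite_measure.emeasure_eq_measure[OF finite_M])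
  then show ?thesis
    using F_diff[of a b] assms by (smt (verit) measure_nonneg)
qed

lemma F_mono: "a \<le> b \<Longrightarrow> F a \<le> F b"
  using F_diff[of a b] by (smt (verit) measure_nonneg)

lemma AE_M_point: "emeasure M {x} = 0"
proof -
  have "AE y in M. y \<notin> {x}" by (rule eventually_mono[OF AE_M_countable[of "{x}"]]) auto
  then show ?thesis by (subst (asm) AE_M_notin_iff) auto
qed

lemma F_cont: "isCont F \<theta>"
  using finite_borel_measure.isCont_cdf[OF finite_borel_M, of \<theta>] AE_M_point[of \<theta>]
  unfolding F_def by (simp add: measure_def)

lemma F_lo: "F lo = 0"
proof -
  have "AE y in M. y \<notin> {..lo}" using AE_M_interior by eventually_elim auto
  then have "emeasure M {..lo} = 0"
    by (subst (asm) AE_M_notin_iff) auto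
  then show ?thesis by (simp add: F_def cdf_def measure_def)
qed

lemma F_hi: "F hi = 1"
proof -
  have "AE y in M. y \<in> {..hi}" using AE_M_interior by eventually_elim auto
  then show ?thesis
    unfolding F_def cdf_def using prob_space.prob_eq_1[OF type_dist_prob, of "{..hi}"] by (simp add: sets_M)
qed

text \<open>\<open>gap\<close> is bounded, so \<open>G\<close> is Lipschitz in \<open>F\<close>.
  This gives continuity of \<open>G\<close>, and near \<open>lo\<close> it bounds \<open>G\<close>
  by a multiple of \<open>F\<close>.\<close>

lemma G_abs_diff_le: obtains K where "0 \<le> K" "\<And>a b. a \<le> b \<Longrightarrow> \<bar>G b - G a\<bar> \<le> K * (F b - F a)"
proof -
  obtain K where K: "0 \<le> K" "\<And>x. \<bar>gap x\<bar> \<le> K" using gap_bdd_borel by (metis bdd_borel_bound)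
  have "\<bar>G b - G a\<bar> \<le> K * (F b - F a)" if "a \<le> b" for a b
  proof -
    have "\<bar>G b - G a\<bar> \<le> (\<integral>s. \<bar>indicator {a<..b} s * gap s\<bar> \<partial>M)"
      unfolding G_diff[OF that] by (rule integral_abs_bound)
    also have "\<dots> \<le> (\<integral>s. K * indicator {a<..b} s \<partial>M)"
      by (rule integral_mono)
         (use K in \<open>auto intro!: int_M integrable_abs bdd_borel_intros gap_bdd_borel split: split_indicator\<close>)
    also have "\<dots> = K * (F b - F a)"
      unfolding F_diff[OF that] by (simp add: space_M)
    finally show ?thesis .
  qed
  then show thesis using K(1) that by blast
qed

lemma G_lo: "G lo = 0"
proof -
  have "G lo = (\<integral>s. 0 \<partial>M)"
    unfolding G_def
    by (rule cong_M_interior) (auto intro!: bdd_borel_intros gap_bdd_borel split: split_indicator)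
  then show ?thesis by simp
qed

lemma G_cont: "isCont G \<theta>"
proof -
  obtain K where K: "0 \<le> K" "\<And>a b. a \<le> b \<Longrightarrow> \<bar>G b - G a\<bar> \<le> K * (F b - F a)"
    using G_abs_diff_le by blast
  have bound: "\<bar>G x - G \<theta>\<bar> \<le> K * \<bar>F x - F \<theta>\<bar>" for x
    using K(2)[of x \<theta>] K(2)[of \<theta> x] F_mono[of x \<theta>] F_mono[of \<theta> x]
    by (cases "x \<le> \<theta>") (auto simp: abs_minus_commute)
  have "((\<lambda>x. K * \<bar>F x - F \<theta>\<bar>) \<longlongrightarrow> K * \<bar>F \<theta> - F \<theta>\<bar>) (at \<theta>)"
    using F_cont[of \<theta>] by (intro tendsto_intros) (simp add: isCont_def)
  then have "((\<lambda>x. G x - G \<theta>) \<longlongrightarrow> 0) (at \<theta>)"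
    by (intro Lim_null_comparison[of "\<lambda>x. G x - G \<theta>" "\<lambda>x. K * \<bar>F x - F \<theta>\<bar>"]) (use bound in auto)
  then show ?thesis by (simp add: isCont_def LIM_zero_iff)
qed

lemma G_bdd_borel: "bdd_borel G"
proof -
  obtain K where K: "0 \<le> K" "\<And>x. \<bar>gap x\<bar> \<le> K" using gap_bdd_borel by (metis bdd_borel_bound)
  have "\<bar>G \<theta>\<bar> \<le> K" for \<theta>
  proof -
    have "\<bar>G \<theta>\<bar> \<le> (\<integral>s. \<bar>indicator {..\<theta>} s * gap s\<bar> \<partial>M)"
      unfolding G_def by (rule integral_abs_bound)
    also have "\<dots> \<le> (\<integral>s. K \<partial>M)"
      by (rule integral_mono)
         (use K in \<open>auto intro!: int_M integrable_abs bdd_borel_intros gap_bdd_borel split: split_indicator\<close>)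
    finally show ?thesis using prob_space.prob_space[OF type_dist_prob] by simp
  qed
  then show ?thesis
    by (intro bdd_borelI borel_measurable_continuous_onI)
       (auto intro!: continuous_at_imp_continuous_on G_cont)
qed

section \<open>Demand and laissez-faire utility\<close>

lemma objective_less_left:
  assumes "c < y * v' r" "0 \<le> a" "a < r" "r \<le> A"
  shows "y * v a - c * a < y * v r - c * r"
proof -
  have "0 < y" using assms c_pos v'_pos[of r] by (smt (verit) atLeastAtMost_iff mult_nonpos_nonneg)
  then have "y * (v' r * (r - a)) < y * (v r - v a)"
    using v_diff_bounds(1)[of a r] assms by simp
  moreover have "c * (r - a) < y * v' r * (r - a)" using assms by simp
  ultimately show ?thesis by (simp add: algebra_simps)
qed

lemma objective_less_right:
  assumes "y * v' r \<le> c" "0 \<le> r" "r < b" "b \<le> A"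
  shows "y * v b - c * b < y * v r - c * r"
proof (cases "0 < y")
  case True
  then have "y * (v b - v r) < y * (v' r * (b - r))"
    using v_diff_bounds(2)[of r b] assms by simp
  moreover have "y * v' r * (b - r) \<le> c * (b - r)" using assms by (intro mult_right_mono) auto
  ultimately show ?thesis by (simp add: algebra_simps)
next
  case False
  then have "y * (v b - v r) \<le> 0" using v_strict_mono[of r b] assms by (simp add: mult_nonpos_nonneg)
  moreover have "0 < c * (b - r)" using assms c_pos by simp
  ultimately show ?thesis by (simp add: algebra_simps)
qed

text \<open>Existence is compactness. Of two maximisers \<open>a < b\<close>, the midpoint beats
  \<open>a\<close> if its marginal value exceeds \<open>c\<close>, and beats \<open>b\<close>
  otherwise.\<close>

lemma demand_ex1: "\<exists>!q. q \<in> {0..A} \<and> (\<forall>q'\<in>{0..A}. y * v q' - c * q' \<le> y * v q - c * q)"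
proof -
  have "\<exists>q\<in>{0..A}. \<forall>q'\<in>{0..A}. y * v q' - c * q' \<le> y * v q - c * q"
    by (rule continuous_attains_sup) (use A_pos in \<open>auto intro!: continuous_intros v_cont\<close>)
  moreover have False
    if "a < b" "a \<in> {0..A}" "b \<in> {0..A}"
      and max: "\<forall>q'\<in>{0..A}. y * v q' - c * q' \<le> y * v a - c * a"
        "\<forall>q'\<in>{0..A}. y * v q' - c * q' \<le> y * v b - c * b" for a b
  proof -
    let ?r = "(a + b) / 2"
    have r: "?r \<in> {0..A}" "a < ?r" "?r < b" using that by auto
    show False
      using objective_less_left[of y ?r a] objective_less_right[of y ?r b] max r that(2,3)
      by (smt (verit) atLeastAtMost_iff)
  qed
  ultimately show ?thesis by (metis linorder_less_linear)
qed

lemma demand_in: "demand y \<in> {0..A}"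
  and demand_max: "q \<in> {0..A} \<Longrightarrow> y * v q - c * q \<le> y * v (demand y) - c * demand y"
  using theI'[OF demand_ex1[of y]] unfolding demand_def by auto

lemma demand_less:
  assumes "q \<in> {0..A}" "q \<noteq> demand y"
  shows "y * v q - c * q < y * v (demand y) - c * demand y"
proof (rule ccontr)
  assume "\<not> ?thesis"
  then have "\<forall>q'\<in>{0..A}. y * v q' - c * q' \<le> y * v q - c * q"
    using demand_max by (meson not_less order_trans)
  then show False using demand_ex1[of y] demand_in demand_max assms by blast
qed

text \<open>The first-order condition as an equivalence that also covers corner solutions. It
  identifies the types to whom level \<open>r\<close> is served: those whose virtual value exceeds
  \<open>c / v' r\<close>.\<close>

lemma demand_gt_iff:
  assumes "0 \<le> r" "r < A" shows "r < demand y \<longleftrightarrow> c < y * v' r"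
proof
  assume "r < demand y"
  then show "c < y * v' r"
    using objective_less_right[of y r "demand y"] demand_max[of r y] demand_in[of y] assms
    by (smt (verit) atLeastAtMost_iff)
next
  assume y: "c < y * v' r"
  have "((\<lambda>r. y * v' r) \<longlongrightarrow> y * v' r) (at r within {0..A})"
    using v'_cont assms by (intro tendsto_intros) (auto simp: continuous_on)
  then have "\<forall>\<^sub>F s in at r within {0..A}. c < y * v' s"
    using y by (rule order_tendstoD)
  then obtain d where d: "d > 0" "\<And>s. s \<in> {0..A} \<Longrightarrow> s \<noteq> r \<Longrightarrow> dist s r < d \<Longrightarrow> c < y * v' s"
    by (auto simp: eventually_at)
  define s where "s = min A (r + d / 2)"
  have s: "r < s" "s \<le> A" "dist s r < d" using assms d by (auto simp: s_def dist_real_def)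
  have "c < y * v' s" using d(2)[of s] s assms by auto
  then show "r < demand y"
    using objective_less_left[of y s "demand y"] demand_max[of s y] demand_in[of y] s assms
    by (smt (verit) atLeastAtMost_iff)
qed

lemma demand_mono: assumes "y \<le> z" shows "demand y \<le> demand z"
proof (rule ccontr)
  assume "\<not> ?thesis"
  then have *: "demand z < demand y" by simp
  then have "c < y * v' (demand z)"
    using demand_gt_iff[of "demand z" y] demand_in[of y] demand_in[of z] by auto
  also have "\<dots> \<le> z * v' (demand z)"
    using assms v'_pos[OF demand_in[of z]] by (intro mult_right_mono) auto
  finally show False
    using demand_gt_iff[of "demand z" z] demand_in[of z] demand_in[of y] * by auto
qed

lemma U_LF_eq: "U_LF \<theta> = \<theta> * v (demand \<theta>) - c * demand \<theta>"
  unfolding U_LF_def by (rule cSup_eq_maximum) (use demand_in demand_max in auto)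

section \<open>Mechanisms as monotone allocations\<close>

text \<open>A direct mechanism is encoded by the rent \<open>u\<close> of the lowest type and the allocation
  \<open>x = v \<circ> q\<close> in units of gross utility; the envelope formula then determines all rents.\<close>

definition adm :: "(real \<Rightarrow> real) \<Rightarrow> bool" where
  "adm x \<longleftrightarrow> mono x \<and> (\<forall>\<theta>. x \<theta> \<in> {v 0..v A})"

definition rent :: "real \<Rightarrow> (real \<Rightarrow> real) \<Rightarrow> real \<Rightarrow> real" where
  "rent u x \<theta> = u + (\<integral>s. indicator {..<\<theta>} s * x s \<partial>L)"

definition relaxed :: "real \<Rightarrow> (real \<Rightarrow> real) \<Rightarrow> bool" where
  "relaxed u x \<longleftrightarrow> adm x \<and> (\<forall>\<theta>\<in>{lo..hi}. U_LF \<theta> \<le> rent u x \<theta>)"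

text \<open>Only the payment of type \<open>lo\<close> is required to be nonnegative. The payments
  \<open>\<theta> * x \<theta> - rent u x \<theta>\<close> are smallest at \<open>lo\<close>, so
  this is the whole no-lump-sum constraint.\<close>

definition no_subsidy :: "real \<Rightarrow> (real \<Rightarrow> real) \<Rightarrow> bool" where
  "no_subsidy u x \<longleftrightarrow> u \<le> lo * x lo"

definition surplus :: "(real \<Rightarrow> real) \<Rightarrow> real \<Rightarrow> real" where
  "surplus x \<theta> = clamp \<theta> * x \<theta> - c * w (x \<theta>)"

text \<open>Welfare with the payment eliminated: substituting
  \<open>\<omega> = \<alpha> - gap\<close> leaves \<open>\<alpha>\<close> times the surplus minus
  the net social cost of the rents.\<close>

definition J :: "real \<Rightarrow> (real \<Rightarrow> real) \<Rightarrow> real" where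
  "J u x = (\<integral>\<theta>. \<alpha> * surplus x \<theta> - gap \<theta> * rent u x \<theta> \<partial>M)"

lemma v0_le_vA: "v 0 \<le> v A" and v0_nonneg: "0 \<le> v 0"
  using v_mono[of 0 A] v_nonneg[of 0] A_pos by auto

lemma adm_mono: "adm x \<Longrightarrow> a \<le> b \<Longrightarrow> x a \<le> x b"
  by (auto simp: adm_def mono_def)

lemma adm_range: "adm x \<Longrightarrow> x \<theta> \<in> {v 0..v A}"
  by (auto simp: adm_def)

lemma adm_bounds: "adm x \<Longrightarrow> v 0 \<le> x \<theta> \<and> x \<theta> \<le> v A \<and> 0 \<le> x \<theta>"
  using adm_range[of x \<theta>] v0_nonneg by auto

lemma adm_bdd_borel: "adm x \<Longrightarrow> bdd_borel x"
  by (rule bdd_borel_mono[of _ "v A"]) (simp_all add: adm_bounds, simp add: adm_def)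

lemma adm_w_bdd_borel: "adm x \<Longrightarrow> bdd_borel (\<lambda>\<theta>. w (x \<theta>))"
  by (intro w_bdd_borel bdd_borel_measurable adm_bdd_borel)

lemma surplus_bdd_borel: "adm x \<Longrightarrow> bdd_borel (surplus x)"
  unfolding surplus_def by (intro bdd_borel_intros clamp_bdd_borel adm_bdd_borel adm_w_bdd_borel)

lemma rent_diff:
  assumes "bdd_borel x" "a \<le> b" shows "rent u x b - rent u x a = (\<integral>s. indicator {a..<b} s * x s \<partial>L)"
proof -
  have "rent u x b - rent u x a = (\<integral>s. indicator {..<b} s * x s - indicator {..<a} s * x s \<partial>L)"
    unfolding rent_def
    by (subst Bochner_Integration.integral_diff) (auto intro!: int_L bdd_borel_intros assms)
  also have "\<dots> = (\<integral>s. indicator {a..<b} s * x s \<partial>L)"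
    by (rule Bochner_Integration.integral_cong) (use assms in \<open>auto split: split_indicator\<close>)
  finally show ?thesis .
qed

lemma rent_lo: assumes "bdd_borel x" shows "rent u x lo = u"
proof -
  have "(\<integral>s. indicator {..<lo} s * x s \<partial>L) = (\<integral>s. 0 \<partial>L)"
    by (rule cong_L_interior) (auto intro!: bdd_borel_intros assms split: split_indicator)
  then show ?thesis by (simp add: rent_def)
qed

lemma rent_lower:
  assumes "adm x" "lo \<le> a" "a \<le> b" "b \<le> hi" shows "x a * (b - a) \<le> rent u x b - rent u x a"
proof -
  note bx = adm_bdd_borel[OF assms(1)]
  have "(\<integral>s. x a * indicator {a..<b} s \<partial>L) \<le> (\<integral>s. indicator {a..<b} s * x s \<partial>L)"
    by (rule integral_mono)
       (use adm_mono[OF assms(1)] in \<open>auto intro!: int_L bdd_borel_intros bx split: split_indicator\<close>)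
  then show ?thesis
    unfolding rent_diff[OF adm_bdd_borel[OF assms(1)] assms(3)] integral_mult_right_zero integral_indicator_L[OF assms(2-4)] .
qed

lemma rent_upper:
  assumes "adm x" "lo \<le> a" "a \<le> b" "b \<le> hi" shows "rent u x b - rent u x a \<le> x b * (b - a)"
proof -
  note bx = adm_bdd_borel[OF assms(1)]
  have "(\<integral>s. indicator {a..<b} s * x s \<partial>L) \<le> (\<integral>s. x b * indicator {a..<b} s \<partial>L)"
    by (rule integral_mono)
       (use adm_mono[OF assms(1)] in \<open>auto intro!: int_L bdd_borel_intros bx split: split_indicator\<close>)
  then show ?thesis
    unfolding rent_diff[OF adm_bdd_borel[OF assms(1)] assms(3)] integral_mult_right_zero integral_indicator_L[OF assms(2-4)] .
qed

lemma rent_bdd_borel: assumes "bdd_borel x" shows "bdd_borel (rent u x)"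
proof -
  obtain B where B: "0 \<le> B" "\<And>s. \<bar>x s\<bar> \<le> B" using assms by (metis bdd_borel_bound)
  have bd: "\<bar>rent u x \<theta>\<bar> \<le> \<bar>u\<bar> + (\<integral>s. B \<partial>L)" for \<theta>
  proof -
    have "\<bar>\<integral>s. indicator {..<\<theta>} s * x s \<partial>L\<bar> \<le> (\<integral>s. \<bar>indicator {..<\<theta>} s * x s\<bar> \<partial>L)"
      by (rule integral_abs_bound)
    also have "\<dots> \<le> (\<integral>s. B \<partial>L)"
      by (rule integral_mono)
         (use B in \<open>auto intro!: int_L integrable_abs bdd_borel_intros assms split: split_indicator\<close>)
    finally show ?thesis unfolding rent_def by linarith
  qed
  \<comment> \<open>Adding the bound \<open>B\<close> makes the integrand nonnegative, so the rent
    is, up to a constant, a difference of two nondecreasing functions and thus Borel.\<close>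
  define y where "y s = x s + B" for s
  have y: "bdd_borel y" unfolding y_def by (intro bdd_borel_intros assms)
  have ynn: "0 \<le> y s" for s using B(2)[of s] by (auto simp: y_def)
  have mono: "mono (rent 0 y)"
  proof
    fix a b :: real assume "a \<le> b"
    have "0 \<le> (\<integral>s. indicator {a..<b} s * y s \<partial>L)"
      by (rule Bochner_Integration.integral_nonneg) (use ynn in \<open>auto split: split_indicator\<close>)
    then show "rent 0 y a \<le> rent 0 y b" using rent_diff[OF y \<open>a \<le> b\<close>, of 0] by linarith
  qed
  have mono': "mono (rent 0 (\<lambda>_. B))"
  proof
    fix a b :: real assume "a \<le> b"
    have "0 \<le> (\<integral>s. indicator {a..<b} s * B \<partial>L)"
      by (rule Bochner_Integration.integral_nonneg) (use B in \<open>auto split: split_indicator\<close>)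
    then show "rent 0 (\<lambda>_. B) a \<le> rent 0 (\<lambda>_. B) b"
      using rent_diff[OF bdd_borel_const \<open>a \<le> b\<close>, of 0 B] by linarith
  qed
  have eq: "rent u x \<theta> = u + (rent 0 y \<theta> - rent 0 (\<lambda>_. B) \<theta>)" for \<theta>
    unfolding rent_def y_def distrib_left
    by (subst Bochner_Integration.integral_add) (auto intro!: int_L bdd_borel_intros assms)
  have "rent u x \<in> borel_measurable borel"
    using borel_measurable_mono[OF mono] borel_measurable_mono[OF mono']
    by (subst eq[abs_def]) auto
  then show ?thesis using bd by (rule bdd_borelI)
qed

lemma rent_mix:
  assumes "bdd_borel x" "bdd_borel y"
  shows "rent ((1 - l) * u + l * u') (\<lambda>s. (1 - l) * x s + l * y s) \<theta> = (1 - l) * rent u x \<theta> + l * rent u' y \<theta>"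
proof -
  have "(\<integral>s. indicator {..<\<theta>} s * ((1 - l) * x s + l * y s) \<partial>L)
      = (\<integral>s. (1 - l) * (indicator {..<\<theta>} s * x s) + l * (indicator {..<\<theta>} s * y s) \<partial>L)"
    by (rule Bochner_Integration.integral_cong) (auto simp: algebra_simps)
  also have "\<dots> = (1 - l) * (\<integral>s. indicator {..<\<theta>} s * x s \<partial>L) + l * (\<integral>s. indicator {..<\<theta>} s * y s \<partial>L)"
    by (subst Bochner_Integration.integral_add) (auto intro!: int_L bdd_borel_intros assms)
  finally show ?thesis by (simp add: rent_def algebra_simps)
qed

lemma rent_shift: "rent (u + k) x \<theta> = rent u x \<theta> + k"
  by (simp add: rent_def)

lemma rent_le:
  assumes "bdd_borel x" "bdd_borel y" "u \<le> u'" "AE s in L. s < \<theta> \<longrightarrow> x s \<le> y s"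
  shows "rent u x \<theta> \<le> rent u' y \<theta>"
  unfolding rent_def
  by (intro add_mono mono_L) (use assms in \<open>auto intro!: bdd_borel_intros elim!: eventually_mono split: split_indicator\<close>)

lemma rent_cong_AE:
  assumes "bdd_borel x" "bdd_borel y" "AE s in L. s < \<theta> \<longrightarrow> x s = y s"
  shows "rent u x \<theta> = rent u y \<theta>"
proof -
  have "AE s in L. s < \<theta> \<longrightarrow> x s \<le> y s" "AE s in L. s < \<theta> \<longrightarrow> y s \<le> x s"
    using assms(3) by (auto elim!: eventually_mono)
  then show ?thesis
    using rent_le[of x y u u \<theta>] rent_le[of y x u u \<theta>] assms by auto
qed

lemma integrand_bdd_borel: "adm x \<Longrightarrow> bdd_borel (\<lambda>\<theta>. \<alpha> * surplus x \<theta> - gap \<theta> * rent u x \<theta>)"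
  by (intro bdd_borel_intros surplus_bdd_borel gap_bdd_borel rent_bdd_borel adm_bdd_borel)

lemma J_eq:
  assumes "adm x"
  shows "J u x = \<alpha> * (\<integral>\<theta>. surplus x \<theta> \<partial>M) - (\<integral>\<theta>. gap \<theta> * rent u x \<theta> \<partial>M)"
  unfolding J_def
  by (subst Bochner_Integration.integral_diff)
     (simp_all add: int_M bdd_borel_intros surplus_bdd_borel gap_bdd_borel rent_bdd_borel adm_bdd_borel[OF assms] assms)

lemma J_shift: assumes "adm x" shows "J (u + k) x = J u x - k * (\<alpha> - mean_weight)"
proof -
  have "(\<integral>\<theta>. gap \<theta> * rent (u + k) x \<theta> \<partial>M) = (\<integral>\<theta>. gap \<theta> * rent u x \<theta> + k * gap \<theta> \<partial>M)"
    by (rule Bochner_Integration.integral_cong) (simp_all only: rent_shift, simp add: algebra_simps)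
  also have "\<dots> = (\<integral>\<theta>. gap \<theta> * rent u x \<theta> \<partial>M) + k * (\<integral>\<theta>. gap \<theta> \<partial>M)"
    by (subst Bochner_Integration.integral_add)
       (auto intro!: int_M bdd_borel_intros gap_bdd_borel rent_bdd_borel adm_bdd_borel[OF assms])
  finally show ?thesis by (simp add: J_eq[OF assms] mean_weight_eq algebra_simps)
qed

lemma J_cong_AE:
  assumes "adm x" "adm y" "AE \<theta> in L. x \<theta> = y \<theta>" shows "J u x = J u y"
proof -
  have r: "rent u x \<theta> = rent u y \<theta>" for \<theta>
    by (rule rent_cong_AE) (use assms in \<open>auto intro: adm_bdd_borel elim!: eventually_mono\<close>)
  show ?thesis unfolding J_def
    by (rule cong_M[OF integrand_bdd_borel integrand_bdd_borel])
       (use assms in \<open>auto simp: r surplus_def AE_L_iff_M simp del: mult_cancel_left elim!: eventually_mono\<close>)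
qed

text \<open>Integration by parts against the measure with distribution function \<open>G\<close>.\<close>

lemma integral_gap_rent:
  assumes x: "adm x" and ab: "lo \<le> a" "a \<le> b" "b \<le> hi"
  shows "(\<integral>\<theta>. indicator {a<..b} \<theta> * (gap \<theta> * rent u x \<theta>) \<partial>M)
       = rent u x a * (G b - G a) + (\<integral>s. indicator {a..<b} s * (x s * (G b - G s)) \<partial>L)"
proof -
  note bx = adm_bdd_borel[OF x]
  have *: "rent u x \<theta> = rent u x a + (\<integral>s. indicator {..<\<theta>} s * (indicator {a..} s * x s) \<partial>L)"
    if "a < \<theta>" for \<theta>
  proof -
    have "(\<integral>s. indicator {a..<\<theta>} s * x s \<partial>L) = (\<integral>s. indicator {..<\<theta>} s * (indicator {a..} s * x s) \<partial>L)"
      by (rule Bochner_Integration.integral_cong) (auto split: split_indicator)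
    then show ?thesis using rent_diff[OF bx, of a \<theta> u] that by simp
  qed
  define k where "k \<theta> = (indicator {a<..b} \<theta> * gap \<theta>)" for \<theta>
  have k: "bdd_borel k" unfolding k_def by (intro bdd_borel_intros gap_bdd_borel) auto
  define r where "r \<theta> = (\<integral>s. indicator {..<\<theta>} s * (indicator {a..} s * x s) \<partial>L)" for \<theta>
  have r: "bdd_borel r"
  proof -
    have "bdd_borel (\<lambda>s. indicator {a..} s * x s)" by (intro bdd_borel_intros bx) auto
    from rent_bdd_borel[OF this, of 0] show ?thesis by (simp add: r_def[abs_def] rent_def[abs_def])
  qed
  have "(\<integral>\<theta>. indicator {a<..b} \<theta> * (gap \<theta> * rent u x \<theta>) \<partial>M) = (\<integral>\<theta>. rent u x a * k \<theta> + k \<theta> * r \<theta> \<partial>M)"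
    by (rule Bochner_Integration.integral_cong)
       (auto simp: k_def r_def[symmetric] *[folded r_def] algebra_simps split: split_indicator)
  also have "\<dots> = rent u x a * (\<integral>\<theta>. k \<theta> \<partial>M) + (\<integral>\<theta>. k \<theta> * r \<theta> \<partial>M)"
    by (subst Bochner_Integration.integral_add) (auto intro!: int_M bdd_borel_intros k r)
  also have "(\<integral>\<theta>. k \<theta> \<partial>M) = G b - G a"
    using G_diff[OF ab(2)] by (simp add: k_def)
  also have "(\<integral>\<theta>. k \<theta> * r \<theta> \<partial>M) = (\<integral>s. (indicator {a..} s * x s) * (\<integral>\<theta>. k \<theta> * indicator {..<\<theta>} s \<partial>M) \<partial>L)"
    unfolding r_def
    by (rule Fubini_below_graph[OF finite_M sets_M finite_L sets_L k]) (auto intro!: bdd_borel_intros bx)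
  also have "\<dots> = (\<integral>s. indicator {a..<b} s * (x s * (G b - G s)) \<partial>L)"
  proof (rule Bochner_Integration.integral_cong[OF refl])
    fix s
    have "(\<integral>\<theta>. k \<theta> * indicator {..<\<theta>} s \<partial>M) = G b - G s" if "a \<le> s" "s < b"
    proof -
      have "(\<integral>\<theta>. k \<theta> * indicator {..<\<theta>} s \<partial>M) = (\<integral>\<theta>. indicator {s<..b} \<theta> * gap \<theta> \<partial>M)"
        by (rule Bochner_Integration.integral_cong) (use that in \<open>auto simp: k_def split: split_indicator\<close>)
      then show ?thesis using G_diff[of s b] that by simp
    qed
    moreover have "(\<integral>\<theta>. k \<theta> * indicator {..<\<theta>} s \<partial>M) = 0" if "b \<le> s"
    proof -
      have "(\<integral>\<theta>. k \<theta> * indicator {..<\<theta>} s \<partial>M) = (\<integral>\<theta>. 0 \<partial>M)"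
        by (rule Bochner_Integration.integral_cong) (use that in \<open>auto simp: k_def split: split_indicator\<close>)
      then show ?thesis by simp
    qed
    ultimately show "indicator {a..} s * x s * (\<integral>\<theta>. k \<theta> * indicator {..<\<theta>} s \<partial>M)
        = indicator {a..<b} s * (x s * (G b - G s))"
      by (cases "s < b") (auto split: split_indicator)
  qed
  finally show ?thesis .
qed

text \<open>The two incentive constraints of a pair of types add up to monotonicity of
  \<open>x\<close>; separately they squeeze the increment of indirect utility between the bounds
  that the increment of the integral satisfies. It applies to arbitrary mechanisms and to
  laissez-faire, seen as a mechanism charging \<open>c * demand \<theta>\<close>.\<close>

lemma envelope:
  assumes q: "\<And>\<theta>. \<theta> \<in> {lo..hi} \<Longrightarrow> q \<theta> \<in> {0..A}"
    and ic: "\<And>\<theta> \<theta>'. \<theta> \<in> {lo..hi} \<Longrightarrow> \<theta>' \<in> {lo..hi} \<Longrightarrow> \<theta> * v (q \<theta>') - t \<theta>' \<le> \<theta> * v (q \<theta>) - t \<theta>"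
  defines "x \<equiv> \<lambda>\<theta>. v (q (clamp \<theta>))" and "u \<equiv> lo * v (q lo) - t lo"
  shows "adm x" and "\<And>\<theta>. \<theta> \<in> {lo..hi} \<Longrightarrow> \<theta> * v (q \<theta>) - t \<theta> = rent u x \<theta>"
proof -
  have x_eq: "x \<theta> = v (q \<theta>)" if "\<theta> \<in> {lo..hi}" for \<theta> using that by (simp add: x_def clamp_id)
  have vm: "v (q a) \<le> v (q b)" if "a \<in> {lo..hi}" "b \<in> {lo..hi}" "a \<le> b" for a b
  proof (cases "a = b")
    case False
    have "(b - a) * (v (q b) - v (q a)) \<ge> 0"
      using ic[OF that(1,2)] ic[OF that(2,1)] by (simp add: algebra_simps)
    then show ?thesis using that False by (simp add: zero_le_mult_iff)
  qed auto
  show x: "adm x"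
    unfolding adm_def mono_def
    using vm[OF clamp_in clamp_in] v_range[OF q[OF clamp_in]] clamp_mono by (auto simp: x_def mono_def)
  show "\<theta> * v (q \<theta>) - t \<theta> = rent u x \<theta>" if \<theta>: "\<theta> \<in> {lo..hi}" for \<theta>
  proof -
    let ?N = "\<lambda>\<theta>. \<theta> * v (q \<theta>) - t \<theta>"
    have "?N \<theta> - ?N lo = rent u x \<theta> - rent u x lo"
    proof (rule integral_squeeze_eq[where g = x])
      show "lo \<le> \<theta>" using \<theta> by simp
      fix s t' assume st: "lo \<le> s" "s \<le> t'" "t' \<le> \<theta>"
      then have in': "s \<in> {lo..hi}" "t' \<in> {lo..hi}" using \<theta> by auto
      show "x s * (t' - s) \<le> ?N t' - ?N s \<and> x s * (t' - s) \<le> rent u x t' - rent u x s"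
        using ic[OF in'(2,1)] rent_lower[OF x, of s t' u] in' st by (auto simp: x_eq algebra_simps)
      show "?N t' - ?N s \<le> x t' * (t' - s) \<and> rent u x t' - rent u x s \<le> x t' * (t' - s)"
        using ic[OF in'] rent_upper[OF x, of s t' u] in' st by (auto simp: x_eq algebra_simps)
    qed
    then show ?thesis by (simp add: rent_lo adm_bdd_borel[OF x] u_def)
  qed
qed

lemma welfare_eq:
  assumes x: "adm x" and q: "\<And>\<theta>. \<theta> \<in> {lo..hi} \<Longrightarrow> q \<theta> \<in> {0..A} \<and> v (q \<theta>) = x \<theta>"
    and t: "\<And>\<theta>. \<theta> \<in> {lo..hi} \<Longrightarrow> \<theta> * v (q \<theta>) - t \<theta> = rent u x \<theta>"
  shows "welfare q t = J u x"
  unfolding welfare_def J_def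
proof (rule set_integral_M[OF integrand_bdd_borel[OF x]])
  fix \<theta> assume \<theta>: "\<theta> \<in> {lo..hi}"
  have wx: "w (x \<theta>) = q \<theta>" using q[OF \<theta>] w_v by metis
  have vq: "v (q \<theta>) = x \<theta>" using q[OF \<theta>] by simp
  have t: "t \<theta> = \<theta> * x \<theta> - rent u x \<theta>" using t[OF \<theta>] vq by simp
  show "\<omega> \<theta> * (\<theta> * v (q \<theta>) - t \<theta>) + \<alpha> * (t \<theta> - c * q \<theta>)
      = \<alpha> * surplus x \<theta> - gap \<theta> * rent u x \<theta>"
    unfolding t vq surplus_def wx gap_def clamp_id[OF \<theta>] by (simp add: algebra_simps)
qed

lemma reduce_mechanism:
  assumes "feasible_noLS q t"
  defines "x \<equiv> \<lambda>\<theta>. v (q (clamp \<theta>))" and "u \<equiv> lo * v (q lo) - t lo"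
  shows "relaxed u x" "welfare q t = J u x" "feasible q t \<Longrightarrow> no_subsidy u x"
    and "\<And>\<theta>. \<theta> \<in> {lo..hi} \<Longrightarrow> \<theta> * v (q \<theta>) - t \<theta> = rent u x \<theta>"
proof -
  have q: "\<And>\<theta>. \<theta> \<in> {lo..hi} \<Longrightarrow> q \<theta> \<in> {0..A}"
    and ic: "\<And>\<theta> \<theta>'. \<theta> \<in> {lo..hi} \<Longrightarrow> \<theta>' \<in> {lo..hi} \<Longrightarrow> \<theta> * v (q \<theta>') - t \<theta>' \<le> \<theta> * v (q \<theta>) - t \<theta>"
    and ir: "\<And>\<theta>. \<theta> \<in> {lo..hi} \<Longrightarrow> U_LF \<theta> \<le> \<theta> * v (q \<theta>) - t \<theta>"
    using assms(1) by (auto simp: feasible_noLS_def)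
  note env = envelope[of q t, OF q ic, folded x_def u_def]
  show eq: "\<theta> * v (q \<theta>) - t \<theta> = rent u x \<theta>" if "\<theta> \<in> {lo..hi}" for \<theta>
    using env(2) that by blast
  have x: "adm x" using env(1) by blast
  show "relaxed u x" using x eq ir by (auto simp: relaxed_def)
  show "welfare q t = J u x"
    by (rule welfare_eq[OF x]) (use eq q in \<open>auto simp: x_def clamp_id\<close>)
  show "no_subsidy u x" if "feasible q t"
    using that lo_less_hi by (auto simp: no_subsidy_def u_def x_def clamp_id feasible_def)
qed

lemma expand_mechanism:
  assumes "relaxed u x"
  defines "q \<equiv> \<lambda>\<theta>. w (x \<theta>)" and "t \<equiv> \<lambda>\<theta>. \<theta> * x \<theta> - rent u x \<theta>"
  shows "feasible_noLS q t" "welfare q t = J u x" "no_subsidy u x \<Longrightarrow> feasible q t"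
proof -
  have x: "adm x" and ir: "\<And>\<theta>. \<theta> \<in> {lo..hi} \<Longrightarrow> U_LF \<theta> \<le> rent u x \<theta>"
    using assms by (auto simp: relaxed_def)
  have vq: "v (q \<theta>) = x \<theta>" for \<theta> using v_w[OF adm_range[OF x]] by (simp add: q_def)
  show noLS: "feasible_noLS q t"
    unfolding feasible_noLS_def
  proof (intro conjI ballI)
    fix \<theta> assume \<theta>: "\<theta> \<in> {lo..hi}"
    show "q \<theta> \<in> {0..A}" using w_in by (simp add: q_def)
    show "U_LF \<theta> \<le> \<theta> * v (q \<theta>) - t \<theta>" using ir[OF \<theta>] by (simp add: vq t_def)
    fix \<theta>' assume \<theta>': "\<theta>' \<in> {lo..hi}"
    show "\<theta> * v (q \<theta>') - t \<theta>' \<le> \<theta> * v (q \<theta>) - t \<theta>"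
      using rent_lower[OF x, of \<theta>' \<theta> u] rent_upper[OF x, of \<theta> \<theta>' u] \<theta> \<theta>'
      by (cases "\<theta>' \<le> \<theta>") (auto simp: vq t_def algebra_simps)
  qed
  show "welfare q t = J u x"
    by (rule welfare_eq[OF x]) (use w_in vq in \<open>auto simp: t_def q_def\<close>)
  show "feasible q t" if "no_subsidy u x"
    unfolding feasible_def
  proof (intro conjI ballI noLS)
    fix \<theta> assume \<theta>: "\<theta> \<in> {lo..hi}"
    have "rent u x \<theta> - u \<le> x \<theta> * (\<theta> - lo)"
      using rent_upper[OF x, of lo \<theta> u] \<theta> by (simp add: rent_lo adm_bdd_borel[OF x])
    moreover have "lo * x lo \<le> lo * x \<theta>" using adm_mono[OF x, of lo \<theta>] \<theta> lo_pos by simp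
    ultimately show "0 \<le> t \<theta>" using that by (simp add: t_def no_subsidy_def algebra_simps)
  qed
qed

definition x_LF :: "real \<Rightarrow> real" where "x_LF \<theta> = v (demand (clamp \<theta>))"

lemma x_LF_adm: "adm x_LF"
  and U_LF_rent: "\<theta> \<in> {lo..hi} \<Longrightarrow> U_LF \<theta> = rent (U_LF lo) x_LF \<theta>"
proof -
  have ic: "\<theta> * v (demand \<theta>') - c * demand \<theta>' \<le> \<theta> * v (demand \<theta>) - c * demand \<theta>" for \<theta> \<theta>'
    using demand_max[OF demand_in] .
  note env = envelope[of demand "\<lambda>\<theta>. c * demand \<theta>", OF demand_in ic]
  show "adm x_LF" using env(1) by (simp add: x_LF_def[abs_def])
  show "U_LF \<theta> = rent (U_LF lo) x_LF \<theta>" if "\<theta> \<in> {lo..hi}"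
    using env(2)[OF that] by (simp add: x_LF_def[abs_def] U_LF_eq)
qed

lemma relaxed_LF: "relaxed (U_LF lo) x_LF"
  by (simp add: relaxed_def x_LF_adm U_LF_rent[symmetric])

text \<open>Laissez-faire charges each type the cost of its quality, which is nonnegative. It thus
  serves as a feasible reference point.\<close>

lemma no_subsidy_LF: "no_subsidy (U_LF lo) x_LF"
  using demand_in[of lo] c_pos lo_less_hi by (auto simp: no_subsidy_def U_LF_eq x_LF_def clamp_id)

lemma surplus_le_LF: assumes "adm x" shows "surplus x \<theta> \<le> surplus x_LF \<theta>"
  using demand_max[OF w_in, of "clamp \<theta>" "x \<theta>"] adm_range[OF assms, of \<theta>]
  by (simp add: surplus_def x_LF_def v_w w_v[OF demand_in])

lemma surplus_less_LF: assumes "adm x" "x \<theta> \<noteq> x_LF \<theta>" shows "surplus x \<theta> < surplus x_LF \<theta>"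
proof -
  have "v (w (x \<theta>)) \<noteq> v (demand (clamp \<theta>))" using assms adm_range[OF assms(1), of \<theta>] by (simp add: v_w x_LF_def)
  then have "w (x \<theta>) \<noteq> demand (clamp \<theta>)" by auto
  from demand_less[OF w_in this] show ?thesis
    using adm_range[OF assms(1), of \<theta>] by (simp add: surplus_def x_LF_def v_w w_v[OF demand_in])
qed

section \<open>Existence and structure of the optimum\<close>

abbreviation mix :: "real \<Rightarrow> (real \<Rightarrow> real) \<Rightarrow> (real \<Rightarrow> real) \<Rightarrow> real \<Rightarrow> real" where
  "mix l x y \<equiv> \<lambda>s. (1 - l) * x s + l * y s"

lemma adm_mix: assumes "adm x" "adm y" "0 \<le> l" "l \<le> 1" shows "adm (mix l x y)"
  unfolding adm_def
proof (intro conjI allI)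
  show "mono (mix l x y)"
    using adm_mono[OF assms(1)] adm_mono[OF assms(2)] assms(3,4)
    by (auto simp: mono_def intro!: add_mono mult_left_mono)
  show "mix l x y \<theta> \<in> {v 0..v A}" for \<theta>
    using convexD_alt[of "{v 0..v A}" "x \<theta>" "y \<theta>" l] adm_range[OF assms(1)] adm_range[OF assms(2)] assms(3,4)
    by auto
qed

lemma relaxed_mix:
  assumes "relaxed u x" "relaxed u' y" "0 \<le> l" "l \<le> 1"
  shows "relaxed ((1 - l) * u + l * u') (mix l x y)"
  unfolding relaxed_def
proof (intro conjI ballI)
  have xy: "adm x" "adm y" using assms by (auto simp: relaxed_def)
  show "adm (mix l x y)" using adm_mix xy assms by blast
  fix \<theta> assume "\<theta> \<in> {lo..hi}"
  then have "U_LF \<theta> \<le> rent u x \<theta>" "U_LF \<theta> \<le> rent u' y \<theta>" using assms by (auto simp: relaxed_def)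
  then have "(1 - l) * U_LF \<theta> + l * U_LF \<theta> \<le> (1 - l) * rent u x \<theta> + l * rent u' y \<theta>"
    using assms(3,4) by (intro add_mono mult_left_mono) auto
  then show "U_LF \<theta> \<le> rent ((1 - l) * u + l * u') (mix l x y) \<theta>"
    unfolding rent_mix[OF adm_bdd_borel[OF xy(1)] adm_bdd_borel[OF xy(2)]] by (simp add: algebra_simps)
qed

lemma integral_M_lincomb:
  assumes "bdd_borel h" "bdd_borel k" "bdd_borel r"
  shows "(\<integral>\<theta>. (a * h \<theta> + b * k \<theta>) + d * r \<theta> \<partial>M) = a * (\<integral>\<theta>. h \<theta> \<partial>M) + b * (\<integral>\<theta>. k \<theta> \<partial>M) + d * (\<integral>\<theta>. r \<theta> \<partial>M)"
  using int_M[OF assms(1)] int_M[OF assms(2)] int_M[OF assms(3)] by simp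

text \<open>Rents and gross utilities are linear in \<open>(u, x)\<close>, so the production cost
  alone contributes a nonlinear term: the convexity gap of \<open>w\<close>. Concavity of
  \<open>J\<close>, and its strictness up to null sets, can be read off.\<close>

lemma J_mix_eq:
  assumes "adm x" "adm y" "0 \<le> l" "l \<le> 1"
  shows "J ((1 - l) * u + l * u') (mix l x y) = (1 - l) * J u x + l * J u' y
    + \<alpha> * (\<integral>\<theta>. c * ((1 - l) * w (x \<theta>) + l * w (y \<theta>) - w (mix l x y \<theta>)) \<partial>M)"
proof -
  note b = integrand_bdd_borel[OF assms(1)] integrand_bdd_borel[OF assms(2)]
    adm_w_bdd_borel[OF assms(1)] adm_w_bdd_borel[OF assms(2)] adm_w_bdd_borel[OF adm_mix[OF assms]]
  have "J ((1 - l) * u + l * u') (mix l x y)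
     = (\<integral>\<theta>. ((1 - l) * (\<alpha> * surplus x \<theta> - gap \<theta> * rent u x \<theta>) + l * (\<alpha> * surplus y \<theta> - gap \<theta> * rent u' y \<theta>))
          + \<alpha> * (c * ((1 - l) * w (x \<theta>) + l * w (y \<theta>) - w (mix l x y \<theta>))) \<partial>M)"
    unfolding J_def rent_mix[OF adm_bdd_borel[OF assms(1)] adm_bdd_borel[OF assms(2)]]
    by (rule Bochner_Integration.integral_cong) (auto simp: surplus_def algebra_simps)
  also have "\<dots> = (1 - l) * J u x + l * J u' y
      + \<alpha> * (\<integral>\<theta>. c * ((1 - l) * w (x \<theta>) + l * w (y \<theta>) - w (mix l x y \<theta>)) \<partial>M)"
    unfolding J_def
    by (rule integral_M_lincomb) (rule b, rule b, intro bdd_borel_intros b)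
  finally show ?thesis .
qed

lemma J_mix:
  assumes "adm x" "adm y" "0 \<le> l" "l \<le> 1"
  shows "(1 - l) * J u x + l * J u' y \<le> J ((1 - l) * u + l * u') (mix l x y)"
proof -
  have "0 \<le> (\<integral>\<theta>. c * ((1 - l) * w (x \<theta>) + l * w (y \<theta>) - w (mix l x y \<theta>)) \<partial>M)"
    by (rule Bochner_Integration.integral_nonneg)
       (use w_convex[OF adm_range[OF assms(1)] adm_range[OF assms(2)] assms(3,4)] c_pos in auto)
  then show ?thesis unfolding J_mix_eq[OF assms] using \<alpha>_pos by simp
qed

lemma J_mix_strict:
  assumes "adm x" "adm y" "0 < l" "l < 1"
    and le: "J ((1 - l) * u + l * u') (mix l x y) \<le> (1 - l) * J u x + l * J u' y"
  shows "AE \<theta> in L. x \<theta> = y \<theta>"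
proof -
  let ?d = "\<lambda>\<theta>. c * ((1 - l) * w (x \<theta>) + l * w (y \<theta>) - w (mix l x y \<theta>))"
  have l: "0 \<le> l" "l \<le> 1" using assms by auto
  have nn: "0 \<le> ?d \<theta>" for \<theta>
    using w_convex[OF adm_range[OF assms(1)] adm_range[OF assms(2)] l] c_pos by auto
  have int: "integrable M ?d"
    by (intro int_M bdd_borel_intros adm_w_bdd_borel adm_mix assms l)
  have "(\<integral>\<theta>. ?d \<theta> \<partial>M) \<le> 0"
    using le \<alpha>_pos unfolding J_mix_eq[OF assms(1,2) l] by (simp add: mult_le_0_iff)
  moreover have "0 \<le> (\<integral>\<theta>. ?d \<theta> \<partial>M)"
    by (rule Bochner_Integration.integral_nonneg) (rule nn)
  ultimately have "(\<integral>\<theta>. ?d \<theta> \<partial>M) = 0" by simp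
  then have "AE \<theta> in M. ?d \<theta> = 0"
    using integral_nonneg_eq_0_iff_AE[OF int] nn by simp
  then show ?thesis unfolding AE_L_iff_M
  proof eventually_elim
    case (elim \<theta>)
    then show ?case
      using w_strict_convex[OF adm_range[OF assms(1)] adm_range[OF assms(2)] _ assms(3,4), of \<theta> \<theta>] c_pos by auto
  qed
qed

section \<open>Versions of an allocation: one-sided limits and null sets\<close>

lemma AE_L_exists:
  assumes "AE s in L. P s" "lo \<le> a" "a < b" "b \<le> hi" obtains s where "a < s" "s < b" "P s"
proof -
  have "\<exists>s. a < s \<and> s < b \<and> P s"
  proof (rule ccontr)
    assume *: "\<not> ?thesis"
    have "AE s in lborel. s \<notin> {a<..<b}"
      using assms(1)[unfolded AE_L_iff] by eventually_elim (use * assms in auto)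
    then show False using assms AE_iff_null_sets[of "{a<..<b}" lborel] by (simp add: null_sets_def)
  qed
  then show thesis using that by blast
qed

text \<open>A right-continuous version of a monotone allocation, as Helly's theorem requires. At
  \<open>lo\<close> it is the allocation of the lowest types, whatever value \<open>x\<close> takes
  at \<open>lo\<close> itself.\<close>

definition right_lim :: "(real \<Rightarrow> real) \<Rightarrow> real \<Rightarrow> real" where
  "right_lim x \<theta> = (INF s\<in>{\<theta><..}. x s)"

context fixes x assumes x: "adm x" begin

lemma right_lim_le: "\<theta> < s \<Longrightarrow> right_lim x \<theta> \<le> x s"
  unfolding right_lim_def
  by (rule cINF_lower) (auto intro!: bdd_belowI[of _ "v 0"] simp: adm_bounds[OF x])

lemma right_lim_ge: "(\<And>s. \<theta> < s \<Longrightarrow> k \<le> x s) \<Longrightarrow> k \<le> right_lim x \<theta>"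
  unfolding right_lim_def by (rule cINF_greatest) auto

lemma le_right_lim: "x \<theta> \<le> right_lim x \<theta>"
  by (rule right_lim_ge) (use adm_mono[OF x] in auto)

lemma adm_right_lim: "adm (right_lim x)"
  unfolding adm_def
proof (intro conjI allI)
  show "mono (right_lim x)"
    by (rule monoI, rule right_lim_ge) (use right_lim_le in auto)
  show "right_lim x \<theta> \<in> {v 0..v A}" for \<theta>
    using right_lim_le[of \<theta> "\<theta> + 1"] le_right_lim[of \<theta>] adm_bounds[OF x, of \<theta>] adm_bounds[OF x, of "\<theta> + 1"] by auto
qed

lemma right_lim_cont: "continuous (at_right \<theta>) (right_lim x)"
  unfolding continuous_within
proof (rule order_tendstoI)
  fix a assume "a < right_lim x \<theta>"
  then show "\<forall>\<^sub>F t in at_right \<theta>. a < right_lim x t"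
    using adm_mono[OF adm_right_lim, of \<theta>] by (intro eventually_at_rightI[of \<theta> "\<theta> + 1"]) (auto intro: less_le_trans)
next
  fix a assume "right_lim x \<theta> < a"
  then obtain s where s: "\<theta> < s" "x s < a"
    using right_lim_ge[of \<theta> a] by (meson not_less)
  then show "\<forall>\<^sub>F t in at_right \<theta>. right_lim x t < a"
    by (intro eventually_at_rightI[of \<theta> s]) (auto intro: le_less_trans right_lim_le)
qed

lemma right_lim_isCont: assumes "isCont x \<theta>" shows "right_lim x \<theta> = x \<theta>"
proof (rule antisym[OF _ le_right_lim])
  have "(x \<longlongrightarrow> x \<theta>) (at_right \<theta>)"
    using assms by (auto simp: isCont_def intro: tendsto_mono at_le)
  then show "right_lim x \<theta> \<le> x \<theta>"
    by (rule tendsto_lowerbound)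
       (auto intro!: eventually_at_rightI[of \<theta> "\<theta> + 1"] right_lim_le)
qed

lemma AE_isCont: "AE \<theta> in L. lo < \<theta> \<and> \<theta> < hi \<and> isCont x \<theta>"
proof -
  have "countable {a. \<not> isCont x a}" using x by (intro mono_ctble_discont) (simp add: adm_def)
  from AE_L_countable[OF this] AE_L_interior show ?thesis
    by eventually_elim auto
qed

lemma right_lim_AE: "AE \<theta> in L. right_lim x \<theta> = x \<theta>"
  using AE_isCont by eventually_elim (simp add: right_lim_isCont)

text \<open>Among all versions of an allocation this one has the pointwise smallest payments.\<close>

definition left_lim :: "real \<Rightarrow> real" where
  "left_lim \<theta> = (if \<theta> \<le> lo then right_lim x lo else (SUP s\<in>{..<\<theta>}. x s))"

lemma le_left_lim: "lo < \<theta> \<Longrightarrow> s < \<theta> \<Longrightarrow> x s \<le> left_lim \<theta>"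
  unfolding left_lim_def
  by (simp, rule cSUP_upper) (auto intro!: bdd_aboveI[of _ "v A"] simp: adm_bounds[OF x])

lemma left_lim_le: "lo < \<theta> \<Longrightarrow> (\<And>s. s < \<theta> \<Longrightarrow> x s \<le> k) \<Longrightarrow> left_lim \<theta> \<le> k"
  unfolding left_lim_def by (simp, rule cSUP_least) auto

lemma right_lim_le_left_lim: "right_lim x lo \<le> left_lim \<theta>"
proof (cases "\<theta> \<le> lo")
  case False
  then have "right_lim x lo \<le> x ((lo + \<theta>) / 2)" "x ((lo + \<theta>) / 2) \<le> left_lim \<theta>"
    using right_lim_le[of lo "(lo + \<theta>) / 2"] le_left_lim[of \<theta> "(lo + \<theta>) / 2"] by auto
  then show ?thesis by simp
qed (simp add: left_lim_def)

lemma adm_left_lim: "adm left_lim"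
  unfolding adm_def
proof (intro conjI allI)
  show "mono left_lim"
  proof
    fix a b :: real assume "a \<le> b"
    show "left_lim a \<le> left_lim b"
    proof (cases "a \<le> lo")
      case True
      then show ?thesis using right_lim_le_left_lim[of b] by (simp add: left_lim_def)
    next
      case False
      then show ?thesis using \<open>a \<le> b\<close> by (intro left_lim_le) (auto intro: le_left_lim)
    qed
  qed
  show "left_lim \<theta> \<in> {v 0..v A}" for \<theta>
  proof (cases "\<theta> \<le> lo")
    case True
    then show ?thesis using adm_range[OF adm_right_lim, of lo] by (simp add: left_lim_def)
  next
    case False
    then show ?thesis
      using left_lim_le[of \<theta> "v A"] right_lim_le_left_lim[of \<theta>] adm_bounds[OF adm_right_lim, of lo]
        adm_bounds[OF x] by force
  qed
qed

lemma left_lim_AE: "AE \<theta> in L. left_lim \<theta> = x \<theta>"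
  using AE_isCont
proof eventually_elim
  case (elim \<theta>)
  have "(x \<longlongrightarrow> x \<theta>) (at_left \<theta>)"
    using elim by (auto simp: isCont_def intro: tendsto_mono at_le)
  then have "x \<theta> \<le> left_lim \<theta>"
    by (rule tendsto_upperbound)
       (use elim in \<open>auto intro!: eventually_at_leftI[of "\<theta> - 1" \<theta>] le_left_lim\<close>)
  moreover have "left_lim \<theta> \<le> x \<theta>" using elim adm_mono[OF x] by (intro left_lim_le) auto
  ultimately show ?case by simp
qed

end

section \<open>Existence and uniqueness for the encoded problem\<close>

definition best :: "real \<Rightarrow> (real \<Rightarrow> real) \<Rightarrow> bool" where
  "best u x \<longleftrightarrow> relaxed u x \<and> no_subsidy u x \<and>
     (\<forall>u' x'. relaxed u' x' \<and> no_subsidy u' x' \<longrightarrow> J u' x' \<le> J u x)"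

lemma relaxed_ge: "relaxed u x \<Longrightarrow> U_LF lo \<le> u"
  using lo_less_hi by (force simp: relaxed_def rent_lo[OF adm_bdd_borel])

lemma relaxed_cong_AE:
  assumes "relaxed u x" "adm y" "AE s in L. y s = x s" "u \<le> u'"
  shows "relaxed u' y"
  unfolding relaxed_def
proof (intro conjI ballI assms(2))
  fix \<theta> assume "\<theta> \<in> {lo..hi}"
  then have "U_LF \<theta> \<le> rent u x \<theta>" using assms by (auto simp: relaxed_def)
  also have "\<dots> \<le> rent u' y \<theta>"
    using assms by (intro rent_le adm_bdd_borel) (auto simp: relaxed_def elim!: eventually_mono)
  finally show "U_LF \<theta> \<le> rent u' y \<theta>" .
qed

text \<open>The direct method: a maximising sequence has bounded rents \<open>u\<close>, Helly's
  theorem gives a limit of the allocations, and dominated convergence carries rents and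
  \<open>J\<close> over. The delicate point is \<open>no_subsidy\<close>, which sees one value only
  and is not preserved by convergence almost everywhere; right continuity of the limit at
  \<open>lo\<close> rescues it.\<close>

lemma best_exists: "\<exists>u x. best u x"
proof -
  let ?feas = "\<lambda>u x. relaxed u x \<and> no_subsidy u x"
  let ?V = "{J u x | u x. ?feas u x}"
  \<comment> \<open>Participation of the lowest type bounds \<open>u\<close> below by
    \<open>U_LF lo\<close>, and \<open>no_subsidy\<close> bounds it above by
    \<open>lo * v A\<close>.\<close>
  define B where "B = \<bar>U_LF lo\<bar> + lo * v A"
  have u_bound: "\<bar>u\<bar> \<le> B" if "?feas u x" for u x
  proof -
    have x: "adm x" using that by (simp add: relaxed_def)
    have "lo * x lo \<le> lo * v A" using adm_bounds[OF x, of lo] lo_pos by simp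
    then have "u \<le> lo * v A" using that by (simp add: no_subsidy_def)
    moreover have "0 \<le> lo * v A" using lo_pos v0_nonneg v0_le_vA by simp
    ultimately show ?thesis using relaxed_ge[of u x] that by (auto simp: B_def)
  qed
  obtain K where K: "0 \<le> K" "\<And>s. \<bar>gap s\<bar> \<le> K" using gap_bdd_borel by (metis bdd_borel_bound)
  define R where "R = B + v A * (hi - lo)"
  have rent_bound: "\<bar>rent u x \<theta>\<bar> \<le> R" if "\<bar>u\<bar> \<le> B" "adm x" "\<theta> \<in> {lo..hi}" for u x \<theta>
  proof -
    have "0 * (\<theta> - lo) \<le> x lo * (\<theta> - lo)" "x \<theta> * (\<theta> - lo) \<le> v A * (hi - lo)"
      using adm_bounds[OF that(2)] that(3) v0_nonneg v0_le_vA by (auto intro!: mult_mono)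
    then show ?thesis
      using rent_lower[OF that(2), of lo \<theta> u] rent_upper[OF that(2), of lo \<theta> u] that
      by (auto simp: rent_lo[OF adm_bdd_borel] R_def)
  qed
  have J_le: "J u x \<le> (\<integral>\<theta>. \<alpha> * surplus x_LF \<theta> + K * R \<partial>M)" if "?feas u x" for u x
    unfolding J_def
  proof (rule mono_M)
    have x: "adm x" using that by (simp add: relaxed_def)
    show "bdd_borel (\<lambda>\<theta>. \<alpha> * surplus x \<theta> - gap \<theta> * rent u x \<theta>)" using x by (rule integrand_bdd_borel)
    show "bdd_borel (\<lambda>\<theta>. \<alpha> * surplus x_LF \<theta> + K * R)" by (intro bdd_borel_intros surplus_bdd_borel x_LF_adm)
    show "AE \<theta> in M. \<alpha> * surplus x \<theta> - gap \<theta> * rent u x \<theta> \<le> \<alpha> * surplus x_LF \<theta> + K * R"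
      using AE_M_interior
    proof eventually_elim
      case (elim \<theta>)
      have "\<bar>gap \<theta> * rent u x \<theta>\<bar> \<le> K * R"
        unfolding abs_mult using K rent_bound[OF u_bound[OF that] x, of \<theta>] elim by (intro mult_mono) auto
      moreover have "\<alpha> * surplus x \<theta> \<le> \<alpha> * surplus x_LF \<theta>" using surplus_le_LF[OF x] \<alpha>_pos by simp
      ultimately show ?case by linarith
    qed
  qed
  have bdd: "bdd_above ?V" by (rule bdd_aboveI) (use J_le in blast)
  have ne: "?V \<noteq> {}" using relaxed_LF no_subsidy_LF by blast
  define S where "S = Sup ?V"
  have le_S: "J u x \<le> S" if "?feas u x" for u x
    unfolding S_def by (rule cSup_upper[OF _ bdd]) (use that in blast)
  have "\<exists>u x. ?feas u x \<and> S - 1 / real (Suc n) < J u x" for n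
  proof -
    have "S - 1 / real (Suc n) < Sup ?V" by (simp add: S_def)
    from less_cSupE[OF this ne] show ?thesis by blast
  qed
  then obtain un xn where feas: "\<And>n. ?feas (un n) (xn n)" and close: "\<And>n. S - 1 / real (Suc n) < J (un n) (xn n)"
    by metis
  have xn: "adm (xn n)" for n using feas[of n] by (simp add: relaxed_def)
  \<comment> \<open>Passing to the right-continuous version changes neither rents nor
    \<open>J\<close> and can only raise \<open>x lo\<close>, so the sequence stays feasible.\<close>
  define yn where "yn n = right_lim (xn n)" for n
  have yn: "adm (yn n)" for n unfolding yn_def by (rule adm_right_lim[OF xn])
  have "\<exists>s. strict_mono (s::nat \<Rightarrow> nat) \<and> (\<exists>F. (\<forall>x. continuous (at_right x) F) \<and> mono F \<and> (\<forall>x. \<bar>F x\<bar> \<le> v A) \<and>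
      (\<forall>x. continuous (at x) F \<longrightarrow> (\<lambda>n. yn (s n) x) \<longlonglongrightarrow> F x))"
  proof (rule Helly_selection)
    show "continuous (at_right x) (yn n)" for n x unfolding yn_def by (rule right_lim_cont[OF xn])
    show "mono (yn n)" for n using yn by (simp add: adm_def)
    show "\<bar>yn n x\<bar> \<le> v A" for n x using adm_bounds[OF yn, of n x] by simp
  qed
  then obtain s H where s: "strict_mono (s::nat \<Rightarrow> nat)" and Hc: "\<And>\<theta>. continuous (at_right \<theta>) H" and Hm: "mono H"
    and lim: "\<And>\<theta>. isCont H \<theta> \<Longrightarrow> (\<lambda>n. yn (s n) \<theta>) \<longlonglongrightarrow> H \<theta>" by blast
  have "bounded (range (\<lambda>n. un (s n)))"
    using u_bound[OF feas] by (auto simp: bounded_iff)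
  then obtain u r where r: "strict_mono (r::nat \<Rightarrow> nat)" and u: "((\<lambda>n. un (s n)) \<circ> r) \<longlonglongrightarrow> u"
    using bounded_imp_convergent_subsequence by blast
  define U X where "U n = un (s (r n))" and "X n = yn (s (r n))" for n
  have X: "adm (X n)" for n by (simp add: X_def yn)
  have U: "U \<longlonglongrightarrow> u" using u by (simp add: U_def[abs_def] comp_def)
  have UB: "\<bar>U n\<bar> \<le> B" for n using u_bound[OF feas] by (simp add: U_def)
  have uB: "\<bar>u\<bar> \<le> B"
    using LIMSEQ_le_const2[OF tendsto_rabs[OF U]] UB by blast
  \<comment> \<open>Helly's theorem bounds only the absolute value of \<open>H\<close>. Truncation
    puts the limit into the range everywhere and does not affect limits at continuity
    points.\<close>
  define x where "x \<theta> = max (v 0) (min (v A) (H \<theta>))" for \<theta>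
  have x: "adm x"
    unfolding adm_def using Hm v0_le_vA by (auto simp: x_def mono_def min_def max_def) (meson order_trans)+
  have X_lim: "(\<lambda>n. X n \<theta>) \<longlonglongrightarrow> x \<theta>" if "isCont H \<theta>" for \<theta>
  proof -
    have "(\<lambda>n. yn (s (r n)) \<theta>) \<longlonglongrightarrow> H \<theta>"
      using LIMSEQ_subseq_LIMSEQ[OF lim[OF that] r] by (simp add: comp_def)
    then have "(\<lambda>n. max (v 0) (min (v A) (yn (s (r n)) \<theta>))) \<longlonglongrightarrow> x \<theta>"
      unfolding x_def by (intro tendsto_intros)
    moreover have "max (v 0) (min (v A) (yn m \<theta>)) = yn m \<theta>" for m using adm_bounds[OF yn, of m \<theta>] by auto
    ultimately show ?thesis by (simp add: X_def)
  qed
  have ctbl: "countable {a. \<not> isCont H a}" by (rule mono_ctble_discont[OF Hm])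
  have AE_lim: "AE \<theta> in L. (\<lambda>n. X n \<theta>) \<longlonglongrightarrow> x \<theta>"
    using AE_L_countable[OF ctbl] by eventually_elim (use X_lim in auto)
  have rent_lim: "(\<lambda>n. rent (U n) (X n) \<theta>) \<longlonglongrightarrow> rent u x \<theta>" for \<theta>
    unfolding rent_def
  proof (intro tendsto_add U integral_dominated_convergence[where w = "\<lambda>_. v A"])
    show "AE s in L. (\<lambda>n. indicator {..<\<theta>} s * X n s) \<longlonglongrightarrow> indicator {..<\<theta>} s * x s"
      using AE_lim by eventually_elim (intro tendsto_intros)
    show "AE s in L. norm (indicator {..<\<theta>} s * X n s) \<le> v A" for n
      using adm_bounds[OF X, of n] v0_nonneg v0_le_vA by (auto split: split_indicator)
  qed (auto intro!: meas_L int_L bdd_borel_intros adm_bdd_borel[OF x] adm_bdd_borel[OF X])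
  have w_lim: "(\<lambda>n. w (X n \<theta>)) \<longlonglongrightarrow> w (x \<theta>)" if "(\<lambda>n. X n \<theta>) \<longlonglongrightarrow> x \<theta>" for \<theta>
  proof -
    have "(\<lambda>n. wlip * \<bar>X n \<theta> - x \<theta>\<bar>) \<longlonglongrightarrow> wlip * \<bar>x \<theta> - x \<theta>\<bar>"
      using that by (intro tendsto_intros)
    then have "(\<lambda>n. w (X n \<theta>) - w (x \<theta>)) \<longlonglongrightarrow> 0"
      by (intro Lim_null_comparison[of "\<lambda>n. w (X n \<theta>) - w (x \<theta>)" "\<lambda>n. wlip * \<bar>X n \<theta> - x \<theta>\<bar>"])
         (simp_all only: real_norm_def w_abs_diff_le[OF adm_range[OF x] adm_range[OF X]] eventually_True abs_zero
            cancel_comm_monoid_add_class.diff_cancel mult_zero_right)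
    then show ?thesis by (simp add: LIM_zero_iff)
  qed
  have J_lim: "(\<lambda>n. J (U n) (X n)) \<longlonglongrightarrow> J u x"
    unfolding J_def
  proof (rule integral_dominated_convergence[where w = "\<lambda>_. \<alpha> * (hi * v A + c * A) + K * R"])
    show "AE \<theta> in M. (\<lambda>n. \<alpha> * surplus (X n) \<theta> - gap \<theta> * rent (U n) (X n) \<theta>)
        \<longlonglongrightarrow> \<alpha> * surplus x \<theta> - gap \<theta> * rent u x \<theta>"
      using AE_lim[unfolded AE_L_iff_M]
      by eventually_elim (unfold surplus_def, intro tendsto_intros w_lim rent_lim)
    show "AE \<theta> in M. norm (\<alpha> * surplus (X n) \<theta> - gap \<theta> * rent (U n) (X n) \<theta>) \<le> \<alpha> * (hi * v A + c * A) + K * R" for n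
      using AE_M_interior
    proof eventually_elim
      case (elim \<theta>)
      have 1: "\<bar>gap \<theta> * rent (U n) (X n) \<theta>\<bar> \<le> K * R"
        unfolding abs_mult using K rent_bound[OF UB X, of \<theta>] elim by (intro mult_mono) auto
      have "\<bar>clamp \<theta> * X n \<theta>\<bar> \<le> hi * v A" "\<bar>c * w (X n \<theta>)\<bar> \<le> c * A"
        using clamp_in[of \<theta>] adm_bounds[OF X, of n \<theta>] lo_pos lo_less_hi w_in[of "X n \<theta>"] c_pos
        by (auto simp: abs_mult intro!: mult_mono)
      then have "\<bar>surplus (X n) \<theta>\<bar> \<le> hi * v A + c * A"
        unfolding surplus_def by linarith
      then have "\<bar>\<alpha> * surplus (X n) \<theta>\<bar> \<le> \<alpha> * (hi * v A + c * A)"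
        unfolding abs_mult using \<alpha>_pos by simp
      then show ?case using 1 unfolding real_norm_def by linarith
    qed
  qed (intro meas_M int_M integrand_bdd_borel bdd_borel_const x X)+
  have J_eq: "J (U n) (X n) = J (un (s (r n))) (xn (s (r n)))" for n
    unfolding U_def X_def
    by (rule J_cong_AE[OF yn xn]) (simp add: yn_def right_lim_AE[OF xn])
  have "S \<le> J u x"
  proof (rule LIMSEQ_le[OF _ J_lim])
    have "(\<lambda>n. S - 1 / real (Suc n)) \<longlonglongrightarrow> S - 0"
      by (intro tendsto_diff tendsto_const LIMSEQ_Suc[of "\<lambda>n. 1 / real n"] lim_1_over_n)
    then show "(\<lambda>n. S - 1 / real (Suc n)) \<longlonglongrightarrow> S" by simp
    have "S - 1 / real (Suc n) \<le> J (U n) (X n)" for n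
    proof -
      have "n \<le> s (r n)" using seq_suble[OF r, of n] seq_suble[OF s, of "r n"] by simp
      then have "1 / real (Suc (s (r n))) \<le> 1 / real (Suc n)" by (intro divide_left_mono) auto
      then show ?thesis using close[of "s (r n)"] unfolding J_eq by linarith
    qed
    then show "\<exists>N. \<forall>n\<ge>N. S - 1 / real (Suc n) \<le> J (U n) (X n)" by blast
  qed
  moreover have "relaxed u x"
    unfolding relaxed_def
  proof (intro conjI ballI x)
    fix \<theta> assume \<theta>: "\<theta> \<in> {lo..hi}"
    have "U_LF \<theta> \<le> rent (U n) (X n) \<theta>" for n
    proof -
      have "relaxed (U n) (X n)"
        unfolding U_def X_def yn_def
        by (rule relaxed_cong_AE[of _ "xn (s (r n))"])
           (use feas right_lim_AE[OF xn] adm_right_lim[OF xn] in auto)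
      then show ?thesis using \<theta> by (simp add: relaxed_def)
    qed
    then show "U_LF \<theta> \<le> rent u x \<theta>" by (intro LIMSEQ_le_const[OF rent_lim]) auto
  qed
  moreover have "no_subsidy u x"
    unfolding no_subsidy_def
  proof -
    \<comment> \<open>At continuity points above \<open>lo\<close> the constraint survives the
      limit, since each allocation is at least its value at \<open>lo\<close>; afterwards
      \<open>\<theta>\<close> decreases to \<open>lo\<close>.\<close>
    have *: "u \<le> lo * x \<theta>" if "lo < \<theta>" for \<theta>
    proof -
      obtain \<theta>' where \<theta>': "lo < \<theta>'" "\<theta>' < \<theta>" "isCont H \<theta>'"
        using open_minus_countable[OF ctbl, of "{lo<..<\<theta>}"] \<open>lo < \<theta>\<close> by auto
      have "U n \<le> lo * X n \<theta>'" for n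
      proof -
        have "un m \<le> lo * xn m lo" "lo * xn m lo \<le> lo * yn m \<theta>'" for m
          using feas[of m] le_right_lim[OF xn, of m \<theta>'] adm_mono[OF xn, of lo \<theta>' m] \<theta>' lo_pos
          by (auto simp: no_subsidy_def yn_def)
        then show ?thesis unfolding U_def X_def by (meson order_trans)
      qed
      then have "u \<le> lo * x \<theta>'"
        by (intro LIMSEQ_le[OF U tendsto_mult_left[OF X_lim[OF \<theta>'(3)]]]) auto
      also have "\<dots> \<le> lo * x \<theta>" using adm_mono[OF x, of \<theta>' \<theta>] \<theta>' lo_pos by simp
      finally show ?thesis .
    qed
    have "(x \<longlongrightarrow> x lo) (at_right lo)"
      using Hc[of lo] unfolding x_def continuous_within by (intro tendsto_intros)
    then have "((\<lambda>\<theta>. lo * x \<theta>) \<longlongrightarrow> lo * x lo) (at_right lo)" by (intro tendsto_intros)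
    then show "u \<le> lo * x lo"
      by (rule tendsto_lowerbound) (auto intro!: eventually_at_rightI[of lo "lo + 1"] *)
  qed
  ultimately show ?thesis using le_S unfolding best_def by (meson order_trans)
qed

text \<open>All constraints are linear in \<open>(u, x)\<close>, so the midpoint of two optima is
  feasible, and it would be strictly better if the allocations differed on a set of positive
  measure.\<close>

lemma best_unique_AE:
  assumes "best u x" "best u' y" shows "AE \<theta> in L. x \<theta> = y \<theta>"
proof (rule J_mix_strict[of x y "1/2" u u'])
  show xy: "adm x" "adm y" using assms by (auto simp: best_def relaxed_def)
  have "relaxed ((1 - 1/2) * u + 1/2 * u') (mix (1/2) x y)"
    using assms by (intro relaxed_mix) (auto simp: best_def)
  moreover have "no_subsidy ((1 - 1/2) * u + 1/2 * u') (mix (1/2) x y)"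
    using assms by (simp add: best_def no_subsidy_def algebra_simps)
  ultimately have "J ((1 - 1/2) * u + 1/2 * u') (mix (1/2) x y) \<le> J u x"
    using assms(1) by (auto simp: best_def)
  moreover have "J u x = J u' y" using assms by (auto simp: best_def intro: antisym)
  ultimately show "J ((1 - 1/2) * u + 1/2 * u') (mix (1/2) x y) \<le> (1 - 1/2) * J u x + 1/2 * J u' y" by simp
qed auto

section \<open>From the encoded optimum to optimal mechanisms\<close>

lemma planner_reduce:
  assumes "planner_solution q t"
  shows "best (lo * v (q lo) - t lo) (\<lambda>\<theta>. v (q (clamp \<theta>)))"
  unfolding best_def
proof (intro conjI allI impI)
  have noLS: "feasible_noLS q t" and f: "feasible q t"
    using assms by (auto simp: planner_solution_def feasible_def)
  note r = reduce_mechanism[OF noLS]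
  show "relaxed (lo * v (q lo) - t lo) (\<lambda>\<theta>. v (q (clamp \<theta>)))" by (rule r)
  show "no_subsidy (lo * v (q lo) - t lo) (\<lambda>\<theta>. v (q (clamp \<theta>)))" by (rule r(3)[OF f])
  fix u' x' assume "relaxed u' x' \<and> no_subsidy u' x'"
  then have "relaxed u' x'" "no_subsidy u' x'" by auto
  note e = expand_mechanism[OF this(1)] and n = this(2)
  show "J u' x' \<le> J (lo * v (q lo) - t lo) (\<lambda>\<theta>. v (q (clamp \<theta>)))"
    using assms e(3)[OF n] unfolding planner_solution_def e(2)[symmetric] r(2)[symmetric] by blast
qed

lemma planner_expand:
  assumes "best u x"
  shows "planner_solution (\<lambda>\<theta>. w (x \<theta>)) (\<lambda>\<theta>. \<theta> * x \<theta> - rent u x \<theta>)"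
  unfolding planner_solution_def
proof (intro conjI allI impI)
  have r: "relaxed u x" and n: "no_subsidy u x" using assms by (auto simp: best_def)
  note e = expand_mechanism[OF r]
  show "feasible (\<lambda>\<theta>. w (x \<theta>)) (\<lambda>\<theta>. \<theta> * x \<theta> - rent u x \<theta>)" by (rule e(3)[OF n])
  fix q' t' assume f: "feasible q' t'"
  then have noLS: "feasible_noLS q' t'" by (simp add: feasible_def)
  note r' = reduce_mechanism[OF noLS]
  show "welfare q' t' \<le> welfare (\<lambda>\<theta>. w (x \<theta>)) (\<lambda>\<theta>. \<theta> * x \<theta> - rent u x \<theta>)"
    using assms r'(1) r'(3)[OF f] unfolding r'(2) e(2) best_def by blast
qed

text \<open>The case \<open>mean_weight = \<alpha>\<close> needs the smallest payments. There
  \<open>J\<close> does not depend on \<open>u\<close>, so the rent is raised to its limit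
  \<open>lo * right_lim x lo\<close>. Above \<open>lo\<close> the left limit is the smallest value
  that a version of the optimal allocation can take, and at \<open>lo\<close> the payment is
  0.\<close>

lemma optimal_mechanism_exists: "\<exists>q t. optimal_mechanism q t"
proof -
  obtain u x where b: "best u x" using best_exists by blast
  then have x: "adm x" by (simp add: best_def relaxed_def)
  show ?thesis
  proof (cases "mean_weight = \<alpha>")
    case False
    then show ?thesis using planner_expand[OF b] unfolding optimal_mechanism_def by blast
  next
    case True
    define y where "y = left_lim x"
    define k where "k = lo * right_lim x lo"
    have y: "adm y" unfolding y_def by (rule adm_left_lim[OF x])
    have ylo: "y lo = right_lim x lo" by (simp add: y_def left_lim_def[OF x])
    have AE: "AE s in L. y s = x s" unfolding y_def by (rule left_lim_AE[OF x])
    have "u \<le> lo * x lo" using b by (simp add: best_def no_subsidy_def)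
    also have "\<dots> \<le> k" using le_right_lim[OF x, of lo] lo_pos by (simp add: k_def)
    finally have uk: "u \<le> k" .
    have "J k y = J (u + (k - u)) y" by simp
    also have "\<dots> = J u y" using J_shift[OF y, of u "k - u"] True by simp
    also have "\<dots> = J u x" by (rule J_cong_AE[OF y x AE])
    finally have Jeq: "J k y = J u x" .
    have by': "best k y"
      using b relaxed_cong_AE[OF _ y AE uk] Jeq by (auto simp: best_def no_subsidy_def k_def ylo)
    have "\<theta> * y \<theta> - rent k y \<theta> \<le> t' \<theta>" if p: "planner_solution q' t'" and \<theta>: "\<theta> \<in> {lo..hi}" for q' t' \<theta>
    proof -
      define z where "z = (\<lambda>\<theta>. v (q' (clamp \<theta>)))"
      define k' where "k' = lo * v (q' lo) - t' lo"
      have bz: "best k' z" using planner_reduce[OF p] by (simp add: z_def k'_def)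
      have z: "adm z" using bz by (simp add: best_def relaxed_def)
      have noLS: "feasible_noLS q' t'" using p by (simp add: planner_solution_def feasible_def)
      have t': "\<theta> * z \<theta> - t' \<theta> = rent k' z \<theta>"
        using reduce_mechanism(4)[OF noLS \<theta>] \<theta> by (simp add: z_def k'_def clamp_id)
      have AEz: "AE s in L. z s = x s" by (rule best_unique_AE[OF bz b])
      \<comment> \<open>Every optimal allocation agrees with \<open>x\<close> almost everywhere, so
        its value at \<open>lo\<close> is at most the right limit. Through \<open>no_subsidy\<close>
        this caps its rent \<open>k'\<close> by \<open>k\<close>.\<close>
      have "z lo \<le> right_lim x lo"
      proof (rule right_lim_ge[OF x])
        fix s assume "lo < s"
        then obtain s' where "lo < s'" "s' < min s hi" "z s' = x s'"
          using AE_L_exists[OF AEz, of lo "min s hi"] lo_less_hi by auto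
        then show "z lo \<le> x s" using adm_mono[OF z, of lo s'] adm_mono[OF x, of s' s] by auto
      qed
      then have "lo * z lo \<le> k" using lo_pos by (simp add: k_def)
      then have kk: "k' \<le> k" using bz by (simp add: best_def no_subsidy_def)
      show ?thesis
      proof (cases "\<theta> = lo")
        case True
        have "0 \<le> t' lo" using p lo_less_hi by (auto simp: planner_solution_def feasible_def)
        then show ?thesis using True by (simp add: rent_lo adm_bdd_borel[OF y] ylo k_def)
      next
        case False
        have "y \<theta> \<le> z \<theta>"
          unfolding y_def
        proof (rule left_lim_le[OF x])
          show "lo < \<theta>" using False \<theta> by auto
          fix s assume "s < \<theta>"
          then obtain s' where "max s lo < s'" "s' < \<theta>" "z s' = x s'"
            using AE_L_exists[OF AEz, of "max s lo" \<theta>] \<theta> False by auto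
          then show "x s \<le> z \<theta>" using adm_mono[OF z, of s' \<theta>] adm_mono[OF x, of s s'] by auto
        qed
        moreover have "rent k' z \<theta> \<le> rent k y \<theta>"
          by (rule rent_le[OF adm_bdd_borel[OF z] adm_bdd_borel[OF y] kk])
             (use AE AEz in \<open>eventually_elim, simp\<close>)
        moreover have "\<theta> * y \<theta> \<le> \<theta> * z \<theta>" using \<theta> lo_pos \<open>y \<theta> \<le> z \<theta>\<close> by (intro mult_left_mono) auto
        ultimately show ?thesis using t' by linarith
      qed
    qed
    then show ?thesis using planner_expand[OF by'] unfolding optimal_mechanism_def by blast
  qed
qed

text \<open>If the lowest quality were not pooled, mixing the optimum with a better mechanism that
  pays lump sums, and lifting the allocation of the lowest types so as to undo the lump sum, would
  gain in first order but cost only in second order.\<close>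

lemma best_constant_near_lo:
  assumes b: "best u x" and r2: "relaxed u2 y" and better: "J u x < J u2 y"
  obtains \<theta>1 where "lo < \<theta>1" "\<theta>1 \<le> hi" "x \<theta>1 = right_lim x lo"
proof (rule ccontr)
  assume nt: "\<not> thesis"
  note witness = that
  have rx: "relaxed u x" and nsx: "no_subsidy u x" using b by (auto simp: best_def)
  have x: "adm x" and y: "adm y" using rx r2 by (auto simp: relaxed_def)
  define p where "p = right_lim x lo"
  have p_range: "v 0 \<le> p" "p \<le> v A" "0 \<le> p"
    using adm_bounds[OF adm_right_lim[OF x], of lo] by (auto simp: p_def)
  have p_le: "p \<le> x \<theta>" if "lo < \<theta>" for \<theta> using right_lim_le[OF x that] by (simp add: p_def)
  have strict: "p < x \<theta>" if "lo < \<theta>" "\<theta> \<le> hi" for \<theta>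
    using p_le[OF that(1)] nt witness[OF that] by (force simp: p_def)
  have xlo: "x lo \<le> p" using le_right_lim[OF x] by (simp add: p_def)
  obtain K where K: "0 \<le> K" "\<And>s. \<bar>gap s\<bar> \<le> K" using gap_bdd_borel by (metis bdd_borel_bound)
  \<comment> \<open>The first-order gain: mixing with weight \<open>\<epsilon>\<close> raises
    \<open>J\<close> by at least \<open>\<epsilon> * g\<close>.\<close>
  define g where "g = J u2 y - J u x"
  \<comment> \<open>Since \<open>u2 \<le> lo * N\<close>, a lift of \<open>\<epsilon> * N\<close> at
    the bottom offsets the rent \<open>\<epsilon> * u2\<close> brought in by mixing. The lift over
    the mixed allocation is at most \<open>\<epsilon> * D\<close>, as mixing may have lowered it by
    up to \<open>\<epsilon> * v A\<close>.\<close>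
  define N where "N = \<bar>u2\<bar> / lo"
  define D where "D = N + v A"
  have N: "0 \<le> N" "u2 \<le> lo * N" using lo_pos by (auto simp: N_def)
  have D: "0 \<le> D" "N \<le> D" using N v0_nonneg v0_le_vA by (auto simp: D_def)
  \<comment> \<open>A bound, per unit of \<open>\<epsilon>\<close>, on the loss from lifting the
    types below \<open>\<theta>\<close>: their extra production cost and the rents this passes on to
    higher types. It tends to 0 at \<open>lo\<close>, so lifting few enough types costs less than
    the gain \<open>g\<close>.\<close>
  define \<phi> where "\<phi> \<theta> = D * (\<alpha> * c * wlip * F \<theta> + K * (\<theta> - lo))" for \<theta>
  have "isCont \<phi> lo" unfolding \<phi>_def by (intro continuous_intros F_cont)
  then have "(\<phi> \<longlongrightarrow> 0) (at_right lo)"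
    by (simp add: isCont_def \<phi>_def F_lo) (rule tendsto_mono[rotated], assumption, rule at_le, simp)
  then have "\<forall>\<^sub>F \<theta> in at_right lo. \<phi> \<theta> < g"
    using better by (intro order_tendstoD) (auto simp: g_def)
  then obtain \<theta>' where \<theta>': "lo < \<theta>'" "\<And>\<theta>. lo < \<theta> \<Longrightarrow> \<theta> < \<theta>' \<Longrightarrow> \<phi> \<theta> < g"
    by (auto simp: eventually_at_right[OF less_add_one[of lo]])
  define \<theta>1 where "\<theta>1 = min hi ((lo + \<theta>') / 2)"
  have \<theta>1: "lo < \<theta>1" "\<theta>1 \<le> hi" "\<phi> \<theta>1 < g"
    using \<theta>' lo_less_hi by (auto simp: \<theta>1_def min_def intro!: \<theta>'(2))
  \<comment> \<open>Small enough that from \<open>\<theta>1\<close> on the mixed allocation is above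
    the lifted level anyway. It is positive because \<open>p < x \<theta>1\<close>, that is, because
    pooling was assumed to fail.\<close>
  define \<epsilon> where "\<epsilon> = min 1 ((x \<theta>1 - p) / (D + 1))"
  have \<epsilon>: "0 < \<epsilon>" "\<epsilon> \<le> 1" using strict[OF \<theta>1(1,2)] D by (auto simp: \<epsilon>_def)
  have \<epsilon>D: "p + \<epsilon> * D \<le> x \<theta>1"
  proof -
    have "\<epsilon> * D \<le> (x \<theta>1 - p) / (D + 1) * (D + 1)"
      using strict[OF \<theta>1(1,2)] D \<epsilon> by (intro mult_mono) (auto simp: \<epsilon>_def)
    then show ?thesis using D by simp
  qed
  define m where "m = mix \<epsilon> x y"
  define um where "um = (1 - \<epsilon>) * u + \<epsilon> * u2"
  \<comment> \<open>The floor for which \<open>lo * \<beta>\<close> covers the mixed rent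
    \<open>um\<close>, so that \<open>z\<close> satisfies \<open>no_subsidy\<close>.\<close>
  define \<beta> where "\<beta> = p + \<epsilon> * N"
  define z where "z \<theta> = max (m \<theta>) \<beta>" for \<theta>
  have rm: "relaxed um m" unfolding um_def m_def using relaxed_mix[OF rx r2] \<epsilon> by simp
  have m: "adm m" using rm by (simp add: relaxed_def)
  have \<beta>: "v 0 \<le> \<beta>" "\<beta> \<le> x \<theta>1"
  proof -
    have "0 \<le> \<epsilon> * N" "\<epsilon> * N \<le> \<epsilon> * D" using \<epsilon> N D by (auto intro: mult_left_mono)
    then show "v 0 \<le> \<beta>" "\<beta> \<le> x \<theta>1" using p_range \<epsilon>D by (auto simp: \<beta>_def)
  qed
  have z: "adm z"
    unfolding adm_def
  proof (intro conjI allI)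
    show "mono z" using adm_mono[OF m] by (auto simp: z_def mono_def max_def) (meson order_trans nle_le)
    show "z \<theta> \<in> {v 0..v A}" for \<theta>
      using adm_bounds[OF m, of \<theta>] \<beta> adm_bounds[OF x, of \<theta>1] by (auto simp: z_def)
  qed
  have m_ge: "x \<theta> - \<epsilon> * v A \<le> m \<theta>" for \<theta>
  proof -
    have "\<epsilon> * x \<theta> \<le> \<epsilon> * v A" "0 \<le> \<epsilon> * y \<theta>"
      using adm_bounds[OF x, of \<theta>] adm_bounds[OF y, of \<theta>] \<epsilon> by (auto intro: mult_left_mono)
    then show ?thesis by (simp add: m_def algebra_simps)
  qed
  have d_le: "z \<theta> - m \<theta> \<le> \<epsilon> * D * indicator {lo..<\<theta>1} \<theta>" if "lo < \<theta>" for \<theta>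
  proof (cases "\<theta> < \<theta>1")
    case True
    then show ?thesis using m_ge[of \<theta>] p_le[OF that] that D \<epsilon> N by (auto simp: z_def \<beta>_def D_def algebra_simps)
  next
    case False
    then have "x \<theta>1 \<le> x \<theta>" using adm_mono[OF x] by simp
    then have "\<beta> \<le> m \<theta>" using m_ge[of \<theta>] \<epsilon>D by (simp add: \<beta>_def D_def algebra_simps)
    then show ?thesis using False by (simp add: z_def)
  qed
  have rent_le': "rent um z \<theta> - rent um m \<theta> \<le> \<epsilon> * D * (\<theta>1 - lo)" for \<theta>
  proof -
    have "rent um z \<theta> - rent um m \<theta> = (\<integral>s. indicator {..<\<theta>} s * z s \<partial>L) - (\<integral>s. indicator {..<\<theta>} s * m s \<partial>L)"
      by (simp add: rent_def)
    also have "\<dots> = (\<integral>s. indicator {..<\<theta>} s * z s - indicator {..<\<theta>} s * m s \<partial>L)"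
      by (subst Bochner_Integration.integral_diff)
         (auto intro!: int_L bdd_borel_intros adm_bdd_borel[OF z] adm_bdd_borel[OF m])
    also have "\<dots> \<le> (\<integral>s. \<epsilon> * D * indicator {lo..<\<theta>1} s \<partial>L)"
    proof (rule mono_L)
      show "AE s in L. indicator {..<\<theta>} s * z s - indicator {..<\<theta>} s * m s \<le> \<epsilon> * D * indicator {lo..<\<theta>1} s"
        using AE_L_interior
      proof eventually_elim
        case (elim s)
        have "0 \<le> \<epsilon> * D * indicator {lo..<\<theta>1} s" using \<epsilon> D by simp
        then show ?case using d_le[of s] elim by (cases "s < \<theta>") auto
      qed
    qed (auto intro!: bdd_borel_intros adm_bdd_borel[OF z] adm_bdd_borel[OF m])
    also have "\<dots> = \<epsilon> * D * (\<theta>1 - lo)"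
      unfolding integral_mult_right_zero using integral_indicator_L[of lo \<theta>1] \<theta>1 by simp
    finally show ?thesis .
  qed
  have rent_ge': "rent um m \<theta> \<le> rent um z \<theta>" for \<theta>
    by (rule rent_le[OF adm_bdd_borel[OF m] adm_bdd_borel[OF z]]) (auto simp: z_def)
  have "J um m - \<epsilon> * \<phi> \<theta>1 \<le> J um z"
  proof -
    have "J um m - \<epsilon> * \<phi> \<theta>1
      = (\<integral>\<theta>. (1 * (\<alpha> * surplus m \<theta> - gap \<theta> * rent um m \<theta>) + (- (\<alpha> * c * wlip * \<epsilon> * D)) * indicator {lo<..\<theta>1} \<theta>)
           + (- (K * (\<epsilon> * D * (\<theta>1 - lo)))) * 1 \<partial>M)"
      using F_diff[of lo \<theta>1] \<theta>1 prob_space.prob_space[OF type_dist_prob]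
      by (subst integral_M_lincomb)
         (auto intro!: integrand_bdd_borel[OF m] bdd_borel_intros simp: J_def \<phi>_def F_lo space_M algebra_simps)
    also have "\<dots> \<le> (\<integral>\<theta>. \<alpha> * surplus z \<theta> - gap \<theta> * rent um z \<theta> \<partial>M)"
    proof (rule mono_M)
      show "AE \<theta> in M. 1 * (\<alpha> * surplus m \<theta> - gap \<theta> * rent um m \<theta>) + (- (\<alpha> * c * wlip * \<epsilon> * D)) * indicator {lo<..\<theta>1} \<theta>
           + (- (K * (\<epsilon> * D * (\<theta>1 - lo)))) * 1 \<le> \<alpha> * surplus z \<theta> - gap \<theta> * rent um z \<theta>"
        using AE_M_interior
      proof eventually_elim
        case (elim \<theta>)
        have "\<bar>gap \<theta> * (rent um z \<theta> - rent um m \<theta>)\<bar> \<le> K * (\<epsilon> * D * (\<theta>1 - lo))"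
          unfolding abs_mult using K(2)[of \<theta>] rent_le'[of \<theta>] rent_ge'[of \<theta>] K(1) by (intro mult_mono) auto
        then have 1: "gap \<theta> * rent um z \<theta> - gap \<theta> * rent um m \<theta> \<le> K * (\<epsilon> * D * (\<theta>1 - lo))"
          by (simp add: algebra_simps)
        have mz: "m \<theta> \<le> z \<theta>" by (simp add: z_def)
        have "w (z \<theta>) - w (m \<theta>) \<le> wlip * (z \<theta> - m \<theta>)"
          by (rule w_diff_le[OF adm_range[OF m] adm_range[OF z] mz])
        also have "\<dots> \<le> wlip * (\<epsilon> * D * indicator {lo<..\<theta>1} \<theta>)"
          using d_le[of \<theta>] elim wlip_pos \<epsilon> D by (intro mult_left_mono order_trans[OF d_le]) (auto split: split_indicator)
        finally have "c * (w (z \<theta>) - w (m \<theta>)) \<le> c * (wlip * (\<epsilon> * D * indicator {lo<..\<theta>1} \<theta>))"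
          using c_pos by simp
        moreover have "clamp \<theta> * m \<theta> \<le> clamp \<theta> * z \<theta>"
          using mz clamp_in[of \<theta>] lo_pos by (intro mult_left_mono) auto
        ultimately have "surplus m \<theta> - c * (wlip * (\<epsilon> * D * indicator {lo<..\<theta>1} \<theta>)) \<le> surplus z \<theta>"
          by (simp add: surplus_def algebra_simps)
        then have "\<alpha> * (surplus m \<theta> - c * (wlip * (\<epsilon> * D * indicator {lo<..\<theta>1} \<theta>))) \<le> \<alpha> * surplus z \<theta>"
          using \<alpha>_pos by simp
        then show ?case using 1 by (simp add: algebra_simps)
      qed
    qed (auto intro!: bdd_borel_intros surplus_bdd_borel[OF m] surplus_bdd_borel[OF z] gap_bdd_borel
        rent_bdd_borel[OF adm_bdd_borel[OF m]] rent_bdd_borel[OF adm_bdd_borel[OF z]])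
    finally show ?thesis by (simp add: J_def)
  qed
  moreover have "(1 - \<epsilon>) * J u x + \<epsilon> * J u2 y \<le> J um m"
    unfolding um_def m_def using \<epsilon> by (intro J_mix x y) auto
  moreover have "\<epsilon> * \<phi> \<theta>1 < \<epsilon> * g" using \<theta>1 \<epsilon> by simp
  ultimately have "J u x < J um z" by (simp add: g_def algebra_simps)
  moreover have "relaxed um z"
    using rm z rent_ge' unfolding relaxed_def by (meson order_trans)
  moreover have "no_subsidy um z"
  proof -
    have "lo * x lo \<le> lo * p" using xlo lo_pos by (intro mult_left_mono) auto
    then have "u \<le> lo * p" using nsx by (simp add: no_subsidy_def)
    then have "um \<le> (1 - \<epsilon>) * (lo * p) + \<epsilon> * (lo * N)"
      unfolding um_def using \<epsilon> N by (intro add_mono mult_left_mono) auto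
    also have "\<dots> \<le> lo * \<beta>" using p_range \<epsilon> lo_pos by (simp add: \<beta>_def algebra_simps)
    also have "\<dots> \<le> lo * z lo" using lo_pos by (simp add: z_def)
    finally show ?thesis by (simp add: no_subsidy_def)
  qed
  ultimately show False using b by (meson best_def not_less)
qed

text \<open>Once the bottom is pooled, payments there equal the constant \<open>h\<close>, the slack
  of the constraint. A positive slack would leave room for a small step towards the better
  mechanism, against optimality.\<close>

lemma best_free_public_option:
  assumes b: "best u x" and r2: "relaxed u2 y" and better: "J u x < J u2 y"
  obtains \<epsilon> p where "0 < \<epsilon>" "lo + \<epsilon> \<le> hi"
    "\<And>\<theta>. lo < \<theta> \<Longrightarrow> \<theta> < lo + \<epsilon> \<Longrightarrow> x \<theta> = p \<and> \<theta> * x \<theta> - rent u x \<theta> = 0"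
proof -
  obtain \<theta>1 where \<theta>1: "lo < \<theta>1" "\<theta>1 \<le> hi" "x \<theta>1 = right_lim x lo"
    using best_constant_near_lo[OF assms] .
  have rx: "relaxed u x" and nsx: "no_subsidy u x" using b by (auto simp: best_def)
  have x: "adm x" and y: "adm y" using rx r2 by (auto simp: relaxed_def)
  define p where "p = right_lim x lo"
  have p_range: "v 0 \<le> p" "p \<le> v A" "0 \<le> p"
    using adm_bounds[OF adm_right_lim[OF x], of lo] by (auto simp: p_def)
  have p_le: "p \<le> x \<theta>" if "lo < \<theta>" for \<theta> using right_lim_le[OF x that] by (simp add: p_def)
  have const: "x \<theta> = p" if "lo < \<theta>" "\<theta> \<le> \<theta>1" for \<theta>
    using p_le[OF that(1)] adm_mono[OF x that(2)] \<theta>1 by (simp add: p_def)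
  have rent: "rent u x \<theta> = u + p * (\<theta> - lo)" if "lo < \<theta>" "\<theta> \<le> \<theta>1" for \<theta>
  proof -
    have "rent u x \<theta> - rent u x lo = (\<integral>s. indicator {lo..<\<theta>} s * x s \<partial>L)"
      using that by (intro rent_diff adm_bdd_borel x) auto
    also have "\<dots> = (\<integral>s. p * indicator {lo..<\<theta>} s \<partial>L)"
      by (rule cong_L_interior)
         (use that in \<open>auto intro!: bdd_borel_intros adm_bdd_borel[OF x] const split: split_indicator\<close>)
    also have "\<dots> = p * (\<theta> - lo)"
      unfolding integral_mult_right_zero using integral_indicator_L[of lo \<theta>] that \<theta>1 by simp
    finally show ?thesis by (simp add: rent_lo adm_bdd_borel[OF x])
  qed
  define h where "h = lo * p - u"
  have h: "h = 0"
  proof (rule ccontr)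
    assume "h \<noteq> 0"
    have "lo * x lo \<le> lo * p" using le_right_lim[OF x, of lo] lo_pos by (simp add: p_def)
    then have "0 < h" using nsx \<open>h \<noteq> 0\<close> by (simp add: h_def no_subsidy_def)
    \<comment> \<open>Solves \<open>(1 - \<epsilon>) * h = \<epsilon> * \<bar>u2\<bar>\<close>: the
      slack that the mixture keeps pays for the rent \<open>u2\<close>.\<close>
    define \<epsilon> where "\<epsilon> = h / (h + \<bar>u2\<bar>)"
    have \<epsilon>: "0 < \<epsilon>" "\<epsilon> \<le> 1" using \<open>0 < h\<close> by (auto simp: \<epsilon>_def field_simps)
    \<comment> \<open>Raises \<open>x\<close> to its right limit at and below \<open>lo\<close>, a
      change on a null set. The whole slack \<open>h\<close> then becomes available in
      \<open>no_subsidy\<close>.\<close>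
    define z where "z \<theta> = max (x \<theta>) p" for \<theta>
    have z: "adm z"
      unfolding adm_def
    proof (intro conjI allI)
      show "mono z" using adm_mono[OF x] by (auto simp: z_def mono_def max_def) (meson order_trans nle_le)
      show "z \<theta> \<in> {v 0..v A}" for \<theta> using adm_bounds[OF x, of \<theta>] p_range by (auto simp: z_def)
    qed
    have AE: "AE s in L. z s = x s"
      using AE_L_interior by eventually_elim (use p_le in \<open>auto simp: z_def max_def intro: antisym\<close>)
    have rz: "relaxed u z" by (rule relaxed_cong_AE[OF rx z AE]) simp
    have "J u z = J u x" by (rule J_cong_AE[OF z x AE])
    then have "(1 - \<epsilon>) * J u x + \<epsilon> * J u2 y \<le> J ((1 - \<epsilon>) * u + \<epsilon> * u2) (mix \<epsilon> z y)"
      using J_mix[OF z y, of \<epsilon> u u2] \<epsilon> by simp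
    moreover have "\<epsilon> * J u x < \<epsilon> * J u2 y" using better \<epsilon> by simp
    ultimately have "J u x < J ((1 - \<epsilon>) * u + \<epsilon> * u2) (mix \<epsilon> z y)" by (simp add: algebra_simps)
    moreover have "relaxed ((1 - \<epsilon>) * u + \<epsilon> * u2) (mix \<epsilon> z y)" using relaxed_mix[OF rz r2] \<epsilon> by simp
    moreover have "no_subsidy ((1 - \<epsilon>) * u + \<epsilon> * u2) (mix \<epsilon> z y)"
    proof -
      have "\<epsilon> * u2 \<le> (1 - \<epsilon>) * h"
      proof -
        have "(1 - \<epsilon>) * h = \<epsilon> * \<bar>u2\<bar>" using \<open>0 < h\<close> by (simp add: \<epsilon>_def field_simps)
        then show ?thesis using \<epsilon> by (simp add: mult_left_mono)
      qed
      moreover have "(1 - \<epsilon>) * (lo * p) \<le> (1 - \<epsilon>) * (lo * z lo)"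
        using \<epsilon> lo_pos by (intro mult_left_mono) (auto simp: z_def)
      moreover have "0 \<le> \<epsilon> * (lo * y lo)" using \<epsilon> lo_pos adm_bounds[OF y, of lo] by simp
      ultimately show ?thesis unfolding no_subsidy_def h_def by (simp add: algebra_simps)
    qed
    ultimately show False using b by (meson best_def not_less)
  qed
  show thesis
  proof (rule that[of "\<theta>1 - lo" p])
    fix \<theta> assume "lo < \<theta>" "\<theta> < lo + (\<theta>1 - lo)"
    then show "x \<theta> = p \<and> \<theta> * x \<theta> - rent u x \<theta> = 0"
      using const[of \<theta>] rent[of \<theta>] h by (simp add: h_def algebra_simps)
  qed (use \<theta>1 in auto)
qed

text \<open>The constrained supremum is attained, so a gap between the suprema means that a single
  relaxed mechanism beats all constrained ones. Pooling and zero payments at the bottom then follow,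
  and the statement about shapes disappears from the criterion.\<close>

lemma free_public_option_iff:
  "free_public_option_optimal \<longleftrightarrow>
     (\<exists>u x. relaxed u x \<and> (\<forall>u' x'. relaxed u' x' \<and> no_subsidy u' x' \<longrightarrow> J u' x' < J u x))"
proof -
  obtain q t where opt: "optimal_mechanism q t" using optimal_mechanism_exists by blast
  then have ps: "planner_solution q t" by (simp add: optimal_mechanism_def)
  then have f: "feasible q t" and noLS: "feasible_noLS q t" by (auto simp: planner_solution_def feasible_def)
  define x where "x = (\<lambda>\<theta>. v (q (clamp \<theta>)))"
  define u where "u = lo * v (q lo) - t lo"
  have b: "best u x" using planner_reduce[OF ps] by (simp add: x_def u_def)
  note red = reduce_mechanism[OF noLS, folded x_def u_def]
  have sup: "(SUP (q, t)\<in>{(q, t). feasible q t}. ereal (welfare q t)) = ereal (J u x)"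
  proof (rule antisym)
    show "(SUP (q, t)\<in>{(q, t). feasible q t}. ereal (welfare q t)) \<le> ereal (J u x)"
      by (rule SUP_least) (use ps red(2) in \<open>auto simp: planner_solution_def\<close>)
    show "ereal (J u x) \<le> (SUP (q, t)\<in>{(q, t). feasible q t}. ereal (welfare q t))"
      using red(2) f by (intro SUP_upper2[of "(q, t)"]) auto
  qed
  have gap: "(SUP (q, t)\<in>{(q, t). feasible q t}. ereal (welfare q t))
       < (SUP (q, t)\<in>{(q, t). feasible_noLS q t}. ereal (welfare q t)) \<longleftrightarrow> (\<exists>u' x'. relaxed u' x' \<and> J u x < J u' x')"
    unfolding sup less_SUP_iff
    using reduce_mechanism(1,2) expand_mechanism(1,2) by fastforce
  have gap': "(\<exists>u' x'. relaxed u' x' \<and> J u x < J u' x') \<longleftrightarrow>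
     (\<exists>u x. relaxed u x \<and> (\<forall>u' x'. relaxed u' x' \<and> no_subsidy u' x' \<longrightarrow> J u' x' < J u x))"
    using b unfolding best_def by (meson le_less_trans)
  have "\<exists>\<epsilon>>0. lo + \<epsilon> \<le> hi \<and> (\<exists>q\<^sub>0. \<forall>\<theta>\<in>{lo<..<lo + \<epsilon>}. q \<theta> = q\<^sub>0 \<and> t \<theta> = 0)"
    if "\<exists>u' x'. relaxed u' x' \<and> J u x < J u' x'"
  proof -
    from that obtain u2 y where "relaxed u2 y" "J u x < J u2 y" by blast
    from best_free_public_option[OF b this] obtain \<epsilon> p where \<epsilon>: "0 < \<epsilon>" "lo + \<epsilon> \<le> hi"
      and *: "\<And>\<theta>. lo < \<theta> \<Longrightarrow> \<theta> < lo + \<epsilon> \<Longrightarrow> x \<theta> = p \<and> \<theta> * x \<theta> - rent u x \<theta> = 0" by blast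
    have "q \<theta> = w p \<and> t \<theta> = 0" if "\<theta> \<in> {lo<..<lo + \<epsilon>}" for \<theta>
    proof -
      have \<theta>: "\<theta> \<in> {lo..hi}" using that \<epsilon> by auto
      then have q: "q \<theta> \<in> {0..A}" and vq: "v (q \<theta>) = x \<theta>"
        using noLS by (auto simp: feasible_noLS_def x_def clamp_id)
      have "x \<theta> = p" "\<theta> * x \<theta> - rent u x \<theta> = 0" using * that by auto
      then show ?thesis using red(4)[OF \<theta>] w_v[OF q] vq by auto
    qed
    then show ?thesis using \<epsilon> by blast
  qed
  then show ?thesis
    unfolding free_public_option_optimal_def gap gap'[symmetric] using opt by blast
qed

section \<open>Increasing weights\<close>

lemma not_free_public_option:
  assumes "\<And>u x. relaxed u x \<Longrightarrow> \<exists>u' x'. relaxed u' x' \<and> no_subsidy u' x' \<and> J u x \<le> J u' x'"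
  shows "\<not> free_public_option_optimal"
  unfolding free_public_option_iff using assms by (meson not_less)

lemma free_public_option_if_mean_weight_gt:
  assumes "\<alpha> < mean_weight" shows free_public_option_optimal
proof -
  obtain u x where b: "best u x" using best_exists by blast
  \<comment> \<open>A lump sum large enough to lift laissez-faire above the constrained optimum by
    at least 1.\<close>
  define k where "k = max 0 ((J u x - J (U_LF lo) x_LF + 1) / (mean_weight - \<alpha>))"
  have k: "0 \<le> k" "J u x - J (U_LF lo) x_LF + 1 \<le> k * (mean_weight - \<alpha>)"
    using assms by (auto simp: k_def max_def field_simps)
  have r: "relaxed (U_LF lo + k) x_LF"
    by (rule relaxed_cong_AE[OF relaxed_LF x_LF_adm]) (use k in auto)
  have "J u x < J (U_LF lo + k) x_LF"
    unfolding J_shift[OF x_LF_adm] using k by (simp add: algebra_simps)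
  then show ?thesis
    unfolding free_public_option_iff using r b unfolding best_def by (meson le_less_trans)
qed

lemma G_mono_on:
  assumes "lo \<le> a" "a \<le> b" "b \<le> hi" "\<And>s. a < s \<Longrightarrow> s < b \<Longrightarrow> 0 \<le> gap s" shows "G a \<le> G b"
proof -
  have "(\<integral>s. 0 \<partial>M) \<le> (\<integral>s. indicator {a<..b} s * gap s \<partial>M)"
  proof (rule mono_M)
    show "AE s in M. 0 \<le> indicator {a<..b} s * gap s"
      using AE_M_countable[of "{b}"] by (rule eventually_mono) (use assms(4) in \<open>auto split: split_indicator\<close>)
  qed (auto intro!: bdd_borel_intros gap_bdd_borel)
  then show ?thesis using G_diff[OF assms(2)] by simp
qed

lemma G_antimono_on:
  assumes "lo \<le> a" "a \<le> b" "b \<le> hi" "\<And>s. a < s \<Longrightarrow> s < b \<Longrightarrow> gap s \<le> 0" shows "G b \<le> G a"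
proof -
  have "(\<integral>s. indicator {a<..b} s * gap s \<partial>M) \<le> (\<integral>s. 0 \<partial>M)"
  proof (rule mono_M)
    show "AE s in M. indicator {a<..b} s * gap s \<le> 0"
      using AE_M_countable[of "{b}"] by (rule eventually_mono) (use assms(4) in \<open>auto split: split_indicator\<close>)
  qed (auto intro!: bdd_borel_intros gap_bdd_borel)
  then show ?thesis using G_diff[OF assms(2)] by simp
qed

text \<open>Strictness comes from the positive density: equality would make the integrand vanish
  almost everywhere for Lebesgue measure too, hence somewhere inside the interval.\<close>

lemma G_strict_antimono_on:
  assumes "lo \<le> a" "a < b" "b \<le> hi" "\<And>s. a < s \<Longrightarrow> s < b \<Longrightarrow> gap s < 0" shows "G b < G a"
proof (rule ccontr)
  assume "\<not> ?thesis"
  then have eq: "G b = G a" using G_antimono_on[of a b] assms by (force intro: antisym)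
  let ?h = "\<lambda>s. - (indicator {a<..<b} s * gap s)"
  have bb: "bdd_borel (\<lambda>s. indicator {a<..<b} s * gap s)" by (intro bdd_borel_intros gap_bdd_borel) auto
  have "(\<integral>s. indicator {a<..<b} s * gap s \<partial>M) = (\<integral>s. indicator {a<..b} s * gap s \<partial>M)"
  proof (rule cong_M[OF bb])
    show "AE s in M. indicator {a<..<b} s * gap s = indicator {a<..b} s * gap s"
      using AE_M_countable[of "{b}"] by (rule eventually_mono) (auto split: split_indicator)
  qed (auto intro!: bdd_borel_intros gap_bdd_borel)
  then have "(\<integral>s. ?h s \<partial>M) = 0" using G_diff[of a b] assms eq by simp
  moreover have "integrable M ?h" using int_M[OF bb] by simp
  ultimately have "AE s in M. ?h s = 0"
    using integral_nonneg_eq_0_iff_AE[of M ?h] assms(4) by (force split: split_indicator intro: less_imp_le)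
  then have "AE s in L. ?h s = 0" by (simp add: AE_L_iff_M)
  from AE_L_exists[OF this assms(1-3)] obtain s where "a < s" "s < b" "?h s = 0" .
  then show False using assms(4)[of s] by simp
qed

lemma integral_M_split:
  assumes "bdd_borel h" "lo \<le> a" "a \<le> hi"
  shows "(\<integral>\<theta>. h \<theta> \<partial>M) = (\<integral>\<theta>. indicator {lo<..a} \<theta> * h \<theta> \<partial>M) + (\<integral>\<theta>. indicator {a<..hi} \<theta> * h \<theta> \<partial>M)"
proof -
  have "(\<integral>\<theta>. h \<theta> \<partial>M) = (\<integral>\<theta>. indicator {lo<..a} \<theta> * h \<theta> + indicator {a<..hi} \<theta> * h \<theta> \<partial>M)"
    by (rule cong_M_interior) (use assms in \<open>auto intro!: bdd_borel_intros split: split_indicator\<close>)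
  also have "\<dots> = (\<integral>\<theta>. indicator {lo<..a} \<theta> * h \<theta> \<partial>M) + (\<integral>\<theta>. indicator {a<..hi} \<theta> * h \<theta> \<partial>M)"
    by (rule Bochner_Integration.integral_add) (auto intro!: int_M bdd_borel_intros assms)
  finally show ?thesis .
qed

lemma gap_eq: "\<theta> \<in> {lo..hi} \<Longrightarrow> gap \<theta> = \<alpha> - \<omega> \<theta>"
  by (simp add: gap_def clamp_id)

text \<open>For increasing weights the individual rationality constraint binds on \<open>{lo..\<theta>c}\<close> at the
  relaxed optimum, and the allocation is distorted upwards above \<open>\<theta>c\<close>.\<close>

lemma increasing_cutoff:
  assumes inc: "strict_mono_on {lo..hi} \<omega>" and le: "mean_weight \<le> \<alpha>"
  obtains \<theta>c where "\<theta>c \<in> {lo..hi}" "\<And>\<theta>. lo \<le> \<theta> \<Longrightarrow> \<theta> \<le> \<theta>c \<Longrightarrow> 0 \<le> gap \<theta>"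
    "G \<theta>c = G hi" "\<And>\<theta>. \<theta>c \<le> \<theta> \<Longrightarrow> \<theta> \<le> hi \<Longrightarrow> G hi \<le> G \<theta>"
proof -
  have gap_less: "gap b < gap a" if "lo \<le> a" "a < b" "b \<le> hi" for a b
    using strict_mono_onD[OF inc, of a b] that by (simp add: gap_eq)
  have Ghi: "0 \<le> G hi" using le by (simp add: G_hi)
  show thesis
  proof (cases "0 \<le> gap hi")
    case True
    show thesis
    proof (rule that[of hi])
      show "0 \<le> gap \<theta>" if "lo \<le> \<theta>" "\<theta> \<le> hi" for \<theta>
        using gap_less[of \<theta> hi] True that by (cases "\<theta> = hi") auto
      show "G hi \<le> G \<theta>" if "hi \<le> \<theta>" "\<theta> \<le> hi" for \<theta> using that by simp
    qed (use lo_less_hi in auto)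
  next
    case False
    \<comment> \<open>Otherwise \<open>gap\<close> is negative on the interior and
      \<open>G hi < 0\<close>, against \<open>mean_weight \<le> \<alpha>\<close>.\<close>
    have "0 < gap lo"
    proof (rule ccontr)
      assume *: "\<not> 0 < gap lo"
      have "G hi < G lo"
      proof (rule G_strict_antimono_on)
        show "gap s < 0" if "lo < s" "s < hi" for s using gap_less[of lo s] that * by simp
      qed (use lo_less_hi in auto)
      then show False using Ghi by (simp add: G_lo)
    qed
    then obtain \<theta>p where p: "lo \<le> \<theta>p" "\<theta>p \<le> hi" "gap \<theta>p = 0"
      using IVT2'[of gap hi 0 lo] False lo_less_hi continuous_on_subset[OF gap_cont subset_UNIV] by auto
    have pos: "0 \<le> gap \<theta>" if "lo \<le> \<theta>" "\<theta> \<le> \<theta>p" for \<theta>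
      using gap_less[of \<theta> \<theta>p] p that by (cases "\<theta> = \<theta>p") auto
    have neg: "gap \<theta> \<le> 0" if "\<theta>p \<le> \<theta>" "\<theta> \<le> hi" for \<theta>
      using gap_less[of \<theta>p \<theta>] p that by (cases "\<theta> = \<theta>p") auto
    have G_right: "G hi \<le> G \<theta>" if "\<theta>p \<le> \<theta>" "\<theta> \<le> hi" for \<theta>
      by (rule G_antimono_on) (use that p neg in auto)
    \<comment> \<open>\<open>G\<close> rises from 0 at \<open>lo\<close> to its value at the sign
      change \<open>\<theta>p\<close>, which is at least \<open>G hi\<close>, so it takes the value
      \<open>G hi\<close> in between.\<close>
    obtain \<theta>c where cc: "lo \<le> \<theta>c" "\<theta>c \<le> \<theta>p" "G \<theta>c = G hi"
      using IVT'[of G lo "G hi" \<theta>p] Ghi G_right[of \<theta>p] p continuous_at_imp_continuous_on[of "{lo..\<theta>p}" G] G_cont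
      by (auto simp: G_lo)
    show thesis
    proof (rule that[of \<theta>c])
      show "G hi \<le> G \<theta>" if "\<theta>c \<le> \<theta>" "\<theta> \<le> hi" for \<theta>
      proof (cases "\<theta> \<le> \<theta>p")
        case True
        have "G \<theta>c \<le> G \<theta>" by (rule G_mono_on) (use that True p cc pos in auto)
        then show ?thesis using cc by simp
      next
        case False
        then show ?thesis using G_right that by auto
      qed
    qed (use cc p pos in auto)
  qed
qed

text \<open>The replacement is laissez-faire up to \<open>\<theta>c\<close> and the larger of
  \<open>x\<close> and laissez-faire above. Up to \<open>\<theta>c\<close> rents are costly and drop
  to their floor. Above, \<open>G hi = G \<theta>c\<close> removes the rent of
  \<open>\<theta>c\<close> from the integration by parts and leaves
  \<open>x s * (G hi - G s)\<close> with a nonpositive factor, so a larger allocation is cheaper.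
  Surplus can only rise, since \<open>x\<close> moves to laissez-faire or stays.\<close>

lemma not_free_public_option_if_increasing:
  assumes inc: "strict_mono_on {lo..hi} \<omega>" and le: "mean_weight \<le> \<alpha>"
  shows "\<not> free_public_option_optimal"
proof (rule not_free_public_option)
  fix u x assume r: "relaxed u x"
  then have x: "adm x" by (simp add: relaxed_def)
  obtain \<theta>c where cc: "\<theta>c \<in> {lo..hi}" and gap_pos: "\<And>\<theta>. lo \<le> \<theta> \<Longrightarrow> \<theta> \<le> \<theta>c \<Longrightarrow> 0 \<le> gap \<theta>"
    and Gc: "G \<theta>c = G hi" and G_ge: "\<And>\<theta>. \<theta>c \<le> \<theta> \<Longrightarrow> \<theta> \<le> hi \<Longrightarrow> G hi \<le> G \<theta>"
    using increasing_cutoff[OF assms] by blast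
  define y where "y \<theta> = (if \<theta> \<le> \<theta>c then x_LF \<theta> else max (x \<theta>) (x_LF \<theta>))" for \<theta>
  have LF_le: "x_LF \<theta> \<le> y \<theta>" for \<theta> by (simp add: y_def)
  have y: "adm y"
    unfolding adm_def
  proof (intro conjI allI)
    show "mono y"
    proof
      fix a b :: real assume "a \<le> b"
      then show "y a \<le> y b"
        using adm_mono[OF x, of a b] adm_mono[OF x_LF_adm, of a b] by (auto simp: y_def)
    qed
    show "y \<theta> \<in> {v 0..v A}" for \<theta>
      using adm_range[OF x, of \<theta>] adm_range[OF x_LF_adm, of \<theta>] by (auto simp: y_def max_def)
  qed
  have LF: "U_LF \<theta> \<le> rent (U_LF lo) y \<theta>" if "\<theta> \<in> {lo..hi}" for \<theta>
    unfolding U_LF_rent[OF that]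
    by (rule rent_le[OF adm_bdd_borel[OF x_LF_adm] adm_bdd_borel[OF y]]) (auto simp: LF_le)
  have "relaxed (U_LF lo) y" using y LF by (simp add: relaxed_def)
  moreover have "no_subsidy (U_LF lo) y"
    using no_subsidy_LF cc by (simp add: no_subsidy_def y_def)
  moreover have "J u x \<le> J (U_LF lo) y"
  proof -
    have S: "(\<integral>\<theta>. surplus x \<theta> \<partial>M) \<le> (\<integral>\<theta>. surplus y \<theta> \<partial>M)"
    proof (rule integral_mono)
      show "surplus x \<theta> \<le> surplus y \<theta>" for \<theta>
        using surplus_le_LF[OF x, of \<theta>] by (auto simp: y_def surplus_def max_def)
    qed (intro int_M surplus_bdd_borel x y)+
    note b = bdd_borel_intros gap_bdd_borel rent_bdd_borel[OF adm_bdd_borel[OF x]]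
      rent_bdd_borel[OF adm_bdd_borel[OF y]] adm_bdd_borel[OF x] adm_bdd_borel[OF y] G_bdd_borel
    have 1: "(\<integral>\<theta>. indicator {lo<..\<theta>c} \<theta> * (gap \<theta> * rent (U_LF lo) y \<theta>) \<partial>M)
        \<le> (\<integral>\<theta>. indicator {lo<..\<theta>c} \<theta> * (gap \<theta> * rent u x \<theta>) \<partial>M)"
    proof (rule integral_mono)
      fix \<theta>
      have "gap \<theta> * rent (U_LF lo) y \<theta> \<le> gap \<theta> * rent u x \<theta>" if "lo < \<theta>" "\<theta> \<le> \<theta>c"
      proof -
        have "rent (U_LF lo) y \<theta> = rent (U_LF lo) x_LF \<theta>"
          by (rule rent_cong_AE[OF adm_bdd_borel[OF y] adm_bdd_borel[OF x_LF_adm]]) (use that in \<open>simp add: y_def\<close>)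
        also have "\<dots> = U_LF \<theta>" using that cc by (intro U_LF_rent[symmetric]) auto
        also have "\<dots> \<le> rent u x \<theta>" using r that cc by (auto simp: relaxed_def)
        finally show ?thesis using gap_pos[of \<theta>] that by (intro mult_left_mono) auto
      qed
      then show "indicator {lo<..\<theta>c} \<theta> * (gap \<theta> * rent (U_LF lo) y \<theta>) \<le> indicator {lo<..\<theta>c} \<theta> * (gap \<theta> * rent u x \<theta>)"
        by (auto split: split_indicator)
    qed (auto intro!: int_M b)
    have 2: "(\<integral>s. indicator {\<theta>c..<hi} s * (y s * (G hi - G s)) \<partial>L) \<le> (\<integral>s. indicator {\<theta>c..<hi} s * (x s * (G hi - G s)) \<partial>L)"
    proof (rule mono_L)
      show "AE s in L. indicator {\<theta>c..<hi} s * (y s * (G hi - G s)) \<le> indicator {\<theta>c..<hi} s * (x s * (G hi - G s))"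
        using AE_L_countable[of "{\<theta>c}"]
        by (rule eventually_mono)
           (use G_ge in \<open>auto simp: y_def intro!: mult_right_mono_neg split: split_indicator\<close>)
    qed (auto intro!: b)
    have "(\<integral>\<theta>. gap \<theta> * rent (U_LF lo) y \<theta> \<partial>M) \<le> (\<integral>\<theta>. gap \<theta> * rent u x \<theta> \<partial>M)"
      using 1 2 cc integral_gap_rent[OF x, of \<theta>c hi u] integral_gap_rent[OF y, of \<theta>c hi "U_LF lo"]
      by (subst (1 2) integral_M_split[of _ \<theta>c]) (auto intro!: b simp: Gc)
    then show ?thesis unfolding J_eq[OF x] J_eq[OF y] using S \<alpha>_pos by (intro diff_mono mult_left_mono) auto
  qed
  ultimately show "\<exists>u' x'. relaxed u' x' \<and> no_subsidy u' x' \<and> J u x \<le> J u' x'" by blast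
qed

section \<open>The cutoff for decreasing weights\<close>

lemma \<theta>H0_props:
  shows "\<theta>H0 \<in> {lo..hi}" "G \<theta>H0 \<le> 0" "\<And>\<theta>. \<theta> \<in> {lo..hi} \<Longrightarrow> G \<theta> \<le> 0 \<Longrightarrow> \<theta> \<le> \<theta>H0"
proof -
  let ?S = "{\<theta> \<in> {lo..hi}. G \<theta> \<le> 0}"
  \<comment> \<open>Compactness of this set, which contains \<open>lo\<close>, gives the
    \<open>GREATEST\<close> in the definition a meaning.\<close>
  have "closed ?S"
    using continuous_closed_preimage[of "{lo..hi}" G "{..0}"] G_cont
    by (simp add: continuous_at_imp_continuous_on vimage_def Int_def)
  moreover have "bounded ?S" by (rule bounded_subset[of "{lo..hi}"]) auto
  ultimately have "compact ?S" by (simp add: compact_eq_bounded_closed)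
  moreover have "lo \<in> ?S" using G_lo lo_less_hi by simp
  then have "?S \<noteq> {}" by blast
  ultimately obtain m where m: "m \<in> ?S" "\<And>\<theta>. \<theta> \<in> ?S \<Longrightarrow> \<theta> \<le> m"
    using compact_attains_sup[of ?S] by blast
  have "\<theta>H0 = m"
    unfolding \<theta>H0_def by (rule Greatest_equality) (use m in \<open>auto simp: cum_gap_eq\<close>)
  then show "\<theta>H0 \<in> {lo..hi}" "G \<theta>H0 \<le> 0" "\<And>\<theta>. \<theta> \<in> {lo..hi} \<Longrightarrow> G \<theta> \<le> 0 \<Longrightarrow> \<theta> \<le> \<theta>H0"
    using m by auto
qed

text \<open>With \<open>\<omega>\<close> decreasing, \<open>gap\<close> increases, so
  \<open>G\<close> starts at 0, falls and then rises. As \<open>0 \<le> G hi\<close>, the last point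
  where \<open>G\<close> is nonpositive is a zero, lying past the point where \<open>gap\<close>
  turns nonnegative.\<close>

lemma decreasing_cutoff:
  assumes dec: "strict_antimono_on {lo..hi} \<omega>" and le: "mean_weight \<le> \<alpha>"
  shows "G \<theta>H0 = 0" "\<And>\<theta>. lo \<le> \<theta> \<Longrightarrow> \<theta> \<le> \<theta>H0 \<Longrightarrow> G \<theta> \<le> 0"
    "\<And>\<theta>. \<theta>H0 \<le> \<theta> \<Longrightarrow> \<theta> \<le> hi \<Longrightarrow> 0 \<le> gap \<theta>"
proof -
  note H = \<theta>H0_props
  have gap_less: "gap a < gap b" if "lo \<le> a" "a < b" "b \<le> hi" for a b
    using monotone_onD[OF dec, of a b] that by (simp add: gap_eq)
  have Ghi: "0 \<le> G hi" using le by (simp add: G_hi)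
  have cont_right: "(G \<longlongrightarrow> G \<theta>) (at_right \<theta>)" "(gap \<longlongrightarrow> gap \<theta>) (at_right \<theta>)" for \<theta>
    using G_cont[of \<theta>] gap_cont by (auto simp: isCont_def continuous_on_def intro: tendsto_within_subset)
  show GH: "G \<theta>H0 = 0"
  proof (cases "\<theta>H0 = hi")
    case True
    then show ?thesis using H(2) Ghi by simp
  next
    case False
    then have "\<theta>H0 < hi" using H(1) by auto
    have "0 \<le> G \<theta>H0"
    proof (rule tendsto_lowerbound[OF cont_right(1)])
      show "\<forall>\<^sub>F \<theta> in at_right \<theta>H0. 0 \<le> G \<theta>"
      proof (rule eventually_at_rightI[of \<theta>H0 hi])
        show "0 \<le> G \<theta>" if "\<theta> \<in> {\<theta>H0<..<hi}" for \<theta>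
          using H(1) H(3)[of \<theta>] that by (cases "G \<theta> \<le> 0") auto
      qed fact
    qed simp
    then show ?thesis using H(2) by simp
  qed
  show gap_pos: "0 \<le> gap \<theta>" if \<theta>: "\<theta>H0 \<le> \<theta>" "\<theta> \<le> hi" for \<theta>
  proof (rule ccontr)
    assume neg: "\<not> 0 \<le> gap \<theta>"
    have G_neg: "G s < 0" if "lo < s" "s \<le> hi" "\<And>s'. s' < s \<Longrightarrow> lo < s' \<Longrightarrow> gap s' < 0" for s
      using G_strict_antimono_on[of lo s] that by (simp add: G_lo)
    show False
    proof (cases "\<theta> = hi")
      case True
      have "G hi < 0"
      proof (rule G_neg)
        show "gap s' < 0" if "s' < hi" "lo < s'" for s' using gap_less[of s' hi] that neg True by simp
      qed (use lo_less_hi in auto)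
      then show False using Ghi by simp
    next
      case False
      \<comment> \<open>By continuity \<open>gap\<close> stays negative slightly to the right of
        \<open>\<theta>\<close>, so \<open>G\<close> would be negative strictly beyond
        \<open>\<theta>H0\<close>; this also covers \<open>\<theta> = \<theta>H0\<close>.\<close>
      then have "\<forall>\<^sub>F s in at_right \<theta>. gap s < 0"
        using neg cont_right(2)[of \<theta>] by (intro order_tendstoD) auto
      then obtain b where b: "\<theta> < b" "\<And>s. \<theta> < s \<Longrightarrow> s < b \<Longrightarrow> gap s < 0"
        by (auto simp: eventually_at_right[OF less_add_one])
      define s where "s = min hi ((\<theta> + b) / 2)"
      have s: "\<theta> < s" "s < b" "s \<le> hi" using b(1) False \<theta> by (auto simp: s_def min_less_iff_disj)
      have "G s < 0"
      proof (rule G_neg)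
        show "gap s' < 0" if "s' < s" "lo < s'" for s'
          using gap_less[of s' s] b(2)[of s] s that by simp
      qed (use s \<theta> H(1) in auto)
      then show False using H(3)[of s] s \<theta> H(1) by auto
    qed
  qed
  show "G \<theta> \<le> 0" if \<theta>: "lo \<le> \<theta>" "\<theta> \<le> \<theta>H0" for \<theta>
  proof (cases "gap \<theta> \<le> 0")
    case True
    have "G \<theta> \<le> G lo"
    proof (rule G_antimono_on)
      show "gap s \<le> 0" if "lo < s" "s < \<theta>" for s using gap_less[of s \<theta>] that \<theta> H(1) True by auto
    qed (use \<theta> H(1) in auto)
    then show ?thesis by (simp add: G_lo)
  next
    case False
    have "G \<theta> \<le> G \<theta>H0"
    proof (rule G_mono_on)
      show "0 \<le> gap s" if "\<theta> < s" "s < \<theta>H0" for s using gap_less[of \<theta> s] that \<theta> H(1) False by auto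
    qed (use \<theta> H(1) in auto)
    then show ?thesis by (simp add: GH)
  qed
qed

section \<open>Ironing\<close>

text \<open>The tail integral of \<open>H0\<close> in type coordinates. Against \<open>F\<close>,
  the second term of \<open>H0\<close> turns into a Lebesgue integral of
  \<open>G / \<alpha>\<close>, so both integrands are bounded although \<open>H0\<close> need not
  be.\<close>

definition P :: "real \<Rightarrow> real" where
  "P \<theta> = (\<integral>s. indicator {\<theta><..} s * clamp s \<partial>M) + (\<integral>s. indicator {\<theta><..} s * G s \<partial>L) / \<alpha>"

lemma P_diff:
  assumes "a \<le> b"
  shows "P a - P b = (\<integral>s. indicator {a<..b} s * clamp s \<partial>M) + (\<integral>s. indicator {a<..b} s * G s \<partial>L) / \<alpha>"
proof -
  have 1: "(\<integral>s. indicator {a<..} s * clamp s \<partial>M) - (\<integral>s. indicator {b<..} s * clamp s \<partial>M)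
     = (\<integral>s. indicator {a<..b} s * clamp s \<partial>M)"
    by (subst Bochner_Integration.integral_diff[symmetric])
       (use assms in \<open>auto intro!: int_M bdd_borel_intros clamp_bdd_borel Bochner_Integration.integral_cong split: split_indicator\<close>)
  have 2: "(\<integral>s. indicator {a<..} s * G s \<partial>L) - (\<integral>s. indicator {b<..} s * G s \<partial>L)
     = (\<integral>s. indicator {a<..b} s * G s \<partial>L)"
    by (subst Bochner_Integration.integral_diff[symmetric])
       (use assms in \<open>auto intro!: int_L bdd_borel_intros G_bdd_borel Bochner_Integration.integral_cong split: split_indicator\<close>)
  show ?thesis using 1 unfolding P_def 2[symmetric] diff_divide_distrib by linarith
qed

lemma F_inv: "\<theta> \<in> {lo..hi} \<Longrightarrow> the_inv_into {lo..hi} F (F \<theta>) = \<theta>"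
proof (rule the_inv_into_f_f)
  show "inj_on F {lo..hi}"
    by (rule inj_onI) (metis F_less atLeastAtMost_iff less_irrefl linorder_cases)
qed

lemma F_image: "F ` {lo..hi} = {0..1}"
proof
  show "F ` {lo..hi} \<subseteq> {0..1}" using F_mono[of lo] F_mono[of _ hi] by (auto simp: F_lo F_hi)
  show "{0..1} \<subseteq> F ` {lo..hi}"
  proof
    fix z :: real assume "z \<in> {0..1}"
    then obtain x where "lo \<le> x" "x \<le> hi" "F x = z"
      using IVT'[of F lo z hi] lo_less_hi F_cont by (auto simp: F_lo F_hi continuous_at_imp_continuous_on)
    then show "z \<in> F ` {lo..hi}" by auto
  qed
qed

lemma F_obtain: assumes "z \<in> {0..1}" obtains \<theta> where "\<theta> \<in> {lo..hi}" "z = F \<theta>"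
  using assms unfolding F_image[symmetric] by blast

lemma F_in: "\<theta> \<in> {lo..hi} \<Longrightarrow> F \<theta> \<in> {0..1}"
  using F_image by blast

lemma F_less_1: "lo \<le> \<theta> \<Longrightarrow> \<theta> < hi \<Longrightarrow> F \<theta> < 1"
  using F_less[of \<theta> hi] by (simp add: F_hi)

text \<open>The density cancels against the one in the definition of \<open>H0\<close>.\<close>

lemma tail_integral_H0:
  assumes "\<theta> \<in> {lo..hi}" shows "tail_integral H0 (F \<theta>) = P \<theta>"
proof -
  define fi where "fi s = indicator {lo..hi} s * f s" for s
  have fi[measurable]: "fi \<in> borel_measurable borel" using f_ind_meas by (simp add: fi_def[abs_def])
  have [measurable]: "G \<in> borel_measurable borel" using G_bdd_borel by (rule bdd_borel_measurable)
  have fi_nn: "0 \<le> fi s" for s using f_pos[of s] by (auto simp: fi_def split: split_indicator)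
  have M_eq: "M = density lborel (\<lambda>s. ennreal (fi s))" by (simp add: type_dist_def fi_def)
  define h where "h s = indicator {\<theta>..hi} s * (G s / (\<alpha> * fi s))" for s
  have [measurable]: "h \<in> borel_measurable borel" unfolding h_def by measurable
  have fh: "fi s * h s = indicator {lo..hi} s * (indicator {\<theta>..hi} s * G s) / \<alpha>" for s
    using f_pos[of s] assms by (auto simp: fi_def h_def split: split_indicator)
  have bG: "bdd_borel (\<lambda>s. indicator {\<theta>..hi} s * G s)" by (intro bdd_borel_intros G_bdd_borel) auto
  have L_eq: "L = density lborel (\<lambda>x. ennreal (indicator {lo..hi} x))"
    by (simp add: L_def ennreal_indicator)
  have int_ind: "integrable lborel (\<lambda>s. indicator {lo..hi} s * (indicator {\<theta>..hi} s * G s))"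
    using int_L[OF bG] unfolding L_eq by (subst (asm) integrable_density) auto
  have int_h: "integrable M h"
    unfolding M_eq using fi_nn int_ind by (subst integrable_density) (auto simp: fh)
  have "(\<integral>s. h s \<partial>M) = (\<integral>s. indicator {lo..hi} s * (indicator {\<theta>..hi} s * G s) / \<alpha> \<partial>lborel)"
    unfolding M_eq using fi_nn by (subst integral_density) (auto simp: fh)
  also have "\<dots> = (\<integral>s. indicator {\<theta>..hi} s * G s \<partial>L) / \<alpha>"
    unfolding L_eq using G_bdd_borel by (subst integral_density) (auto simp: bdd_borel_def)
  also have "(\<integral>s. indicator {\<theta>..hi} s * G s \<partial>L) = (\<integral>s. indicator {\<theta><..} s * G s \<partial>L)"
  proof (rule cong_L[OF bG])
    show "AE s in L. indicator {\<theta>..hi} s * G s = indicator {\<theta><..} s * G s"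
      using AE_L_countable[of "{\<theta>}"] by (rule eventually_mono) (auto split: split_indicator)
  qed (auto intro!: bdd_borel_intros G_bdd_borel)
  finally have h: "(\<integral>s. h s \<partial>M) = (\<integral>s. indicator {\<theta><..} s * G s \<partial>L) / \<alpha>" .
  have k: "bdd_borel (\<lambda>s. indicator {\<theta>..hi} s * clamp s)" by (intro bdd_borel_intros clamp_bdd_borel) auto
  have "tail_integral H0 (F \<theta>) = (\<integral>s. indicator {\<theta>..hi} s * clamp s + h s \<partial>M)"
    unfolding tail_integral_def F_inv[OF assms] set_lebesgue_integral_def
    by (rule Bochner_Integration.integral_cong)
       (use assms in \<open>auto simp: H0_def h_def fi_def clamp_id cum_gap_eq split: split_indicator\<close>)
  also have "\<dots> = (\<integral>s. indicator {\<theta>..hi} s * clamp s \<partial>M) + (\<integral>s. h s \<partial>M)"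
    by (rule Bochner_Integration.integral_add[OF int_M[OF k] int_h])
  also have "(\<integral>s. indicator {\<theta>..hi} s * clamp s \<partial>M) = (\<integral>s. indicator {\<theta><..} s * clamp s \<partial>M)"
  proof (rule cong_M[OF k])
    show "AE s in M. indicator {\<theta>..hi} s * clamp s = indicator {\<theta><..} s * clamp s"
      using AE_M_countable[of "{\<theta>}"] by (rule eventually_mono) (auto split: split_indicator)
  qed (auto intro!: bdd_borel_intros clamp_bdd_borel)
  finally show ?thesis by (simp add: h P_def)
qed

lemma integral_Ioc_L:
  assumes "lo \<le> a" "a \<le> b" "b \<le> hi" shows "(\<integral>s. indicator {a<..b} s \<partial>L) = b - a"
proof -
  have "(\<integral>s. (indicator {a<..b} s :: real) \<partial>L) = (\<integral>s. indicator {a..<b} s \<partial>L)"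
  proof (rule cong_L)
    show "AE s in L. indicator {a<..b} s = (indicator {a..<b} s :: real)"
      using AE_L_countable[of "{a, b}"] by (rule eventually_mono) (auto split: split_indicator)
  qed (auto intro!: bdd_borel_intros)
  then show ?thesis using integral_indicator_L[OF assms] by simp
qed

lemma integral_Ioc_M: assumes "a \<le> b" shows "(\<integral>s. indicator {a<..b} s \<partial>M) = F b - F a"
  unfolding F_diff[OF assms] by (simp add: space_M)

text \<open>The bound \<open>K\<close> on \<open>G\<close> is local to the interval. Near
  \<open>lo\<close> it can be taken proportional to \<open>F\<close>, which yields a Lipschitz
  estimate in the coordinate \<open>F\<close> and not only continuity.\<close>

lemma P_abs_diff_le:
  assumes K: "0 \<le> K" "\<And>s. s \<in> {a<..b} \<Longrightarrow> \<bar>G s\<bar> \<le> K" and ab: "lo \<le> a" "a \<le> b" "b \<le> hi"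
  shows "\<bar>P a - P b\<bar> \<le> hi * (F b - F a) + K * (b - a) / \<alpha>"
proof -
  have clamp_le: "\<bar>clamp s\<bar> \<le> hi" for s using clamp_in[of s] lo_pos by auto
  have "\<bar>\<integral>s. indicator {a<..b} s * clamp s \<partial>M\<bar> \<le> (\<integral>s. \<bar>indicator {a<..b} s * clamp s\<bar> \<partial>M)"
    by (rule integral_abs_bound)
  also have "\<dots> \<le> (\<integral>s. hi * indicator {a<..b} s \<partial>M)"
    by (rule integral_mono)
       (use clamp_le in \<open>auto intro!: int_M integrable_abs bdd_borel_intros clamp_bdd_borel split: split_indicator\<close>)
  finally have 1: "\<bar>\<integral>s. indicator {a<..b} s * clamp s \<partial>M\<bar> \<le> hi * (F b - F a)"
    unfolding integral_mult_right_zero integral_Ioc_M[OF ab(2)] .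
  have "\<bar>\<integral>s. indicator {a<..b} s * G s \<partial>L\<bar> \<le> (\<integral>s. \<bar>indicator {a<..b} s * G s\<bar> \<partial>L)"
    by (rule integral_abs_bound)
  also have "\<dots> \<le> (\<integral>s. K * indicator {a<..b} s \<partial>L)"
    by (rule integral_mono)
       (use K in \<open>auto intro!: int_L integrable_abs bdd_borel_intros G_bdd_borel split: split_indicator\<close>)
  finally have "\<bar>\<integral>s. indicator {a<..b} s * G s \<partial>L\<bar> \<le> K * (b - a)"
    unfolding integral_mult_right_zero integral_Ioc_L[OF ab] .
  then have 2: "\<bar>(\<integral>s. indicator {a<..b} s * G s \<partial>L) / \<alpha>\<bar> \<le> K * (b - a) / \<alpha>"
    using \<alpha>_pos by (simp add: abs_divide divide_right_mono)
  show ?thesis unfolding P_diff[OF ab(2)] using 1 2 by linarith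
qed

lemma P_cont: "continuous_on {lo..hi} P"
proof -
  obtain K where K: "0 \<le> K" "\<And>s. \<bar>G s\<bar> \<le> K" using G_bdd_borel by (metis bdd_borel_bound)
  have bd: "\<bar>P x - P \<theta>\<bar> \<le> hi * \<bar>F x - F \<theta>\<bar> + K * \<bar>x - \<theta>\<bar> / \<alpha>" if "x \<in> {lo..hi}" "\<theta> \<in> {lo..hi}" for x \<theta>
    using P_abs_diff_le[OF K(1) K(2), of x \<theta>] P_abs_diff_le[OF K(1) K(2), of \<theta> x] F_mono[of x \<theta>] F_mono[of \<theta> x] that
    by (cases "x \<le> \<theta>") (auto simp: abs_minus_commute)
  show ?thesis
    unfolding continuous_on_def
  proof
    fix \<theta> assume \<theta>: "\<theta> \<in> {lo..hi}"
    have "(F \<longlongrightarrow> F \<theta>) (at \<theta> within {lo..hi})"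
      using F_cont[of \<theta>] unfolding isCont_def by (rule tendsto_within_subset) simp
    then have "((\<lambda>x. hi * \<bar>F x - F \<theta>\<bar> + K * \<bar>x - \<theta>\<bar> / \<alpha>) \<longlongrightarrow> hi * \<bar>F \<theta> - F \<theta>\<bar> + K * \<bar>\<theta> - \<theta>\<bar> / \<alpha>) (at \<theta> within {lo..hi})"
      using \<alpha>_pos by (intro tendsto_intros) auto
    then have *: "((\<lambda>x. hi * \<bar>F x - F \<theta>\<bar> + K * \<bar>x - \<theta>\<bar> / \<alpha>) \<longlongrightarrow> 0) (at \<theta> within {lo..hi})" by simp
    have "((\<lambda>x. P x - P \<theta>) \<longlongrightarrow> 0) (at \<theta> within {lo..hi})"
      by (rule Lim_null_comparison[OF _ *])
         (use bd \<theta> in \<open>auto simp: eventually_at_filter intro!: always_eventually\<close>)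
    then show "(P \<longlongrightarrow> P \<theta>) (at \<theta> within {lo..hi})" by (simp add: LIM_zero_iff)
  qed
qed

section \<open>The concave envelope of the tail integral and its slopes\<close>

abbreviation "\<Phi> \<equiv> tail_integral H0"
abbreviation "E \<equiv> concave_envelope (tail_integral H0)"

lemma Phi_eq: "z \<in> {0..1} \<Longrightarrow> \<Phi> z = P (the_inv_into {lo..hi} F z)"
  using tail_integral_H0 F_inv by (elim F_obtain) simp

lemma Phi_cont: "continuous_on {0..1} \<Phi>"
proof -
  have "continuous_on (F ` {lo..hi}) (the_inv_into {lo..hi} F)"
    by (rule continuous_on_inv) (auto simp: F_inv intro!: continuous_at_imp_continuous_on F_cont)
  then have "continuous_on {0..1} (the_inv_into {lo..hi} F)" by (simp add: F_image)
  moreover have "the_inv_into {lo..hi} F ` {0..1} \<subseteq> {lo..hi}"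
    unfolding F_image[symmetric] using F_inv by auto
  ultimately have "continuous_on {0..1} (\<lambda>z. P (the_inv_into {lo..hi} F z))"
    by (intro continuous_on_compose2[OF P_cont])
  then show ?thesis
    using continuous_on_cong[of "{0..1}" "{0..1}" \<Phi> "\<lambda>z. P (the_inv_into {lo..hi} F z)"] Phi_eq by blast
qed

lemma Phi_bounded: obtains B where "\<And>z. z \<in> {0..1} \<Longrightarrow> \<Phi> z \<le> B"
proof -
  have "bounded (\<Phi> ` {0..1})"
    by (intro compact_imp_bounded compact_continuous_image Phi_cont) auto
  then obtain B where "\<forall>y\<in>\<Phi> ` {0..1}. norm y \<le> B" unfolding bounded_iff by blast
  then have "norm (\<Phi> z) \<le> B" if "z \<in> {0..1}" for z using that by blast
  then show thesis using that by (metis abs_ge_self order_trans real_norm_def)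
qed

text \<open>A Lipschitz bound of \<open>\<Phi>\<close> at \<open>0\<close> holds even where \<open>H0\<close> is unbounded, since \<open>\<bar>G\<bar>\<close> is at
  most a multiple of \<open>F\<close>.\<close>

lemma Phi_le_line_0: obtains k where "\<And>z. z \<in> {0..1} \<Longrightarrow> \<Phi> z \<le> \<Phi> 0 + k * (z - 0)"
proof -
  obtain K where K: "0 \<le> K" "\<And>a b. a \<le> b \<Longrightarrow> \<bar>G b - G a\<bar> \<le> K * (F b - F a)"
    using G_abs_diff_le by blast
  have "P \<theta> \<le> P lo + (hi + K * (hi - lo) / \<alpha>) * (F \<theta> - 0)" if \<theta>: "\<theta> \<in> {lo..hi}" for \<theta>
  proof -
    have F0: "0 \<le> F \<theta>" using F_in[OF \<theta>] by simp
    have "\<bar>P lo - P \<theta>\<bar> \<le> hi * (F \<theta> - F lo) + K * F \<theta> * (\<theta> - lo) / \<alpha>"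
    proof (rule P_abs_diff_le)
      show "\<bar>G s\<bar> \<le> K * F \<theta>" if "s \<in> {lo<..\<theta>}" for s
        using K(2)[of lo s] that mult_left_mono[OF F_mono[of s \<theta>] K(1)] by (simp add: G_lo F_lo)
    qed (use \<theta> K(1) F0 in auto)
    also have "\<dots> \<le> hi * F \<theta> + K * F \<theta> * (hi - lo) / \<alpha>"
      using \<theta> K(1) F0 \<alpha>_pos lo_pos by (intro add_mono divide_right_mono mult_left_mono) (auto simp: F_lo)
    finally show ?thesis by (simp add: algebra_simps)
  qed
  moreover have "\<Phi> 0 = P lo" using tail_integral_H0[of lo] lo_less_hi by (simp add: F_lo)
  ultimately have "\<Phi> z \<le> \<Phi> 0 + (hi + K * (hi - lo) / \<alpha>) * (z - 0)" if "z \<in> {0..1}" for z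
    using F_obtain[OF that] tail_integral_H0 by metis
  then show thesis using that by blast
qed

lemma E_ge: "z \<in> {0..1} \<Longrightarrow> \<Phi> z \<le> E z"
  by (rule Phi_bounded, rule envelope_ge)

lemma E_le_line:
  assumes "\<And>x. x \<in> {0..1} \<Longrightarrow> \<Phi> x \<le> a + b * (x - d)" "z \<in> {0..1}" shows "E z \<le> a + b * (z - d)"
proof -
  obtain B where "\<And>z. z \<in> {0..1} \<Longrightarrow> \<Phi> z \<le> B" using Phi_bounded by blast
  from envelope_le_line[of \<Phi> B z a b d, OF this assms(2,1)] show ?thesis by blast
qed

lemma E_concave: "concave_on {0..1} E"
  by (rule Phi_bounded, rule envelope_concave)

lemma E_0: "E 0 = \<Phi> 0"
proof -
  obtain k where "\<And>z. z \<in> {0..1} \<Longrightarrow> \<Phi> z \<le> \<Phi> 0 + k * (z - 0)" using Phi_le_line_0 by blast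
  from E_le_line[of "\<Phi> 0" k 0, OF this, of 0] show ?thesis using E_ge[of 0] by simp
qed

text \<open>A finite right derivative needs a linear upper bound to the right of \<open>z\<close>:
  at 0 it comes from \<open>\<Phi>\<close>, elsewhere from the chord back to 0.\<close>

lemma E_slope:
  assumes "0 \<le> z" "z < 1"
  shows "\<And>y. y \<in> {0..1} \<Longrightarrow> E y \<le> E z + vector_derivative E (at_right z) * (y - z)"
    and "\<And>K. (\<And>y. z < y \<Longrightarrow> y \<le> 1 \<Longrightarrow> E y \<le> E z + K * (y - z)) \<Longrightarrow> vector_derivative E (at_right z) \<le> K"
proof -
  have "\<exists>K. \<forall>y. z < y \<and> y \<le> 1 \<longrightarrow> E y \<le> E z + K * (y - z)"
  proof (cases "z = 0")
    case True
    obtain k where "\<And>z. z \<in> {0..1} \<Longrightarrow> \<Phi> z \<le> \<Phi> 0 + k * (z - 0)" using Phi_le_line_0 by blast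
    from E_le_line[of "\<Phi> 0" k 0, OF this] show ?thesis
      using True E_0 by (intro exI[of _ k]) simp
  next
    case False
    then have z: "0 < z" using assms by simp
    have "E y \<le> E z + ((E z - E 0) / z) * (y - z)" if y: "z < y" "y \<le> 1" for y
    proof -
      have "u * E 0 + v * E y \<le> E (u * 0 + v * y)" if "0 \<le> u" "0 \<le> v" "u + v = 1" for u v
        using E_concave[unfolded concave_on_iff, THEN conjunct2, rule_format, of 0 y u v] y z that by simp
      from this[of "1 - z / y" "z / y"] have "(1 - z / y) * E 0 + (z / y) * E y \<le> E z" using y z by simp
      then have "y * ((1 - z / y) * E 0 + (z / y) * E y) \<le> y * E z" using y z by simp
      moreover have "y * ((1 - z / y) * E 0 + (z / y) * E y) = (y - z) * E 0 + z * E y"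
        using y z by (simp add: field_simps)
      ultimately have "z * E y \<le> y * E z - (y - z) * E 0" by simp
      then show ?thesis using z by (simp add: field_simps)
    qed
    then show ?thesis by blast
  qed
  then obtain K where K: "\<And>y. z < y \<Longrightarrow> y \<le> 1 \<Longrightarrow> E y \<le> E z + K * (y - z)" by blast
  show "E y \<le> E z + vector_derivative E (at_right z) * (y - z)" if "y \<in> {0..1}" for y
    using concave_right_derivative[OF E_concave assms K] that by metis
  show "vector_derivative E (at_right z) \<le> K'" if "\<And>y. z < y \<Longrightarrow> y \<le> 1 \<Longrightarrow> E y \<le> E z + K' * (y - z)" for K'
    using concave_right_derivative[OF E_concave assms that] by metis
qed

lemma ironed_eq: "lo \<le> \<theta> \<Longrightarrow> \<theta> < hi \<Longrightarrow> ironed H0 \<theta> = - vector_derivative E (at_right (F \<theta>))"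
  using F_less_1[of \<theta>] by (simp add: ironed_def)

text \<open>In the coordinate \<open>F\<close>, minus the ironed value is the slope of a line above
  \<open>E\<close> touching it at \<open>a\<close>. Monotonicity of the ironed function is the sum
  of two such inequalities.\<close>

lemma ironed_supergradient:
  assumes "lo \<le> a" "a < hi" "b \<in> {lo..hi}"
  shows "E (F b) \<le> E (F a) - ironed H0 a * (F b - F a)"
  using E_slope(1)[of "F a" "F b"] F_in[of a] F_in[OF assms(3)] F_less_1[of a] assms by (simp add: ironed_eq)

lemma ironed_mono:
  assumes "lo \<le> a" "a < b" "b < hi" shows "ironed H0 a \<le> ironed H0 b"
proof -
  have "(ironed H0 b - ironed H0 a) * (F b - F a) \<ge> 0"
    using ironed_supergradient[of a b] ironed_supergradient[of b a] assms by (simp add: algebra_simps)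
  then show ?thesis using F_less[of a b] assms by (simp add: zero_le_mult_iff)
qed

text \<open>Condition (b) evaluates \<open>q0\<close> at the single type \<open>lo\<close>, so the
  value there must be tied to the values nearby. Supergradient inequalities at
  \<open>\<theta>\<close> and at \<open>lo\<close>, with \<open>\<theta>\<close> decreasing to
  \<open>lo\<close>, give a line of slope \<open>- p\<close> above \<open>E\<close> to the right of
  0.\<close>

lemma ironed_lo_right_cont:
  assumes "lo < \<theta>1" "\<theta>1 < hi" "\<And>\<theta>. lo < \<theta> \<Longrightarrow> \<theta> < \<theta>1 \<Longrightarrow> p \<le> ironed H0 \<theta>"
  shows "p \<le> ironed H0 lo"
proof -
  have "E y \<le> E 0 + (- p) * (y - 0)" if y: "0 < y" "y \<le> 1" for y
  proof -
    obtain b where b: "b \<in> {lo..hi}" "F b = y" using F_obtain[of y] y by auto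
    have "lo < b" using b y F_lo by (cases "b = lo") auto
    let ?k = "ironed H0 lo"
    have *: "E (F b) \<le> E 0 - ?k * F \<theta> - p * (F b - F \<theta>)" if "lo < \<theta>" "\<theta> < min b \<theta>1" for \<theta>
    proof -
      have "E (F b) \<le> E (F \<theta>) - ironed H0 \<theta> * (F b - F \<theta>)"
        using that b assms by (intro ironed_supergradient) auto
      also have "E (F \<theta>) \<le> E (F lo) - ?k * (F \<theta> - F lo)"
        using that b assms by (intro ironed_supergradient) auto
      finally have "E (F b) \<le> E 0 - ?k * F \<theta> - ironed H0 \<theta> * (F b - F \<theta>)" by (simp add: F_lo)
      moreover have "p * (F b - F \<theta>) \<le> ironed H0 \<theta> * (F b - F \<theta>)"
        using assms(3)[of \<theta>] that F_mono[of \<theta> b] by (intro mult_right_mono) auto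
      ultimately show ?thesis by simp
    qed
    have "isCont (\<lambda>\<theta>. E 0 - ?k * F \<theta> - p * (F b - F \<theta>)) lo" by (intro continuous_intros F_cont)
    then have "((\<lambda>\<theta>. E 0 - ?k * F \<theta> - p * (F b - F \<theta>)) \<longlongrightarrow> E 0 - ?k * F lo - p * (F b - F lo)) (at_right lo)"
      unfolding isCont_def by (rule tendsto_within_subset) simp
    then have "E (F b) \<le> E 0 - ?k * F lo - p * (F b - F lo)"
      by (rule tendsto_lowerbound)
         (use * \<open>lo < b\<close> assms(1) in \<open>auto intro!: eventually_at_rightI[of lo "min b \<theta>1"]\<close>)
    then show ?thesis by (simp add: b F_lo)
  qed
  then have "vector_derivative E (at_right 0) \<le> - p" by (intro E_slope(2)) auto
  then show ?thesis using ironed_eq[of lo] lo_less_hi by (simp add: F_lo)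
qed

section \<open>Contact with the envelope and optimal thresholds\<close>

context
  fixes \<theta>H assumes H: "\<theta>H \<in> {lo..hi}" "\<And>\<theta>. lo \<le> \<theta> \<Longrightarrow> \<theta> \<le> \<theta>H \<Longrightarrow> G \<theta> \<le> 0" "\<And>\<theta>. \<theta>H \<le> \<theta> \<Longrightarrow> \<theta> \<le> hi \<Longrightarrow> 0 \<le> G \<theta>"
begin

text \<open>Where \<open>G\<close> is nonpositive the virtual value is at most the type, hence at
  most \<open>\<theta>H\<close>; where \<open>G\<close> is nonnegative it is at least
  \<open>\<theta>H\<close>. So the line of slope \<open>- \<theta>H\<close> supports
  \<open>\<Phi>\<close>, the envelope touches \<open>\<Phi>\<close> there, and ironing can be
  treated separately below \<open>\<theta>H\<close>.\<close>

lemma Phi_le_line: "z \<in> {0..1} \<Longrightarrow> \<Phi> z \<le> \<Phi> (F \<theta>H) + (- \<theta>H) * (z - F \<theta>H)"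
proof -
  assume "z \<in> {0..1}"
  then obtain \<theta> where \<theta>: "\<theta> \<in> {lo..hi}" "z = F \<theta>" by (rule F_obtain)
  have "P \<theta> \<le> P \<theta>H + (- \<theta>H) * (F \<theta> - F \<theta>H)"
  proof (cases "\<theta> \<le> \<theta>H")
    case True
    have "(\<integral>s. indicator {\<theta><..\<theta>H} s * clamp s \<partial>M) \<le> (\<integral>s. \<theta>H * indicator {\<theta><..\<theta>H} s \<partial>M)"
      by (rule integral_mono)
         (use \<theta> H(1) in \<open>auto intro!: int_M bdd_borel_intros clamp_bdd_borel simp: clamp_id split: split_indicator\<close>)
    moreover have "(\<integral>s. indicator {\<theta><..\<theta>H} s * G s \<partial>L) \<le> (\<integral>s. 0 \<partial>L)"
      by (rule integral_mono)
         (use \<theta> H in \<open>auto intro!: int_L bdd_borel_intros G_bdd_borel split: split_indicator\<close>)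
    then have "(\<integral>s. indicator {\<theta><..\<theta>H} s * G s \<partial>L) / \<alpha> \<le> 0"
      using \<alpha>_pos by (intro divide_nonpos_pos) auto
    ultimately have "P \<theta> - P \<theta>H \<le> \<theta>H * (F \<theta>H - F \<theta>)"
      unfolding P_diff[OF True] integral_mult_right_zero integral_Ioc_M[OF True] by linarith
    then show ?thesis by (simp add: algebra_simps)
  next
    case False
    then have le: "\<theta>H \<le> \<theta>" by simp
    have "(\<integral>s. \<theta>H * indicator {\<theta>H<..\<theta>} s \<partial>M) \<le> (\<integral>s. indicator {\<theta>H<..\<theta>} s * clamp s \<partial>M)"
      by (rule integral_mono)
         (use \<theta> H(1) in \<open>auto intro!: int_M bdd_borel_intros clamp_bdd_borel simp: clamp_id split: split_indicator\<close>)
    moreover have "(\<integral>s. 0 \<partial>L) \<le> (\<integral>s. indicator {\<theta>H<..\<theta>} s * G s \<partial>L)"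
      by (rule integral_mono)
         (use \<theta> H in \<open>auto intro!: int_L bdd_borel_intros G_bdd_borel split: split_indicator\<close>)
    then have "0 \<le> (\<integral>s. indicator {\<theta>H<..\<theta>} s * G s \<partial>L) / \<alpha>"
      using \<alpha>_pos by (intro divide_nonneg_pos) auto
    ultimately have "\<theta>H * (F \<theta> - F \<theta>H) \<le> P \<theta>H - P \<theta>"
      unfolding P_diff[OF le] integral_mult_right_zero integral_Ioc_M[OF le] by linarith
    then show ?thesis by (simp add: algebra_simps)
  qed
  then show ?thesis using \<theta> H(1) by (simp add: tail_integral_H0)
qed

lemma E_H: "E (F \<theta>H) = \<Phi> (F \<theta>H)"
  using E_le_line[OF Phi_le_line, of "F \<theta>H"] E_ge[of "F \<theta>H"] F_in[OF H(1)] by simp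

lemma E_le_line_H: "z \<in> {0..1} \<Longrightarrow> E z \<le> E (F \<theta>H) + (- \<theta>H) * (z - F \<theta>H)"
  unfolding E_H by (rule E_le_line[OF Phi_le_line])

lemma ironed_ge_H: assumes "\<theta>H = lo" shows "lo \<le> ironed H0 lo"
proof -
  have "vector_derivative E (at_right 0) \<le> - lo"
    by (rule E_slope(2)) (use E_le_line_H assms F_lo in auto)
  then show ?thesis using ironed_eq[of lo] lo_less_hi by (simp add: F_lo)
qed

text \<open>If \<open>\<Phi>\<close> were strictly below the envelope, the envelope would be affine
  around \<open>F \<tau>\<close> and the ironed function constant around \<open>\<tau>\<close>,
  whereas it passes there from at most \<open>p\<close> to above \<open>p\<close>.\<close>

lemma E_contact:
  assumes \<tau>: "lo \<le> \<tau>" "\<tau> \<le> \<theta>H"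
    and below: "\<And>\<theta>. lo < \<theta> \<Longrightarrow> \<theta> < \<tau> \<Longrightarrow> ironed H0 \<theta> \<le> p"
    and above: "\<And>\<theta>. \<tau> < \<theta> \<Longrightarrow> \<theta> < \<theta>H \<Longrightarrow> p < ironed H0 \<theta>"
  shows "E (F \<tau>) = P \<tau>"
proof -
  have \<tau>_in: "\<tau> \<in> {lo..hi}" using \<tau> H(1) by auto
  have *: "E (F \<tau>) \<le> \<Phi> (F \<tau>)"
  proof (cases "\<tau> = lo \<or> \<tau> = \<theta>H")
    case True
    then show ?thesis using E_0 E_H F_lo by auto
  next
    case False
    then have \<tau>': "lo < \<tau>" "\<tau> < \<theta>H" using \<tau> by auto
    show ?thesis
    proof (rule ccontr)
      assume "\<not> ?thesis"
      then have less: "\<Phi> (F \<tau>) < E (F \<tau>)" by simp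
      have z: "0 < F \<tau>" "F \<tau> < 1"
        using F_less[of lo \<tau>] F_less_1[of \<tau>] \<tau>' H(1) by (auto simp: F_lo)
      obtain B where B: "\<And>z. z \<in> {0..1} \<Longrightarrow> \<Phi> z \<le> B" using Phi_bounded by blast
      obtain d s where d: "0 < d" "0 \<le> F \<tau> - d" "F \<tau> + d \<le> 1"
        and aff: "\<And>y. \<bar>y - F \<tau>\<bar> \<le> d \<Longrightarrow> E y = E (F \<tau>) + s * (y - F \<tau>)"
        using envelope_affine[of \<Phi> B, OF B Phi_cont z less] by metis
      \<comment> \<open>On an affine piece the supergradient inequalities at distance
        \<open>\<delta>\<close> on both sides pin down the slope.\<close>
      have slope: "ironed H0 \<theta> = - s" if \<theta>: "lo < \<theta>" "\<theta> < hi" "\<bar>F \<theta> - F \<tau>\<bar> < d" for \<theta>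
      proof -
        define \<delta> where "\<delta> = d - \<bar>F \<theta> - F \<tau>\<bar>"
        have \<delta>: "0 < \<delta>" using \<theta> by (simp add: \<delta>_def)
        have y: "\<bar>F \<theta> + \<sigma> - F \<tau>\<bar> \<le> d" "F \<theta> + \<sigma> \<in> {0..1}" if "\<bar>\<sigma>\<bar> = \<delta>" for \<sigma>
          using that d by (auto simp: \<delta>_def abs_if split: if_splits)
        have **: "s * \<sigma> \<le> - ironed H0 \<theta> * \<sigma>" if "\<bar>\<sigma>\<bar> = \<delta>" for \<sigma>
        proof -
          have "E (F \<theta> + \<sigma>) \<le> E (F \<theta>) - ironed H0 \<theta> * \<sigma>"
            using E_slope(1)[of "F \<theta>" "F \<theta> + \<sigma>"] y[OF that] F_in[of \<theta>] F_less_1[of \<theta>] \<theta> by (simp add: ironed_eq)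
          moreover have "E (F \<theta> + \<sigma>) = E (F \<tau>) + s * (F \<theta> + \<sigma> - F \<tau>)" by (rule aff[OF y(1)[OF that]])
          moreover have "E (F \<theta>) = E (F \<tau>) + s * (F \<theta> - F \<tau>)" using aff[of "F \<theta>"] \<theta> by simp
          ultimately show ?thesis by (simp add: algebra_simps)
        qed
        have "s * \<delta> = - ironed H0 \<theta> * \<delta>"
          using **[of \<delta>] **[of "- \<delta>"] \<delta> by (intro antisym) simp_all
        then have "s = - ironed H0 \<theta>" using \<delta> by (metis mult_right_cancel less_irrefl)
        then show ?thesis by simp
      qed
      have "(F \<longlongrightarrow> F \<tau>) (at \<tau>)" using F_cont by (simp add: isCont_def)
      then have "\<forall>\<^sub>F \<theta> in at \<tau>. dist (F \<theta>) (F \<tau>) < d" using d(1) by (rule tendstoD)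
      then obtain r where r: "0 < r" "\<And>\<theta>. \<theta> \<noteq> \<tau> \<Longrightarrow> dist \<theta> \<tau> < r \<Longrightarrow> dist (F \<theta>) (F \<tau>) < d"
        by (auto simp: eventually_at)
      define a where "a = max ((lo + \<tau>) / 2) (\<tau> - r / 2)"
      define b where "b = min ((\<tau> + \<theta>H) / 2) (\<tau> + r / 2)"
      have a: "lo < a" "a < \<tau>" "dist a \<tau> < r"
        using \<tau>' r(1) by (auto simp: a_def dist_real_def less_max_iff_disj)
      have b: "\<tau> < b" "b < \<theta>H" "dist b \<tau> < r"
        using \<tau>' r(1) by (auto simp: b_def dist_real_def min_less_iff_disj)
      have "ironed H0 a = - s" by (rule slope) (use a r(2)[of a] \<tau>' H(1) in \<open>auto simp: dist_real_def\<close>)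
      moreover have "ironed H0 b = - s" by (rule slope) (use b r(2)[of b] \<tau>' H(1) in \<open>auto simp: dist_real_def\<close>)
      ultimately show False using below[of a] above[of b] a b by auto
    qed
  qed
  then show ?thesis using E_ge[OF F_in[OF \<tau>_in]] by (simp add: tail_integral_H0[OF \<tau>_in])
qed

text \<open>The concave function \<open>E z + p * z\<close> increases while the ironed value is at
  most \<open>p\<close> and decreases afterwards, so it is maximal at \<open>F \<tau>\<close>. The
  bound carries over to \<open>P\<close>, which lies below the envelope and touches it at
  \<open>\<tau>\<close>.\<close>

lemma threshold_optimal:
  assumes \<tau>: "lo \<le> \<tau>" "\<tau> \<le> \<theta>H"
    and below: "\<And>\<theta>. lo < \<theta> \<Longrightarrow> \<theta> < \<tau> \<Longrightarrow> ironed H0 \<theta> \<le> p"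
    and above: "\<And>\<theta>. \<tau> < \<theta> \<Longrightarrow> \<theta> < \<theta>H \<Longrightarrow> p < ironed H0 \<theta>"
    and a: "lo \<le> a" "a \<le> \<theta>H"
  shows "P a + p * F a \<le> P \<tau> + p * F \<tau>"
proof -
  have a_in: "a \<in> {lo..hi}" and \<tau>_in: "\<tau> \<in> {lo..hi}" using a \<tau> H(1) by auto
  have "\<exists>k. \<forall>y\<in>{0..1}. E y \<le> E (F \<tau>) + k * (y - F \<tau>)"
  proof (cases "\<tau> = \<theta>H")
    case True
    then show ?thesis using E_le_line_H by blast
  next
    case False
    then show ?thesis using E_slope(1)[of "F \<tau>"] F_in[OF \<tau>_in] F_less_1[of \<tau>] \<tau> H(1) by fastforce
  qed
  then obtain k where k: "\<And>y. y \<in> {0..1} \<Longrightarrow> E y \<le> E (F \<tau>) + k * (y - F \<tau>)" by blast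
  let ?R = "\<lambda>\<theta>. E (F \<tau>) + k * (F \<theta> - F \<tau>) + p * F \<theta>"
  have cont: "isCont ?R \<tau>" by (intro continuous_intros F_cont)
  have step: "E (F a) + p * F a \<le> ?R \<theta>" if \<theta>: "lo < \<theta>" "\<theta> < \<theta>H" "p * (F a - F \<theta>) \<le> ironed H0 \<theta> * (F a - F \<theta>)" for \<theta>
  proof -
    have "E (F a) \<le> E (F \<theta>) - ironed H0 \<theta> * (F a - F \<theta>)"
      using \<theta> a_in H(1) by (intro ironed_supergradient) auto
    moreover have "E (F \<theta>) \<le> E (F \<tau>) + k * (F \<theta> - F \<tau>)" using \<theta> H(1) by (intro k F_in) auto
    ultimately show ?thesis using \<theta>(3) by (simp add: algebra_simps)
  qed
  have "E (F a) + p * F a \<le> ?R \<tau>"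
  proof (cases a \<tau> rule: linorder_cases)
    case less
    have "(?R \<longlongrightarrow> ?R \<tau>) (at_left \<tau>)" using cont unfolding isCont_def by (rule tendsto_within_subset) simp
    then show ?thesis
    proof (rule tendsto_lowerbound)
      show "\<forall>\<^sub>F \<theta> in at_left \<tau>. E (F a) + p * F a \<le> ?R \<theta>"
      proof (rule eventually_at_leftI[OF _ less])
        fix \<theta> assume \<theta>: "\<theta> \<in> {a<..<\<tau>}"
        then have "ironed H0 \<theta> \<le> p" "F a - F \<theta> \<le> 0" using below[of \<theta>] a F_mono[of a \<theta>] by auto
        then show "E (F a) + p * F a \<le> ?R \<theta>"
          using \<theta> a \<tau> by (intro step mult_right_mono_neg) auto
      qed
    qed simp
  next
    case greater
    have "(?R \<longlongrightarrow> ?R \<tau>) (at_right \<tau>)" using cont unfolding isCont_def by (rule tendsto_within_subset) simp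
    then show ?thesis
    proof (rule tendsto_lowerbound)
      show "\<forall>\<^sub>F \<theta> in at_right \<tau>. E (F a) + p * F a \<le> ?R \<theta>"
      proof (rule eventually_at_rightI[OF _ greater])
        fix \<theta> assume \<theta>: "\<theta> \<in> {\<tau><..<a}"
        then have "p \<le> ironed H0 \<theta>" "0 \<le> F a - F \<theta>" using above[of \<theta>] a F_mono[of \<theta> a] by auto
        then show "E (F a) + p * F a \<le> ?R \<theta>"
          using \<theta> a \<tau> by (intro step mult_right_mono) auto
      qed
    qed simp
  next
    case equal
    then show ?thesis by simp
  qed
  moreover have "P a \<le> E (F a)" using E_ge[OF F_in[OF a_in]] by (simp add: tail_integral_H0[OF a_in])
  ultimately show ?thesis using E_contact[OF \<tau> below above] by simp
qed

end

section \<open>Decomposition of the virtual surplus into quality levels\<close>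

definition R :: "real measure" where "R = density lborel (indicator {0..A})"

definition v'_ext :: "real \<Rightarrow> real" where "v'_ext r = v' (max 0 (min A r))"

lemma sets_R: "sets R = sets borel" by (simp add: R_def)

lemma finite_R: "finite_measure R"
  by (rule finite_measureI) (use A_pos in \<open>simp add: R_def emeasure_restricted\<close>)

lemma int_R: "bdd_borel h \<Longrightarrow> integrable R h"
  by (rule bdd_borel_integrable[OF finite_R sets_R])

lemma AE_R: "AE r in R. 0 \<le> r \<and> r < A"
proof -
  have "AE r in lborel. r \<noteq> A" by (rule AE_lborel_singleton)
  moreover have "0 < (indicator {0..A} r :: ennreal) \<longleftrightarrow> r \<in> {0..A}" for r by (auto simp: indicator_def)
  ultimately show ?thesis unfolding R_def by (subst AE_density) auto
qed

lemma v'_ext_bdd_borel: "bdd_borel v'_ext"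
proof -
  have "continuous_on UNIV v'_ext"
    unfolding v'_ext_def by (rule continuous_on_compose2[OF v'_cont]) (use A_pos in \<open>auto intro!: continuous_intros\<close>)
  moreover have "\<bar>v'_ext r\<bar> \<le> v' 0" for r
  proof -
    define m where "m = max 0 (min A r)"
    have "m \<in> {0..A}" using A_pos by (auto simp: m_def)
    then have "0 < v' m" "v' m \<le> v' 0"
      using v'_pos[of m] v'_strict_antimono[of 0 m] by (auto simp: le_less)
    then show ?thesis by (simp add: v'_ext_def m_def)
  qed
  ultimately show ?thesis by (intro bdd_borelI borel_measurable_continuous_onI)
qed

lemma integral_R: "h \<in> borel_measurable borel \<Longrightarrow> (\<integral>r. h r \<partial>R) = (\<integral>r. indicator {0..A} r * h r \<partial>lborel)"
  for h :: "real \<Rightarrow> real"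
proof -
  assume [measurable]: "h \<in> borel_measurable borel"
  have "R = density lborel (\<lambda>x. ennreal (indicator {0..A} x))" by (simp add: R_def ennreal_indicator)
  then show ?thesis by (simp add: integral_density)
qed

lemma v_layer: assumes "q \<in> {0..A}" shows "v q = v 0 + (\<integral>r. indicator {..<q} r * v'_ext r \<partial>R)"
proof -
  have [measurable]: "v'_ext \<in> borel_measurable borel" using v'_ext_bdd_borel by (rule bdd_borel_measurable)
  have "(\<integral>r. indicator {..<q} r * v'_ext r \<partial>R) = (\<integral>r. indicator {0..A} r * (indicator {..<q} r * v'_ext r) \<partial>lborel)"
    by (rule integral_R) simp
  also have "\<dots> = (\<integral>r. indicator {0..q} r *\<^sub>R v'_ext r \<partial>lborel)"
  proof (rule integral_cong_AE)
    show "AE r in lborel. indicator {0..A} r * (indicator {..<q} r * v'_ext r) = indicator {0..q} r *\<^sub>R v'_ext r"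
      using AE_lborel_singleton[of q] by eventually_elim (use assms in \<open>auto split: split_indicator\<close>)
  qed auto
  also have "\<dots> = v q - v 0"
  proof (rule integral_FTC_atLeastAtMost)
    fix r assume r: "0 \<le> r" "r \<le> q"
    then have "(v has_real_derivative v'_ext r) (at r within {0..A})"
      using v_deriv[of r] assms by (simp add: v'_ext_def)
    then have "(v has_real_derivative v'_ext r) (at r within {0..q})"
      using assms by (auto intro: DERIV_subset)
    then show "(v has_vector_derivative v'_ext r) (at r within {0..q})"
      by (simp add: has_real_derivative_iff_has_vector_derivative)
  next
    have "continuous_on {0..q} v'" using v'_cont assms by (auto intro: continuous_on_subset)
    then show "continuous_on {0..q} v'_ext"
      by (rule continuous_on_eq) (use assms in \<open>auto simp: v'_ext_def\<close>)
  qed (use assms in auto)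
  finally show ?thesis by simp
qed

lemma id_layer: assumes "q \<in> {0..A}" shows "q = (\<integral>r. indicator {..<q} r * 1 \<partial>R)"
proof -
  have "(\<integral>r. indicator {..<q} r * (1::real) \<partial>R) = (\<integral>r. indicator {0..A} r * (indicator {..<q} r * 1) \<partial>lborel)"
    by (rule integral_R) simp
  also have "\<dots> = (\<integral>r. indicator {0..<q} r \<partial>lborel)"
    by (rule Bochner_Integration.integral_cong) (use assms in \<open>auto split: split_indicator\<close>)
  also have "\<dots> = q" using assms by simp
  finally show ?thesis by simp
qed

context
  assumes dec: "strict_antimono_on {lo..hi} \<omega>" and le: "mean_weight \<le> \<alpha>"
begin

lemmas cutoff = \<theta>H0_props(1) decreasing_cutoff[OF dec le]

lemma H_in: "\<theta>H0 \<in> {lo..hi}" by (rule cutoff)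

lemma G_nonpos: "lo \<le> \<theta> \<Longrightarrow> \<theta> \<le> \<theta>H0 \<Longrightarrow> G \<theta> \<le> 0" by (rule cutoff)

lemma G_nonneg: "\<theta>H0 \<le> \<theta> \<Longrightarrow> \<theta> \<le> hi \<Longrightarrow> 0 \<le> G \<theta>"
  using G_mono_on[of \<theta>H0 \<theta>] cutoff by auto

text \<open>The contribution to \<open>J / \<alpha>\<close> of the types up to
  \<open>\<theta>H0\<close> after integrating rents by parts, formally the integral of
  \<open>H0 * x - c * w x\<close> against \<open>F\<close>. Since \<open>G\<close> vanishes at both
  ends, the rent \<open>u\<close> does not appear.\<close>

definition virtual_surplus :: "(real \<Rightarrow> real) \<Rightarrow> real" where
  "virtual_surplus x = (\<integral>\<theta>. indicator {lo<..\<theta>H0} \<theta> * surplus x \<theta> \<partial>M)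
     + (\<integral>s. indicator {lo..<\<theta>H0} s * (x s * G s) \<partial>L) / \<alpha>"

lemma J_decomposition:
  assumes x: "adm x"
  shows "J u x = \<alpha> * virtual_surplus x + (\<alpha> * (\<integral>\<theta>. indicator {\<theta>H0<..hi} \<theta> * surplus x \<theta> \<partial>M)
     - (\<integral>\<theta>. indicator {\<theta>H0<..hi} \<theta> * (gap \<theta> * rent u x \<theta>) \<partial>M))"
proof -
  have H: "lo \<le> \<theta>H0" "\<theta>H0 \<le> hi" using H_in by auto
  have "(\<integral>s. indicator {lo..<\<theta>H0} s * (x s * (G \<theta>H0 - G s)) \<partial>L) = (\<integral>s. - (indicator {lo..<\<theta>H0} s * (x s * G s)) \<partial>L)"
    by (rule Bochner_Integration.integral_cong) (auto simp: cutoff(2))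
  then have "(\<integral>\<theta>. indicator {lo<..\<theta>H0} \<theta> * (gap \<theta> * rent u x \<theta>) \<partial>M) = - (\<integral>s. indicator {lo..<\<theta>H0} s * (x s * G s) \<partial>L)"
    using integral_gap_rent[OF x order_refl H, of u] by (simp add: G_lo cutoff(2))
  moreover have "bdd_borel (\<lambda>\<theta>. gap \<theta> * rent u x \<theta>)"
    by (intro bdd_borel_intros gap_bdd_borel rent_bdd_borel adm_bdd_borel[OF x])
  ultimately have "(\<integral>\<theta>. gap \<theta> * rent u x \<theta> \<partial>M) = - (\<integral>s. indicator {lo..<\<theta>H0} s * (x s * G s) \<partial>L)
      + (\<integral>\<theta>. indicator {\<theta>H0<..hi} \<theta> * (gap \<theta> * rent u x \<theta>) \<partial>M)"
    using integral_M_split[OF _ H] by simp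
  moreover have "\<alpha> * (a + b / \<alpha>) = \<alpha> * a + b" for a b using \<alpha>_pos by (simp add: field_simps)
  ultimately show ?thesis
    unfolding J_eq[OF x] virtual_surplus_def integral_M_split[OF surplus_bdd_borel[OF x] H]
    by (simp add: distrib_left)
qed

text \<open>The contribution of the marginal quality at level \<open>r\<close>: it goes to the types
  with \<open>r < w (x \<theta>)\<close>, is worth \<open>v' r\<close> times their virtual value and
  costs \<open>c\<close> per type.\<close>

definition layer :: "(real \<Rightarrow> real) \<Rightarrow> real \<Rightarrow> real" where
  "layer x r = v'_ext r * ((\<integral>\<theta>. indicator {lo<..\<theta>H0} \<theta> * clamp \<theta> * indicator {..<w (x \<theta>)} r \<partial>M)
        + (\<integral>\<theta>. indicator {lo..<\<theta>H0} \<theta> * G \<theta> * indicator {..<w (x \<theta>)} r \<partial>L) / \<alpha>)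
     - c * (\<integral>\<theta>. indicator {lo<..\<theta>H0} \<theta> * indicator {..<w (x \<theta>)} r \<partial>M)"

lemma layer_bdd_borel: assumes "adm x" shows "bdd_borel (layer x)"
proof -
  have q: "(\<lambda>\<theta>. w (x \<theta>)) \<in> borel_measurable borel"
    using adm_w_bdd_borel[OF assms] by (rule bdd_borel_measurable)
  have b: "bdd_borel (\<lambda>\<theta>. indicator {lo<..\<theta>H0} \<theta> * clamp \<theta>)" "bdd_borel (\<lambda>\<theta>. indicator {lo..<\<theta>H0} \<theta> * G \<theta>)"
    "bdd_borel (indicator {lo<..\<theta>H0})"
    by (intro bdd_borel_intros clamp_bdd_borel G_bdd_borel; simp)+
  show ?thesis
    unfolding layer_def
    by (intro bdd_borel_intros v'_ext_bdd_borel bdd_borel_below_graph[OF finite_M sets_M _ q]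
        bdd_borel_below_graph[OF finite_L sets_L _ q] b)
qed

lemma virtual_surplus_layers:
  assumes x: "adm x"
  shows "virtual_surplus x = v 0 * ((\<integral>\<theta>. indicator {lo<..\<theta>H0} \<theta> * clamp \<theta> \<partial>M)
      + (\<integral>s. indicator {lo..<\<theta>H0} s * G s \<partial>L) / \<alpha>) + (\<integral>r. layer x r \<partial>R)"
proof -
  define q where "q \<theta> = w (x \<theta>)" for \<theta>
  have bq: "bdd_borel q" unfolding q_def[abs_def] by (rule adm_w_bdd_borel[OF x])
  have q: "q \<in> borel_measurable borel" using bq by (rule bdd_borel_measurable)
  have q_in: "q \<theta> \<in> {0..A}" for \<theta> using w_in by (simp add: q_def)
  have xq: "x \<theta> = v (q \<theta>)" for \<theta> using v_w[OF adm_range[OF x]] by (simp add: q_def)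
  define a1 where "a1 \<theta> = indicator {lo<..\<theta>H0} \<theta> * clamp \<theta>" for \<theta>
  define a2 where "a2 \<theta> = indicator {lo..<\<theta>H0} \<theta> * G \<theta>" for \<theta>
  define a3 :: "real \<Rightarrow> real" where "a3 \<theta> = indicator {lo<..\<theta>H0} \<theta>" for \<theta>
  have b: "bdd_borel a1" "bdd_borel a2" "bdd_borel a3"
    unfolding a1_def[abs_def] a2_def[abs_def] a3_def[abs_def]
    by (intro bdd_borel_intros clamp_bdd_borel G_bdd_borel; simp)+
  define d where "d \<theta> = (\<integral>r. indicator {..<q \<theta>} r * v'_ext r \<partial>R)" for \<theta>
  have vd: "v (q \<theta>) = v 0 + d \<theta>" for \<theta> using v_layer[OF q_in] by (simp add: d_def)
  have d_eq: "d = (\<lambda>\<theta>. x \<theta> - v 0)" using vd xq by (simp add: fun_eq_iff)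
  have sx: "surplus x \<theta> = clamp \<theta> * (v 0 + d \<theta>) - c * q \<theta>" for \<theta>
    unfolding surplus_def q_def[symmetric] d_eq by simp
  have bd: "bdd_borel d" unfolding d_eq by (intro bdd_borel_intros adm_bdd_borel[OF x])
  define V1 where "V1 r = (\<integral>\<theta>. a1 \<theta> * indicator {..<q \<theta>} r \<partial>M)" for r
  define V2 where "V2 r = (\<integral>\<theta>. a2 \<theta> * indicator {..<q \<theta>} r \<partial>L)" for r
  define V3 where "V3 r = (\<integral>\<theta>. a3 \<theta> * indicator {..<q \<theta>} r \<partial>M)" for r
  have bV: "bdd_borel V1" "bdd_borel V2" "bdd_borel V3"
    unfolding V1_def[abs_def] V2_def[abs_def] V3_def[abs_def]
    by (intro bdd_borel_below_graph finite_M sets_M finite_L sets_L b q)+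
  have F1: "(\<integral>\<theta>. a1 \<theta> * d \<theta> \<partial>M) = (\<integral>r. v'_ext r * V1 r \<partial>R)"
    unfolding d_def V1_def by (rule Fubini_below_graph[OF finite_M sets_M finite_R sets_R b(1) v'_ext_bdd_borel q])
  have F2: "(\<integral>\<theta>. a2 \<theta> * d \<theta> \<partial>L) = (\<integral>r. v'_ext r * V2 r \<partial>R)"
    unfolding d_def V2_def by (rule Fubini_below_graph[OF finite_L sets_L finite_R sets_R b(2) v'_ext_bdd_borel q])
  have F3: "(\<integral>\<theta>. a3 \<theta> * q \<theta> \<partial>M) = (\<integral>r. V3 r \<partial>R)"
    using Fubini_below_graph[OF finite_M sets_M finite_R sets_R b(3) bdd_borel_const[of 1] q] id_layer[OF q_in]
    by (simp add: V3_def)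
  have "(\<integral>\<theta>. indicator {lo<..\<theta>H0} \<theta> * surplus x \<theta> \<partial>M) = (\<integral>\<theta>. (v 0 * a1 \<theta> + 1 * (a1 \<theta> * d \<theta>)) + (- c) * (a3 \<theta> * q \<theta>) \<partial>M)"
    by (rule Bochner_Integration.integral_cong) (auto simp: sx a1_def a3_def algebra_simps)
  also have "\<dots> = v 0 * (\<integral>\<theta>. a1 \<theta> \<partial>M) + (\<integral>r. v'_ext r * V1 r \<partial>R) - c * (\<integral>r. V3 r \<partial>R)"
    by (subst integral_M_lincomb) (auto intro!: bdd_borel_intros b bd bq simp: F1 F3)
  finally have 1: "(\<integral>\<theta>. indicator {lo<..\<theta>H0} \<theta> * surplus x \<theta> \<partial>M)
      = v 0 * (\<integral>\<theta>. a1 \<theta> \<partial>M) + (\<integral>r. v'_ext r * V1 r \<partial>R) - c * (\<integral>r. V3 r \<partial>R)" .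
  have "(\<integral>s. indicator {lo..<\<theta>H0} s * (x s * G s) \<partial>L) = (\<integral>\<theta>. v 0 * a2 \<theta> + a2 \<theta> * d \<theta> \<partial>L)"
    by (rule Bochner_Integration.integral_cong) (auto simp: a2_def xq vd algebra_simps)
  also have "\<dots> = v 0 * (\<integral>\<theta>. a2 \<theta> \<partial>L) + (\<integral>r. v'_ext r * V2 r \<partial>R)"
    by (subst Bochner_Integration.integral_add) (auto intro!: int_L bdd_borel_intros b bd simp: F2)
  finally have 2: "(\<integral>s. indicator {lo..<\<theta>H0} s * (x s * G s) \<partial>L)
      = v 0 * (\<integral>\<theta>. a2 \<theta> \<partial>L) + (\<integral>r. v'_ext r * V2 r \<partial>R)" .
  have iR: "integrable R (\<lambda>r. v'_ext r * V1 r)" "integrable R (\<lambda>r. v'_ext r * V2 r)" "integrable R V3"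
    by (intro int_R bdd_borel_intros bV v'_ext_bdd_borel)+
  have "(\<integral>r. layer x r \<partial>R) = (\<integral>r. (v'_ext r * V1 r + (v'_ext r * V2 r) / \<alpha>) - c * V3 r \<partial>R)"
    by (rule Bochner_Integration.integral_cong)
       (auto simp: layer_def V1_def V2_def V3_def a1_def a2_def a3_def q_def algebra_simps)
  also have "\<dots> = (\<integral>r. v'_ext r * V1 r \<partial>R) + (\<integral>r. v'_ext r * V2 r \<partial>R) / \<alpha> - c * (\<integral>r. V3 r \<partial>R)"
    using iR by simp
  finally show ?thesis
    unfolding virtual_surplus_def 1 2 a1_def[symmetric] a2_def[symmetric]
    by (simp add: algebra_simps add_divide_distrib)
qed

text \<open>The layer depends on the allocation only through the threshold, so comparing allocations
  becomes comparing thresholds. Behaviour at \<open>\<tau>\<close> itself is a null event.\<close>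

lemma layer_threshold:
  assumes x: "adm x" and r: "0 \<le> r" "r < A" and \<tau>: "lo \<le> \<tau>" "\<tau> \<le> \<theta>H0"
    and below: "\<And>\<theta>. lo < \<theta> \<Longrightarrow> \<theta> < \<tau> \<Longrightarrow> \<not> r < w (x \<theta>)"
    and above: "\<And>\<theta>. \<tau> < \<theta> \<Longrightarrow> \<theta> < \<theta>H0 \<Longrightarrow> r < w (x \<theta>)"
  shows "layer x r = v' r * ((P \<tau> + c / v' r * F \<tau>) - (P \<theta>H0 + c / v' r * F \<theta>H0))"
proof -
  have q: "(\<lambda>\<theta>. w (x \<theta>)) \<in> borel_measurable borel"
    using adm_w_bdd_borel[OF x] by (rule bdd_borel_measurable)
  have b: "bdd_borel (\<lambda>\<theta>. indicator {..<w (x \<theta>)} r)"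
  proof (rule bdd_borelI[of _ 1])
    have "(\<lambda>\<theta>. indicator {..<w (x \<theta>)} r :: real) = (\<lambda>\<theta>. if r < w (x \<theta>) then 1 else 0)" by (auto simp: indicator_def)
    moreover note q[measurable]
    have "(\<lambda>\<theta>. if r < w (x \<theta>) then 1 else 0 :: real) \<in> borel_measurable borel" by measurable
    ultimately show "(\<lambda>\<theta>. indicator {..<w (x \<theta>)} r :: real) \<in> borel_measurable borel" by (simp only:)
  qed (simp add: indicator_def)
  have AE: "AE \<theta> in L. \<theta> \<noteq> lo \<and> \<theta> \<noteq> \<theta>H0 \<and> \<theta> \<noteq> \<tau> \<and> lo < \<theta>"
    using AE_L_countable[of "{lo, \<theta>H0, \<tau>}"] by (rule eventually_mono) auto
  have 1: "(\<integral>\<theta>. indicator {lo<..\<theta>H0} \<theta> * clamp \<theta> * indicator {..<w (x \<theta>)} r \<partial>M) = (\<integral>\<theta>. indicator {\<tau><..\<theta>H0} \<theta> * clamp \<theta> \<partial>M)"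
    by (rule cong_M, intro bdd_borel_intros clamp_bdd_borel b, simp, intro bdd_borel_intros clamp_bdd_borel, simp,
        rule eventually_mono[OF AE[unfolded AE_L_iff_M]])
       (use below above \<tau> in \<open>force split: split_indicator\<close>)
  have 2: "(\<integral>\<theta>. indicator {lo..<\<theta>H0} \<theta> * G \<theta> * indicator {..<w (x \<theta>)} r \<partial>L) = (\<integral>\<theta>. indicator {\<tau><..\<theta>H0} \<theta> * G \<theta> \<partial>L)"
    by (rule cong_L, intro bdd_borel_intros G_bdd_borel b, simp, intro bdd_borel_intros G_bdd_borel, simp,
        rule eventually_mono[OF AE])
       (use below above \<tau> in \<open>force split: split_indicator\<close>)
  have 3: "(\<integral>\<theta>. indicator {lo<..\<theta>H0} \<theta> * indicator {..<w (x \<theta>)} r \<partial>M :: real) = (\<integral>\<theta>. indicator {\<tau><..\<theta>H0} \<theta> \<partial>M)"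
    by (rule cong_M, intro bdd_borel_intros b, simp, intro bdd_borel_intros, simp,
        rule eventually_mono[OF AE[unfolded AE_L_iff_M]])
       (use below above \<tau> in \<open>force split: split_indicator\<close>)
  have v'r: "v'_ext r = v' r" "0 < v' r" using r v'_pos[of r] by (auto simp: v'_ext_def)
  show ?thesis
    unfolding layer_def 1 2 3 P_diff[OF \<tau>(2), symmetric] integral_Ioc_M[OF \<tau>(2)] v'r(1)
    using v'r(2) by (simp add: field_simps)
qed

text \<open>The ironed allocation in units of utility. At \<open>hi\<close> the ironed value may be
  unspecified, so the largest value is taken there, which preserves monotonicity.\<close>

definition x0 :: "real \<Rightarrow> real" where
  "x0 \<theta> = (if \<theta> < hi then v (q0 (max lo \<theta>)) else v A)"

lemma q0_in: "q0 \<theta> \<in> {0..A}" by (simp only: q0_def demand_in)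

lemma x0_eq: "lo \<le> \<theta> \<Longrightarrow> \<theta> < hi \<Longrightarrow> x0 \<theta> = v (q0 \<theta>)"
  by (simp add: x0_def max_def)

lemma q0_mono: "lo \<le> a \<Longrightarrow> a \<le> b \<Longrightarrow> b < hi \<Longrightarrow> q0 a \<le> q0 b"
  using ironed_mono[of a b] by (cases "a = b") (auto simp: q0_def intro: demand_mono)

lemma x0_adm: "adm x0"
  unfolding adm_def
proof (intro conjI allI)
  show "mono x0"
  proof
    fix a b :: real assume "a \<le> b"
    show "x0 a \<le> x0 b"
    proof (cases "b < hi")
      case True
      then show ?thesis
        using \<open>a \<le> b\<close> q0_in lo_less_hi v_mono[OF _ q0_mono[of "max lo a" "max lo b"]] by (auto simp: x0_def)
    next
      case False
      then show ?thesis using v_range[OF q0_in] v0_le_vA by (auto simp: x0_def)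
    qed
  qed
  show "x0 \<theta> \<in> {v 0..v A}" for \<theta>
    using v_range[OF q0_in] v0_le_vA by (auto simp: x0_def)
qed

lemma w_x0: "lo \<le> \<theta> \<Longrightarrow> \<theta> < hi \<Longrightarrow> w (x0 \<theta>) = q0 \<theta>"
  by (simp add: x0_eq w_v[OF q0_in])

lemma q0_gt_iff:
  assumes "0 \<le> r" "r < A" shows "r < q0 \<theta> \<longleftrightarrow> c / v' r < ironed H0 \<theta>"
  using demand_gt_iff[OF assms] v'_pos[of r] assms by (simp add: q0_def field_simps)

text \<open>Holds level by level: the threshold \<open>\<sigma>\<close> of \<open>x0\<close> is
  where the ironed function crosses \<open>c / v' r\<close>, and no other threshold does
  better.\<close>

lemma virtual_surplus_le:
  assumes x: "adm x" shows "virtual_surplus x \<le> virtual_surplus x0"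
proof -
  have H: "lo \<le> \<theta>H0" "\<theta>H0 \<le> hi" using H_in by auto
  have threshold: "\<exists>\<tau>\<ge>lo. \<tau> \<le> \<theta>H0 \<and> (\<forall>\<theta>. lo < \<theta> \<longrightarrow> \<theta> < \<tau> \<longrightarrow> \<not> r < w (y \<theta>))
      \<and> (\<forall>\<theta>. \<tau> < \<theta> \<longrightarrow> \<theta> < \<theta>H0 \<longrightarrow> r < w (y \<theta>))" if y: "adm y" for y r
  proof (rule monotone_threshold[OF H(1), of "\<lambda>\<theta>. r < w (y \<theta>)"])
    show "r < w (y b)" if "a \<le> b" "r < w (y a)" for a b
      using monoD[OF w_mono adm_mono[OF y that(1)]] that(2) by simp
  qed blast
  have "(\<integral>r. layer x r \<partial>R) \<le> (\<integral>r. layer x0 r \<partial>R)"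
  proof (rule integral_mono_AE)
    show "AE r in R. layer x r \<le> layer x0 r"
      using AE_R
    proof eventually_elim
      case (elim r)
      obtain \<tau> where \<tau>: "lo \<le> \<tau>" "\<tau> \<le> \<theta>H0" "\<And>\<theta>. lo < \<theta> \<Longrightarrow> \<theta> < \<tau> \<Longrightarrow> \<not> r < w (x \<theta>)"
        "\<And>\<theta>. \<tau> < \<theta> \<Longrightarrow> \<theta> < \<theta>H0 \<Longrightarrow> r < w (x \<theta>)"
        using threshold[OF x, of r] by blast
      obtain \<sigma> where \<sigma>: "lo \<le> \<sigma>" "\<sigma> \<le> \<theta>H0" "\<And>\<theta>. lo < \<theta> \<Longrightarrow> \<theta> < \<sigma> \<Longrightarrow> \<not> r < w (x0 \<theta>)"
        "\<And>\<theta>. \<sigma> < \<theta> \<Longrightarrow> \<theta> < \<theta>H0 \<Longrightarrow> r < w (x0 \<theta>)"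
        using threshold[OF x0_adm, of r] by blast
      have r: "0 \<le> r" "r < A" using elim by auto
      have "P \<tau> + c / v' r * F \<tau> \<le> P \<sigma> + c / v' r * F \<sigma>"
      proof (rule threshold_optimal[of \<theta>H0 \<sigma> "c / v' r" \<tau>])
        show "ironed H0 \<theta> \<le> c / v' r" if "lo < \<theta>" "\<theta> < \<sigma>" for \<theta>
          using \<sigma>(3)[OF that] that \<sigma>(2) H q0_gt_iff[OF r, of \<theta>] by (simp add: w_x0 not_less)
        show "c / v' r < ironed H0 \<theta>" if "\<sigma> < \<theta>" "\<theta> < \<theta>H0" for \<theta>
          using \<sigma>(4)[OF that] that \<sigma>(1) H q0_gt_iff[OF r, of \<theta>] by (simp add: w_x0)
      qed (use H_in G_nonpos G_nonneg \<sigma> \<tau> in auto)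
      then have "v' r * ((P \<tau> + c / v' r * F \<tau>) - (P \<theta>H0 + c / v' r * F \<theta>H0))
          \<le> v' r * ((P \<sigma> + c / v' r * F \<sigma>) - (P \<theta>H0 + c / v' r * F \<theta>H0))"
        using v'_pos[of r] r by (intro mult_left_mono) auto
      moreover have "layer x r = v' r * ((P \<tau> + c / v' r * F \<tau>) - (P \<theta>H0 + c / v' r * F \<theta>H0))"
        by (rule layer_threshold) (use x r \<tau> in auto)
      moreover have "layer x0 r = v' r * ((P \<sigma> + c / v' r * F \<sigma>) - (P \<theta>H0 + c / v' r * F \<theta>H0))"
        by (rule layer_threshold) (use x0_adm r \<sigma> in auto)
      ultimately show ?case by (simp only:)
    qed
  qed (intro int_R layer_bdd_borel x x0_adm)+
  then show ?thesis unfolding virtual_surplus_layers[OF x] virtual_surplus_layers[OF x0_adm] by simp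
qed

section \<open>Decreasing weights\<close>

text \<open>Capping at \<open>x_LF\<close> makes individual rationality immediate; the cap turns out not to bind.\<close>

definition x_rel :: "real \<Rightarrow> real" where
  "x_rel \<theta> = (if \<theta> \<le> \<theta>H0 then min (x0 \<theta>) (x_LF \<theta>) else x_LF \<theta>)"

text \<open>The rent of the lowest type for which type \<open>\<theta>H0\<close> gets exactly its
  laissez-faire utility; participation then binds for all higher types as well.\<close>

definition u_rel :: real where "u_rel = U_LF \<theta>H0 - (\<integral>s. indicator {..<\<theta>H0} s * x_rel s \<partial>L)"

lemma x_rel_le_LF: "x_rel \<theta> \<le> x_LF \<theta>" by (simp add: x_rel_def)

lemma x_rel_adm: "adm x_rel"
  unfolding adm_def
proof (intro conjI allI)
  show "mono x_rel"
  proof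
    fix a b :: real assume "a \<le> b"
    then show "x_rel a \<le> x_rel b"
      using adm_mono[OF x0_adm, of a b] adm_mono[OF x_LF_adm, of a b] by (auto simp: x_rel_def)
  qed
  show "x_rel \<theta> \<in> {v 0..v A}" for \<theta>
    using adm_range[OF x0_adm, of \<theta>] adm_range[OF x_LF_adm, of \<theta>] by (auto simp: x_rel_def min_def)
qed

lemma rent_x_rel_H: "rent u_rel x_rel \<theta>H0 = U_LF \<theta>H0"
  by (simp add: rent_def u_rel_def)

lemma rent_x_rel_right: assumes "\<theta>H0 \<le> \<theta>" "\<theta> \<le> hi" shows "rent u_rel x_rel \<theta> = U_LF \<theta>"
proof -
  have H: "\<theta>H0 \<in> {lo..hi}" by (rule \<theta>H0_props)
  have "rent u_rel x_rel \<theta> - rent u_rel x_rel \<theta>H0 = (\<integral>s. indicator {\<theta>H0..<\<theta>} s * x_rel s \<partial>L)"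
    by (rule rent_diff[OF adm_bdd_borel[OF x_rel_adm] assms(1)])
  also have "\<dots> = (\<integral>s. indicator {\<theta>H0..<\<theta>} s * x_LF s \<partial>L)"
  proof (rule cong_L)
    show "AE s in L. indicator {\<theta>H0..<\<theta>} s * x_rel s = indicator {\<theta>H0..<\<theta>} s * x_LF s"
      using AE_L_countable[of "{\<theta>H0}"] by (rule eventually_mono) (auto simp: x_rel_def split: split_indicator)
  qed (auto intro!: bdd_borel_intros adm_bdd_borel[OF x_rel_adm] adm_bdd_borel[OF x_LF_adm])
  also have "\<dots> = rent (U_LF lo) x_LF \<theta> - rent (U_LF lo) x_LF \<theta>H0"
    by (rule rent_diff[OF adm_bdd_borel[OF x_LF_adm] assms(1), symmetric])
  also have "\<dots> = U_LF \<theta> - U_LF \<theta>H0"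
    using U_LF_rent[of \<theta>] U_LF_rent[OF H] H assms by simp
  finally show ?thesis by (simp add: rent_x_rel_H)
qed

text \<open>Going down from \<open>\<theta>H0\<close>, where the two utilities agree, the rent falls
  no faster than laissez-faire utility, because of the cap.\<close>

lemma rent_x_rel_left: assumes "lo \<le> \<theta>" "\<theta> \<le> \<theta>H0" shows "U_LF \<theta> \<le> rent u_rel x_rel \<theta>"
proof -
  have H: "\<theta>H0 \<in> {lo..hi}" by (rule \<theta>H0_props)
  have "rent u_rel x_rel \<theta>H0 - rent u_rel x_rel \<theta> = (\<integral>s. indicator {\<theta>..<\<theta>H0} s * x_rel s \<partial>L)"
    by (rule rent_diff[OF adm_bdd_borel[OF x_rel_adm] assms(2)])
  also have "\<dots> \<le> (\<integral>s. indicator {\<theta>..<\<theta>H0} s * x_LF s \<partial>L)"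
    by (rule integral_mono)
       (auto intro!: int_L bdd_borel_intros adm_bdd_borel[OF x_rel_adm] adm_bdd_borel[OF x_LF_adm] x_rel_le_LF split: split_indicator)
  also have "\<dots> = rent (U_LF lo) x_LF \<theta>H0 - rent (U_LF lo) x_LF \<theta>"
    by (rule rent_diff[OF adm_bdd_borel[OF x_LF_adm] assms(2), symmetric])
  also have "\<dots> = U_LF \<theta>H0 - U_LF \<theta>"
    using U_LF_rent[of \<theta>] U_LF_rent[OF H] H assms by simp
  finally show ?thesis by (simp add: rent_x_rel_H)
qed

lemma relaxed_x_rel: "relaxed u_rel x_rel"
  unfolding relaxed_def
proof (intro conjI ballI x_rel_adm)
  show "U_LF \<theta> \<le> rent u_rel x_rel \<theta>" if "\<theta> \<in> {lo..hi}" for \<theta>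
    using rent_x_rel_left[of \<theta>] rent_x_rel_right[of \<theta>] that by (cases "\<theta> \<le> \<theta>H0") auto
qed

text \<open>Capping at laissez-faire raises surplus and, as \<open>G\<close> is nonpositive below
  the cutoff, also the term with \<open>G\<close>. Since \<open>x0\<close> is already optimal,
  neither can change, so the cap acts on a null set only.\<close>

lemma virtual_surplus_x_rel: "virtual_surplus x0 \<le> virtual_surplus x_rel" "AE \<theta> in L. \<theta> < \<theta>H0 \<longrightarrow> x_rel \<theta> = x0 \<theta>"
proof -
  note b = bdd_borel_intros surplus_bdd_borel[OF x_rel_adm] surplus_bdd_borel[OF x0_adm] G_bdd_borel
    adm_bdd_borel[OF x_rel_adm] adm_bdd_borel[OF x0_adm]
  have s_le: "surplus x0 \<theta> \<le> surplus x_rel \<theta>" if "\<theta> \<le> \<theta>H0" for \<theta>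
    using surplus_le_LF[OF x0_adm, of \<theta>] that by (auto simp: surplus_def x_rel_def min_def)
  let ?k = "\<lambda>\<theta>. indicator {lo<..\<theta>H0} \<theta> * surplus x_rel \<theta> - indicator {lo<..\<theta>H0} \<theta> * surplus x0 \<theta>"
  have k_nn: "0 \<le> ?k \<theta>" for \<theta> using s_le[of \<theta>] by (auto split: split_indicator)
  have bk: "bdd_borel ?k" by (intro b) auto
  have kI: "(\<integral>\<theta>. ?k \<theta> \<partial>M) = (\<integral>\<theta>. indicator {lo<..\<theta>H0} \<theta> * surplus x_rel \<theta> \<partial>M) - (\<integral>\<theta>. indicator {lo<..\<theta>H0} \<theta> * surplus x0 \<theta> \<partial>M)"
    by (rule Bochner_Integration.integral_diff) (intro int_M b, simp)+
  have kI_nn: "0 \<le> (\<integral>\<theta>. ?k \<theta> \<partial>M)" by (rule Bochner_Integration.integral_nonneg) (rule k_nn)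
  have "(\<integral>s. indicator {lo..<\<theta>H0} s * (x0 s * G s) \<partial>L) \<le> (\<integral>s. indicator {lo..<\<theta>H0} s * (x_rel s * G s) \<partial>L)"
  proof (rule integral_mono)
    fix s
    have "x0 s * G s \<le> x_rel s * G s" if "lo \<le> s" "s < \<theta>H0"
      using G_nonpos[of s] that by (intro mult_right_mono_neg) (auto simp: x_rel_def)
    then show "indicator {lo..<\<theta>H0} s * (x0 s * G s) \<le> indicator {lo..<\<theta>H0} s * (x_rel s * G s)"
      by (auto split: split_indicator)
  qed (intro int_L b, simp)+
  then have G_le: "(\<integral>s. indicator {lo..<\<theta>H0} s * (x0 s * G s) \<partial>L) / \<alpha> \<le> (\<integral>s. indicator {lo..<\<theta>H0} s * (x_rel s * G s) \<partial>L) / \<alpha>"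
    using \<alpha>_pos by (simp add: divide_right_mono)
  then show "virtual_surplus x0 \<le> virtual_surplus x_rel"
    using kI kI_nn by (simp add: virtual_surplus_def)
  have "virtual_surplus x_rel \<le> virtual_surplus x0" by (rule virtual_surplus_le[OF x_rel_adm])
  then have "(\<integral>\<theta>. ?k \<theta> \<partial>M) = 0"
    using kI kI_nn G_le by (simp add: virtual_surplus_def)
  then have "AE \<theta> in M. ?k \<theta> = 0"
    using integral_nonneg_eq_0_iff_AE[OF int_M[OF bk]] k_nn by simp
  then show "AE \<theta> in L. \<theta> < \<theta>H0 \<longrightarrow> x_rel \<theta> = x0 \<theta>"
    using AE_M_interior unfolding AE_L_iff_M
  proof eventually_elim
    case (elim \<theta>)
    show ?case
    proof
      assume \<theta>: "\<theta> < \<theta>H0"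
      then have eq: "surplus x_rel \<theta> = surplus x0 \<theta>" using elim by simp
      show "x_rel \<theta> = x0 \<theta>"
      proof (rule ccontr)
        assume "x_rel \<theta> \<noteq> x0 \<theta>"
        then have "x_rel \<theta> = x_LF \<theta>" "x0 \<theta> \<noteq> x_LF \<theta>" using \<theta> by (auto simp: x_rel_def min_def split: if_splits)
        then show False using surplus_less_LF[OF x0_adm, of \<theta>] eq by (simp add: surplus_def)
      qed
    qed
  qed
qed

text \<open>The three parts of \<open>J\<close> are optimal separately: virtual surplus by ironing,
  surplus above the cutoff pointwise, and rents above the cutoff because they are costly and sit at
  their floor.\<close>

lemma relaxed_le_x_rel: assumes r: "relaxed u x" shows "J u x \<le> J u_rel x_rel"
proof -
  have x: "adm x" using r by (simp add: relaxed_def)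
  have H: "\<theta>H0 \<in> {lo..hi}" by (rule \<theta>H0_props)
  note b = bdd_borel_intros surplus_bdd_borel[OF x_rel_adm] surplus_bdd_borel[OF x] gap_bdd_borel
    rent_bdd_borel[OF adm_bdd_borel[OF x_rel_adm]] rent_bdd_borel[OF adm_bdd_borel[OF x]]
  have 1: "virtual_surplus x \<le> virtual_surplus x_rel"
    using virtual_surplus_le[OF x] virtual_surplus_x_rel(1) by simp
  have 2: "(\<integral>\<theta>. indicator {\<theta>H0<..hi} \<theta> * surplus x \<theta> \<partial>M) \<le> (\<integral>\<theta>. indicator {\<theta>H0<..hi} \<theta> * surplus x_rel \<theta> \<partial>M)"
  proof (rule integral_mono)
    fix \<theta>
    have "surplus x \<theta> \<le> surplus x_rel \<theta>" if "\<theta>H0 < \<theta>"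
      using surplus_le_LF[OF x, of \<theta>] that by (simp add: surplus_def x_rel_def)
    then show "indicator {\<theta>H0<..hi} \<theta> * surplus x \<theta> \<le> indicator {\<theta>H0<..hi} \<theta> * surplus x_rel \<theta>"
      by (auto split: split_indicator)
  qed (intro int_M b, simp)+
  have 3: "(\<integral>\<theta>. indicator {\<theta>H0<..hi} \<theta> * (gap \<theta> * rent u_rel x_rel \<theta>) \<partial>M) \<le> (\<integral>\<theta>. indicator {\<theta>H0<..hi} \<theta> * (gap \<theta> * rent u x \<theta>) \<partial>M)"
  proof (rule integral_mono)
    fix \<theta>
    have "gap \<theta> * rent u_rel x_rel \<theta> \<le> gap \<theta> * rent u x \<theta>" if "\<theta>H0 < \<theta>" "\<theta> \<le> hi"
      using decreasing_cutoff(3)[OF dec le, of \<theta>] rent_x_rel_right[of \<theta>] r that H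
      by (intro mult_left_mono) (auto simp: relaxed_def)
    then show "indicator {\<theta>H0<..hi} \<theta> * (gap \<theta> * rent u_rel x_rel \<theta>) \<le> indicator {\<theta>H0<..hi} \<theta> * (gap \<theta> * rent u x \<theta>)"
      by (auto split: split_indicator)
  qed (intro int_M b, simp)+
  show ?thesis
    unfolding J_decomposition[OF x] J_decomposition[OF x_rel_adm]
    using 1 2 3 \<alpha>_pos by (intro add_mono diff_mono mult_left_mono) auto
qed

lemma u_rel_eq: "u_rel = U_LF \<theta>H0 - (LINT s:{lo..\<theta>H0}|lborel. v (q0 s))"
proof -
  have H: "\<theta>H0 \<in> {lo..hi}" by (rule \<theta>H0_props)
  have bx: "bdd_borel (\<lambda>s. indicator {..<\<theta>H0} s * x0 s)" by (intro bdd_borel_intros adm_bdd_borel[OF x0_adm]) simp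
  have [measurable]: "x0 \<in> borel_measurable borel" using adm_bdd_borel[OF x0_adm] by (rule bdd_borel_measurable)
  have "(\<integral>s. indicator {..<\<theta>H0} s * x_rel s \<partial>L) = (\<integral>s. indicator {..<\<theta>H0} s * x0 s \<partial>L)"
  proof (rule cong_L)
    show "AE s in L. indicator {..<\<theta>H0} s * x_rel s = indicator {..<\<theta>H0} s * x0 s"
      using virtual_surplus_x_rel(2) by (rule eventually_mono) (auto split: split_indicator)
  qed (auto intro!: bdd_borel_intros adm_bdd_borel[OF x0_adm] adm_bdd_borel[OF x_rel_adm])
  also have "\<dots> = (\<integral>s. indicator {lo..hi} s * (indicator {..<\<theta>H0} s * x0 s) \<partial>lborel)"
    using integral_L_eq[OF bx] by (simp add: set_lebesgue_integral_def)
  also have "\<dots> = (\<integral>s. indicator {lo..\<theta>H0} s * v (q0 s) \<partial>lborel)"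
  proof (rule integral_cong_AE)
    \<comment> \<open>The point \<open>\<theta>H0\<close> is split off because it may be
      \<open>hi\<close>, where \<open>x0\<close> need not equal \<open>v (q0 hi)\<close>.\<close>
    have eq: "indicator {lo..\<theta>H0} s * v (q0 s) = indicator {lo..<\<theta>H0} s * x0 s + v (q0 \<theta>H0) * indicator {\<theta>H0} s" for s
      using H x0_eq[of s] by (auto split: split_indicator)
    show "(\<lambda>s. indicator {lo..\<theta>H0} s * v (q0 s)) \<in> borel_measurable lborel"
      unfolding eq by measurable
    show "AE s in lborel. indicator {lo..hi} s * (indicator {..<\<theta>H0} s * x0 s) = indicator {lo..\<theta>H0} s * v (q0 s)"
      using AE_lborel_singleton[of \<theta>H0]
      by (rule eventually_mono) (use H in \<open>auto simp: eq split: split_indicator\<close>)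
  qed measurable
  finally show ?thesis by (simp add: u_rel_def set_lebesgue_integral_def)
qed

text \<open>With the cutoff at \<open>lo\<close> no type is distorted and condition (b) must fail.
  Indeed the ironed value at \<open>lo\<close> is at least \<open>lo\<close>, so
  \<open>q0 lo\<close> is at least laissez-faire demand, whose gross utility already covers
  \<open>U_LF lo\<close>.\<close>

lemma public_option_condition_false_at_lo:
  assumes "\<theta>H0 = lo" shows "U_LF lo \<le> lo * v (q0 lo)"
proof -
  have "lo \<le> ironed H0 lo"
    by (rule ironed_ge_H[of \<theta>H0]) (use \<theta>H0_props(1) G_nonpos G_nonneg assms in auto)
  then have "v (demand lo) \<le> v (q0 lo)"
    using demand_mono[of lo "ironed H0 lo"] demand_in by (auto simp: q0_def intro!: v_mono)
  then have "lo * v (demand lo) \<le> lo * v (q0 lo)" using lo_pos by simp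
  moreover have "0 \<le> c * demand lo" using demand_in[of lo] c_pos by simp
  ultimately show ?thesis by (simp add: U_LF_eq)
qed

text \<open>Were \<open>x lo\<close> larger, levels slightly above \<open>q0 lo\<close> would be
  served to all types just above \<open>lo\<close>. The ironed function would then exceed the
  corresponding bound near \<open>lo\<close>, hence at \<open>lo\<close>, and \<open>q0 lo\<close>
  would be larger.\<close>

lemma x_lo_le_x0_lo:
  assumes x: "adm x" and AE: "AE \<theta> in L. \<theta> < \<theta>H0 \<longrightarrow> x \<theta> = x0 \<theta>" and H: "lo < \<theta>H0"
  shows "x lo \<le> v (q0 lo)"
proof (rule ccontr)
  assume "\<not> ?thesis"
  then have less: "v (q0 lo) < v (w (x lo))" by (simp add: v_w[OF adm_range[OF x]])
  define Q where "Q = w (x lo)"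
  have Q: "q0 lo < Q" "Q \<le> A" "0 \<le> q0 lo"
    using less v_less_iff[OF q0_in w_in] w_in[of "x lo"] q0_in[of lo] by (auto simp: Q_def)
  define r where "r = (q0 lo + Q) / 2"
  \<comment> \<open>The passage to \<open>lo\<close> gives only a weak inequality at level
    \<open>r\<close>; the lower level \<open>r'\<close> makes it strict.\<close>
  define r' where "r' = (q0 lo + r) / 2"
  have r: "q0 lo < r'" "r' < r" "r < Q" using Q by (auto simp: r_def r'_def)
  have r_bounds: "0 \<le> r" "r < A" "0 \<le> r'" "r' < A" using r Q by auto
  have "c / v' r \<le> ironed H0 lo"
  proof (rule ironed_lo_right_cont[of "(lo + \<theta>H0) / 2"])
    have Hh: "\<theta>H0 \<le> hi" using \<theta>H0_props(1) by simp
    show "c / v' r \<le> ironed H0 \<theta>" if \<theta>: "lo < \<theta>" "\<theta> < (lo + \<theta>H0) / 2" for \<theta>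
    proof -
      obtain s where s: "lo < s" "s < \<theta>" "s < \<theta>H0 \<longrightarrow> x s = x0 s"
        using AE_L_exists[OF AE, of lo \<theta>] \<theta> Hh by auto
      have "x lo \<le> x0 \<theta>"
        using adm_mono[OF x, of lo s] adm_mono[OF x0_adm, of s \<theta>] s \<theta> by auto
      then have "Q \<le> w (x0 \<theta>)" unfolding Q_def by (rule monoD[OF w_mono])
      then have "r < q0 \<theta>" using w_x0[of \<theta>] \<theta> Hh r by simp
      then show ?thesis using q0_gt_iff[OF r_bounds(1,2)] by (simp add: less_imp_le)
    qed
    show "lo < (lo + \<theta>H0) / 2" "(lo + \<theta>H0) / 2 < hi" using H Hh by auto
  qed
  moreover have "c / v' r' < c / v' r"
    using v'_strict_antimono[of r' r] v'_pos[of r] r r_bounds c_pos by (intro divide_strict_left_mono) auto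
  ultimately have "r' < q0 lo" using q0_gt_iff[OF r_bounds(3,4), of lo] by simp
  then show False using r by simp
qed

text \<open>Condition (b) reads \<open>lo * v (q0 lo) < u_rel\<close>. If it fails, a version of the
  relaxed optimum meets the constraint. If it holds, a constrained mechanism tying with the relaxed
  optimum would share its allocation almost everywhere; participation at \<open>\<theta>H0\<close>
  would force \<open>u_rel \<le> u\<close>, while \<open>x lo \<le> v (q0 lo)\<close> caps
  \<open>u\<close> below \<open>u_rel\<close>.\<close>

lemma free_public_option_iff_decreasing:
  "free_public_option_optimal \<longleftrightarrow> (LINT s:{lo..\<theta>H0}|lborel. v (q0 s)) + lo * v (q0 lo) < U_LF \<theta>H0"
proof
  have H: "\<theta>H0 \<in> {lo..hi}" by (rule \<theta>H0_props)
  let ?C = "(LINT s:{lo..\<theta>H0}|lborel. v (q0 s)) + lo * v (q0 lo) < U_LF \<theta>H0"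
  have C_iff: "?C \<longleftrightarrow> lo * v (q0 lo) < u_rel" by (auto simp: u_rel_eq)
  have u_rel_lo: "u_rel = U_LF lo" if "\<theta>H0 = lo"
    using rent_x_rel_H rent_lo[OF adm_bdd_borel[OF x_rel_adm], of u_rel] that by simp
  show ?C if fpo: free_public_option_optimal
  proof (rule ccontr)
    assume "\<not> ?C"
    then have nC: "u_rel \<le> lo * v (q0 lo)" by (simp add: C_iff)
    have "\<exists>z. adm z \<and> no_subsidy u_rel z \<and> (AE s in L. z s = x_rel s)"
    proof (cases "\<theta>H0 = lo")
      case True
      have "AE s in L. x_LF s = x_rel s"
        using AE_L_interior by (rule eventually_mono) (simp add: x_rel_def True)
      then show ?thesis using x_LF_adm no_subsidy_LF u_rel_lo[OF True] by auto
    next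
      case False
      then have "lo < \<theta>H0" using H by simp
      \<comment> \<open>The value at \<open>lo\<close> is set to \<open>x0 lo\<close>, the one in
        condition (b); \<open>x_rel lo\<close> could be smaller because of the cap.\<close>
      define z where "z \<theta> = (if \<theta> \<le> lo then x0 lo else x_rel \<theta>)" for \<theta>
      have x0_le: "x0 lo \<le> x_rel \<theta>" if "lo < \<theta>" for \<theta>
      proof -
        obtain s where s: "lo < s" "s < min \<theta> \<theta>H0" "s < \<theta>H0 \<longrightarrow> x_rel s = x0 s"
          using AE_L_exists[OF virtual_surplus_x_rel(2), of lo "min \<theta> \<theta>H0"] \<open>lo < \<theta>\<close> \<open>lo < \<theta>H0\<close> H
          by (auto simp: min_le_iff_disj)
        then have "x0 lo \<le> x_rel s" using adm_mono[OF x0_adm, of lo s] by simp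
        also have "\<dots> \<le> x_rel \<theta>" using adm_mono[OF x_rel_adm, of s \<theta>] s by simp
        finally show ?thesis .
      qed
      have "adm z"
        unfolding adm_def
      proof (intro conjI allI)
        show "mono z"
        proof
          fix a b :: real assume "a \<le> b"
          then show "z a \<le> z b" using x0_le[of b] adm_mono[OF x_rel_adm, of a b] by (auto simp: z_def)
        qed
        show "z \<theta> \<in> {v 0..v A}" for \<theta>
          using adm_range[OF x0_adm, of lo] adm_range[OF x_rel_adm, of \<theta>] by (auto simp: z_def)
      qed
      moreover have "no_subsidy u_rel z"
        using nC x0_eq[of lo] lo_less_hi by (simp add: no_subsidy_def z_def)
      moreover have "AE s in L. z s = x_rel s"
        using AE_L_interior by (rule eventually_mono) (simp add: z_def)
      ultimately show ?thesis by blast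
    qed
    then obtain z where z: "adm z" "no_subsidy u_rel z" "AE s in L. z s = x_rel s" by blast
    have "relaxed u_rel z" by (rule relaxed_cong_AE[OF relaxed_x_rel z(1,3)]) simp
    moreover have "J u_rel z = J u_rel x_rel" by (rule J_cong_AE[OF z(1) x_rel_adm z(3)])
    ultimately have "\<not> free_public_option_optimal"
      using relaxed_le_x_rel z(2) by (intro not_free_public_option) metis
    then show False using fpo by simp
  qed
  show free_public_option_optimal if C: ?C
  proof -
    have C': "lo * v (q0 lo) < u_rel" using C C_iff by blast
    have "lo < \<theta>H0"
      using C' public_option_condition_false_at_lo u_rel_lo H by (cases "\<theta>H0 = lo") auto
    have "J u x < J u_rel x_rel" if r: "relaxed u x" and n: "no_subsidy u x" for u x
    proof (rule ccontr)
      assume "\<not> ?thesis"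
      then have ge: "J u_rel x_rel \<le> J u x" by simp
      have x: "adm x" using r by (simp add: relaxed_def)
      have "J ((1 - 1/2) * u + 1/2 * u_rel) (mix (1/2) x x_rel) \<le> J u_rel x_rel"
        by (rule relaxed_le_x_rel, rule relaxed_mix[OF r relaxed_x_rel]) auto
      also have "\<dots> \<le> (1 - 1/2) * J u x + 1/2 * J u_rel x_rel" using ge by simp
      finally have AE: "AE \<theta> in L. x \<theta> = x_rel \<theta>"
        by (intro J_mix_strict[OF x x_rel_adm, of "1/2" u u_rel]) auto
      have "rent u_rel x_rel \<theta>H0 \<le> rent u x \<theta>H0"
        using r H by (simp add: rent_x_rel_H relaxed_def)
      also have "\<dots> = rent u x_rel \<theta>H0"
        by (rule rent_cong_AE[OF adm_bdd_borel[OF x] adm_bdd_borel[OF x_rel_adm]])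
           (use AE in \<open>auto elim!: eventually_mono\<close>)
      finally have "u_rel \<le> u" by (simp add: rent_def)
      also have "u \<le> lo * x lo" using n by (simp add: no_subsidy_def)
      also have "\<dots> \<le> lo * v (q0 lo)"
      proof -
        have "AE \<theta> in L. \<theta> < \<theta>H0 \<longrightarrow> x \<theta> = x0 \<theta>"
          using AE virtual_surplus_x_rel(2) by eventually_elim simp
        from x_lo_le_x0_lo[OF x this \<open>lo < \<theta>H0\<close>] show ?thesis using lo_pos by simp
      qed
      finally show False using C' by simp
    qed
    then show ?thesis unfolding free_public_option_iff using relaxed_x_rel by blast
  qed
qed

end

end

theorem proposition3:
  fixes A c lo hi :: real and v v' v'' f \<omega> :: "real \<Rightarrow> real" and \<alpha> :: real
  assumes "screening A c lo hi v v' v'' f \<omega> \<alpha>"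
  defines "FPO \<equiv> screening.free_public_option_optimal A c lo hi v f \<omega> \<alpha>"
    and "E\<omega> \<equiv> screening.mean_weight lo hi f \<omega>"
    and "q\<^sub>0 \<equiv> screening.q0 A c lo hi v f \<omega> \<alpha>"
    and "\<theta>\<^sub>H \<equiv> screening.\<theta>H0 lo hi f \<omega> \<alpha>"
    and "U \<equiv> screening.U_LF A c v"
  shows "(strict_antimono_on {lo..hi} \<omega> \<longrightarrow>
            (FPO \<longleftrightarrow>
               E\<omega> > \<alpha> \<or>
               (E\<omega> \<le> \<alpha> \<and>
                (LINT s:{lo..\<theta>\<^sub>H}|lborel. v (q\<^sub>0 s)) + lo * v (q\<^sub>0 lo) < U \<theta>\<^sub>H))) \<and>
         (strict_mono_on {lo..hi} \<omega> \<longrightarrow> (FPO \<longleftrightarrow> E\<omega> > \<alpha>))"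
proof -
  interpret screening A c lo hi v v' v'' f \<omega> \<alpha> by fact
  have gt: "\<alpha> < mean_weight \<Longrightarrow> free_public_option_optimal"
    by (rule free_public_option_if_mean_weight_gt)
  have "free_public_option_optimal \<longleftrightarrow> mean_weight > \<alpha> \<or>
      (mean_weight \<le> \<alpha> \<and> (LINT s:{lo..\<theta>H0}|lborel. v (q0 s)) + lo * v (q0 lo) < U_LF \<theta>H0)"
    if "strict_antimono_on {lo..hi} \<omega>"
    using gt free_public_option_iff_decreasing[OF that] by (cases "mean_weight \<le> \<alpha>") auto
  moreover have "free_public_option_optimal \<longleftrightarrow> mean_weight > \<alpha>" if "strict_mono_on {lo..hi} \<omega>"
    using gt not_free_public_option_if_increasing[OF that] by (cases "mean_weight \<le> \<alpha>") auto
  ultimately show ?thesis unfolding FPO_def E\<omega>_def q\<^sub>0_def \<theta>\<^sub>H_def U_def by blast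
qed

end
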